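(* Let $(\Omega,\mathcal{F},\mu)$ be a complete finite separable measure space and let $Y$ be a separable Banach space. Let $z\in(0,1]$, let $X:\Omega\to\mathcal{F}(Y)$ be a fuzzy mapping, $A:\Omega\times L_X\to\mathcal{F}(Y)$ a random fuzzy mapping and $a:L_X\to(0,1]$ a function with $(A(\omega,\tilde x))_{a(\tilde x)}\subset (X(\omega))_z$ for all $(\omega,\tilde x)\in\Omega\times L_X$. Suppose that: A.1) (a) $\omega\mapsto (X(\omega))_z:\Omega\to 2^Y$ is a nonempty, convex, weakly compact-valued and integrably bounded correspondence; (b) $\omega\mapsto (X(\omega))_z:\Omega\to 2^Y$ is $\mathcal{F}$-lower measurable. A.2) (a) For each $(\omega,\tilde x)\in\Omega\times L_X$, $(A(\omega,\tilde x))_{a(\tilde x)}$ is non-empty, convex and compact; (b) for each $\tilde x\in L_X$, the correspondence $\omega\mapsto (A(\omega,\tilde x))_{a(\tilde x)}:\Omega\to 2^Y$ has a measurable graph; (c) for each $\omega\in\Omega$, $\tilde x\mapsto (A(\omega,\tilde x))_{a(\tilde x)}:L_X\to 2^Y$ is upper semicontinuous. Then there exists $\tilde x^*\in L_X$ such that $\tilde x^*(\omega)\in (A(\omega,\tilde x^* ))_{a(\tilde x^* )}$ for $\mu$-a.e. $\omega\in\Omega$.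
   Context: Notation: $2^D$ is the set of all non-empty subsets of a set $D$. $\mathcal{F}(Y)$ (not to be confused with the $\sigma$-algebra $\mathcal{F}$) is the collection of all fuzzy sets over $Y$, i.e. functions $A:Y\to[0,1]$; for $a\in[0,1]$ the $a$-cut of $A$ is $(A)_a=\{y\in Y:A(y)\ge a\}$. A fuzzy mapping is a map into $\mathcal{F}(Y)$; a fuzzy mapping $P:\Omega\times Z\to\mathcal{F}(Y)$ is a random fuzzy mapping if for every $z\in Z$ and $a\in[0,1]$ the set-valued map $\omega\mapsto (P(\omega,z))_a$ is ($\mathcal{F}$-lower) measurable. A correspondence $T:\Omega\to 2^Y$ is $\mathcal{F}$-lower measurable if $\{\omega: T(\omega)\cap V\neq\emptyset\}\in\mathcal{F}$ for every open $V\subset Y$; $T$ has a measurable graph if $\{(\omega,y):y\in T(\omega)\}\in\mathcal{F}\otimes\beta(Y)$, $\beta(Y)$ being the norm-Borel $\sigma$-algebra of $Y$. $T$ is integrably bounded if there is $h\in L_1(\mu,\mathbb{R})$ with $\sup\{\|x\|:x\in T(\omega)\}\le h(\omega)$ $\mu$-a.e. $L_1(\mu,Y)$ is the space of (classes of) Bochner integrable functions $\Omega\to Y$. $L_X=\{x\in L_1(\mu,Y): x(\omega)\in (X(\omega))_z\ \mu\text{-a.e.}\}$, with the weak topology of $L_1(\mu,Y)$. A correspondence $T:L_X\to 2^Y$ is upper semicontinuous if $\{\tilde x\in L_X:T(\tilde x)\subset V\}$ is weakly open in $L_X$ for every norm open $V\subset Y$. *)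

theory Defs
  imports "HOL-Analysis.Analysis"
begin

subsection \<open>Fuzzy sets and set-valued maps\<close>

definition fuzzy_sets :: "('y \<Rightarrow> real) set" where
  "fuzzy_sets = {A. \<forall>y. 0 \<le> A y \<and> A y \<le> 1}"

definition fuzzy_cut :: "('y \<Rightarrow> real) \<Rightarrow> real \<Rightarrow> 'y set" where
  "fuzzy_cut A a = {y. a \<le> A y}"

text \<open>Values may be empty here: an \<open>a\<close>-cut of a fuzzy set can be empty.\<close>

definition lower_measurable ::
    "'w measure \<Rightarrow> ('w \<Rightarrow> 'y::topological_space set) \<Rightarrow> bool" where
  "lower_measurable M T \<longleftrightarrow>
     (\<forall>V. open V \<longrightarrow> {\<omega> \<in> space M. T \<omega> \<inter> V \<noteq> {}} \<in> sets M)"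

definition measurable_graph ::
    "'w measure \<Rightarrow> ('w \<Rightarrow> 'y::topological_space set) \<Rightarrow> bool" where
  "measurable_graph M T \<longleftrightarrow>
     {(\<omega>, y). \<omega> \<in> space M \<and> y \<in> T \<omega>} \<in> sets (M \<Otimes>\<^sub>M borel)"

definition integrably_bounded ::
    "'w measure \<Rightarrow> ('w \<Rightarrow> 'y::real_normed_vector set) \<Rightarrow> bool" where
  "integrably_bounded M T \<longleftrightarrow>
     (\<exists>h::'w \<Rightarrow> real. integrable M h \<and> (AE \<omega> in M. \<forall>x \<in> T \<omega>. norm x \<le> h \<omega>))"

definition upper_semicontinuous ::
    "'x topology \<Rightarrow> ('x \<Rightarrow> 'y::topological_space set) \<Rightarrow> bool" where
  "upper_semicontinuous X T \<longleftrightarrow>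
     (\<forall>V. open V \<longrightarrow> openin X {x \<in> topspace X. T x \<subseteq> V})"

definition fuzzy_mapping :: "'w set \<Rightarrow> ('w \<Rightarrow> 'y \<Rightarrow> real) \<Rightarrow> bool" where
  "fuzzy_mapping S X \<longleftrightarrow> (\<forall>\<omega> \<in> S. X \<omega> \<in> fuzzy_sets)"

definition random_fuzzy_mapping ::
    "'w measure \<Rightarrow> 'z set \<Rightarrow> ('w \<Rightarrow> 'z \<Rightarrow> 'y::topological_space \<Rightarrow> real) \<Rightarrow> bool" where
  "random_fuzzy_mapping M Z P \<longleftrightarrow>
     fuzzy_mapping (space M \<times> Z) (\<lambda>(\<omega>, z). P \<omega> z) \<and>
     (\<forall>z \<in> Z. \<forall>a \<in> {0..1}. lower_measurable M (\<lambda>\<omega>. fuzzy_cut (P \<omega> z) a))"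


subsection \<open>Separable measure spaces\<close>

text \<open>Separability of the pseudometric \<open>d(A, B) = \<mu>(A \<triangle> B)\<close> on the measurable sets;
  meant for finite measures only.\<close>

definition separable_measure :: "'w measure \<Rightarrow> bool" where
  "separable_measure M \<longleftrightarrow>
     (\<exists>D \<subseteq> sets M. countable D \<and>
        (\<forall>A \<in> sets M. \<forall>e>0. \<exists>B \<in> D. emeasure M ((A - B) \<union> (B - A)) < ennreal e))"


subsection \<open>Weak topologies\<close>

definition initial_topology :: "'x set \<Rightarrow> ('x \<Rightarrow> real) set \<Rightarrow> 'x topology" where
  "initial_topology S \<Phi> =
     topology_generated_by {{x \<in> S. \<phi> x \<in> U} |\<phi> U. \<phi> \<in> \<Phi> \<and> open U}"

definition weak_topology :: "'y::real_normed_vector topology" where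
  "weak_topology = initial_topology UNIV {\<phi>. bounded_linear \<phi>}"


subsection \<open>Classes of Bochner integrable functions\<close>

text \<open>Points of \<open>L\<^sub>1(\<mu>, Y)\<close> are classes of a.e. equal integrable functions, represented as
  sets of functions. As \<open>AE\<close> only refers to \<open>space M\<close>, the values of a total function
  outside \<open>space M\<close> do not matter.\<close>

definition L1_rel ::
    "'w measure \<Rightarrow> (('w \<Rightarrow> 'y::{banach, second_countable_topology}) \<times> ('w \<Rightarrow> 'y)) set" where
  "L1_rel M = {(f, g). integrable M f \<and> integrable M g \<and> (AE \<omega> in M. f \<omega> = g \<omega>)}"

definition L1_space ::
    "'w measure \<Rightarrow> ('w \<Rightarrow> 'y::{banach, second_countable_topology}) set set" where
  "L1_space M = {f. integrable M f} // L1_rel M"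

definition L1_class ::
    "'w measure \<Rightarrow> ('w \<Rightarrow> 'y::{banach, second_countable_topology}) \<Rightarrow> ('w \<Rightarrow> 'y) set" where
  "L1_class M f = L1_rel M `` {f}"

text \<open>The continuous linear functionals on \<open>L\<^sub>1(\<mu>, Y)\<close>, the vector space operations and the norm
  of classes being given by those of representatives.\<close>

definition L1_dual ::
    "'w measure \<Rightarrow> (('w \<Rightarrow> 'y::{banach, second_countable_topology}) set \<Rightarrow> real) set" where
  "L1_dual M = {\<phi>.
     (\<forall>f g. integrable M f \<longrightarrow> integrable M g \<longrightarrow>
        \<phi> (L1_class M (\<lambda>\<omega>. f \<omega> + g \<omega>)) = \<phi> (L1_class M f) + \<phi> (L1_class M g)) \<and>
     (\<forall>c f. integrable M f \<longrightarrow>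
        \<phi> (L1_class M (\<lambda>\<omega>. c *\<^sub>R f \<omega>)) = c * \<phi> (L1_class M f)) \<and>
     (\<exists>C. \<forall>f. integrable M f \<longrightarrow>
        \<bar>\<phi> (L1_class M f)\<bar> \<le> C * (\<integral>\<omega>. norm (f \<omega>) \<partial>M))}"

definition weak_L1_topology ::
    "'w measure \<Rightarrow> ('w \<Rightarrow> 'y::{banach, second_countable_topology}) set topology" where
  "weak_L1_topology M = initial_topology (L1_space M) (L1_dual M)"

text \<open>For a class \<open>x\<close>, the condition \<open>x(\<omega>) \<in> T(\<omega>)\<close> a.e. does not depend on the representative
  (see \<open>L1_selection_iff\<close>).\<close>

definition L1_selection ::
    "'w measure \<Rightarrow> ('w \<Rightarrow> 'y::{banach, second_countable_topology} set) \<Rightarrow> ('w \<Rightarrow> 'y) set \<Rightarrow> bool" where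
  "L1_selection M T x \<longleftrightarrow> (\<forall>f \<in> x. AE \<omega> in M. f \<omega> \<in> T \<omega>)"

definition L_X ::
    "'w measure \<Rightarrow> ('w \<Rightarrow> 'y::{banach, second_countable_topology} \<Rightarrow> real) \<Rightarrow> real
      \<Rightarrow> ('w \<Rightarrow> 'y) set set" where
  "L_X M X z = {x \<in> L1_space M. L1_selection M (\<lambda>\<omega>. fuzzy_cut (X \<omega>) z) x}"

lemma equiv_L1_rel: "equiv {f. integrable M f} (L1_rel M)"
proof (rule equivI)
  show "trans (L1_rel M)"
    unfolding trans_def L1_rel_def by (auto elim: AE_mp)
  show "sym (L1_rel M)"
    unfolding sym_def L1_rel_def by (auto elim: AE_mp)
qed (auto simp: refl_on_def L1_rel_def)

lemma L1_selection_iff: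
  assumes x: "x \<in> L1_space M"
  shows "L1_selection M T x \<longleftrightarrow> (\<exists>f \<in> x. AE \<omega> in M. f \<omega> \<in> T \<omega>)"
proof
  show "\<exists>f \<in> x. AE \<omega> in M. f \<omega> \<in> T \<omega>" if "L1_selection M T x"
    using that in_quotient_imp_non_empty[OF equiv_L1_rel] x
    unfolding L1_space_def L1_selection_def by blast
next
  assume "\<exists>f \<in> x. AE \<omega> in M. f \<omega> \<in> T \<omega>"
  then obtain f where f: "f \<in> x" "AE \<omega> in M. f \<omega> \<in> T \<omega>"
    by blast
  show "L1_selection M T x"
    unfolding L1_selection_def
  proof
    fix g assume "g \<in> x"
    then have "AE \<omega> in M. f \<omega> = g \<omega>"
      using quotient_eq_iff[OF equiv_L1_rel] x f(1)
      unfolding L1_space_def L1_rel_def by blast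
    with f(2) show "AE \<omega> in M. g \<omega> \<in> T \<omega>"
      by eventually_elim simp
  qed
qed

lemma topspace_initial_topology:
  assumes "\<phi> \<in> \<Phi>"
  shows "topspace (initial_topology S \<Phi>) = S"
proof -
  have "S = {x \<in> S. \<phi> x \<in> UNIV}"
    by simp
  then have "S \<in> {{x \<in> S. \<phi> x \<in> U} |\<phi> U. \<phi> \<in> \<Phi> \<and> open U}"
    using assms open_UNIV by blast
  then show ?thesis
    unfolding initial_topology_def topology_generated_by_topspace by blast
qed

lemma topspace_weak_L1_topology: "topspace (weak_L1_topology M) = L1_space M"
proof -
  have "(\<lambda>_. 0) \<in> L1_dual M"
    by (auto simp: L1_dual_def intro: exI[of _ 0])
  then show ?thesis
    unfolding weak_L1_topology_def by (rule topspace_initial_topology)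
qed

lemma topspace_weak_topology: "topspace weak_topology = UNIV"
  unfolding weak_topology_def
  by (rule topspace_initial_topology[of "\<lambda>_. 0"]) (simp add: bounded_linear_zero)

end

theory Submission
  imports Defs
begin

text \<open>The measurable selections of \<open>\<omega> \<mapsto> (X(\<omega>))\<^sub>z\<close> are coordinatized by countably many bounded
  functionals \<open>f \<mapsto> \<integral>\<^sub>B \<nu>\<^sub>k(f) / (1 + H) d\<mu>\<close>, with \<open>B\<close> from a dense family of measurable sets and
  \<open>\<nu>\<^sub>k\<close> from a norming sequence in the dual of \<open>Y\<close>. A sequence of selections has forward convex
  combinations that converge weakly at almost every point, by minimizing a Hilbert norm and using
  weak compactness of the values. Together with a pointwise representation of the functionals on
  \<open>L\<^sub>1(\<mu>, Y)\<close>, this shows that convergence of the coordinates implies weak convergence in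
  \<open>L\<^sub>1(\<mu>, Y)\<close>.

  Measurable selections of \<open>\<omega> \<mapsto> (A(\<omega>, x))\<^bsub>a(x)\<^esub>\<close> exist by Kuratowski and Ryll-Nardzewski, since cuts of a
  random fuzzy mapping are lower measurable. Brouwer's theorem on a simplex gives approximate fixed
  points: convex combinations of selections chosen at points with nearby coordinates. If \<open>g\<close> is a
  pointwise weak limit of forward convex combinations of these, upper semicontinuity puts the
  combinations at \<open>\<omega>\<close> eventually in every neighbourhood of the norm compact convex set
  \<open>(A(\<omega>, g))\<^bsub>a(g)\<^esub>\<close>, which therefore contains \<open>g(\<omega>)\<close>.\<close>

subsection \<open>Norming sequences of functionals\<close>

text \<open>Two obstacles shape the proof. The points are classes under a weak topology, and the
  dual of L1 need not consist of strongly measurable functions with values in the dual of Y. Both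
  are met by working with genuine functions and with sequences: a limit is always produced at almost
  every point, inside a weakly compact value, after passing to convex combinations of later and
  later members. The passage is harmless because whatever has to survive it is preserved by
  midpoints: membership in \<open>K\<close>, membership in a convex neighbourhood of a compact
  convex value, limits of coordinates, one-sided bounds on a functional. The coordinates then
  identify the limit, since they determine a selection up to null sets.

  The selections taken from the correspondence depend on the point without any regularity. The
  approximate fixed points therefore come from a partition of unity over a finite net of
  coordinates, and their defining property is phrased through arbitrary convex sets, which is the
  form that both upper semicontinuity and the convex combinations can use.\<close>

definition sublinear :: "('a::real_vector \<Rightarrow> real) \<Rightarrow> bool" where
  "sublinear q \<longleftrightarrow> (\<forall>x y. q (x + y) \<le> q x + q y) \<and> (\<forall>c>0. \<forall>x. q (c *\<^sub>R x) \<le> c * q x)"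

lemma sublinear_add: "sublinear q \<Longrightarrow> q (x + y) \<le> q x + q y"
  by (simp add: sublinear_def)

lemma sublinear_scale_le: "sublinear q \<Longrightarrow> c > 0 \<Longrightarrow> q (c *\<^sub>R x) \<le> c * q x"
  by (simp add: sublinear_def)

lemma sublinear_zero:
  assumes "sublinear q"
  shows "q 0 = 0"
proof -
  have "q ((1/2) *\<^sub>R 0) \<le> (1/2) * q 0"
    by (rule sublinear_scale_le[OF assms]) simp
  then have "q 0 \<le> 0" by simp
  moreover have "q (0 + 0) \<le> q 0 + q 0"
    using assms by (rule sublinear_add)
  ultimately show ?thesis by simp
qed

text \<open>The inequality for \<open>1 / c\<close> at \<open>c *\<^sub>R x\<close> reverses the one
  for \<open>c\<close>. Asking only for \<le> in \<open>sublinear\<close> leaves a single direction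
  to check for the infima constructed below.\<close>

lemma sublinear_scale:
  assumes q: "sublinear q" and c: "c \<ge> 0"
  shows "q (c *\<^sub>R x) = c * q x"
proof (cases "c = 0")
  case True
  then show ?thesis using sublinear_zero[OF q] by simp
next
  case False
  then have c: "c > 0" using c by simp
  have "q ((1 / c) *\<^sub>R (c *\<^sub>R x)) \<le> (1 / c) * q (c *\<^sub>R x)"
    by (rule sublinear_scale_le[OF q]) (use c in simp)
  then have "c * q x \<le> q (c *\<^sub>R x)"
    using c by (simp add: field_simps)
  moreover have "q (c *\<^sub>R x) \<le> c * q x"
    using q c by (rule sublinear_scale_le)
  ultimately show ?thesis by simp
qed

lemma sublinear_uminus_ge:
  assumes "sublinear q"
  shows "- q (- x) \<le> q x"
  using sublinear_add[OF assms, of x "- x"] sublinear_zero[OF assms] by simp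

text \<open>A sublinear functional that is minimal must coincide with all its directional modifications
  below, which forces it to be additive. This yields Hahn--Banach without extending linear maps.\<close>

lemma sublinear_directional:
  fixes q :: "'a::real_vector \<Rightarrow> real" and y :: 'a
  assumes q: "sublinear q"
  defines "r \<equiv> \<lambda>x. INF t\<in>{0..}. q (x + t *\<^sub>R y) - t * q y"
  shows "sublinear r" and "r \<le> q" and "r x \<le> q (x + y) - q y"
proof -
  have bdd: "bdd_below ((\<lambda>t. q (x + t *\<^sub>R y) - t * q y) ` {0..})" for x
  proof (rule bdd_belowI2)
    fix t :: real assume "t \<in> {0..}"
    then have "t * q y = q (t *\<^sub>R y)"
      using sublinear_scale[OF q] by simp
    also have "\<dots> \<le> q (x + t *\<^sub>R y) + q (- x)"
      using sublinear_add[OF q, of "x + t *\<^sub>R y" "- x"] by simp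
    finally show "- q (- x) \<le> q (x + t *\<^sub>R y) - t * q y" by simp
  qed
  have le: "r x \<le> q (x + t *\<^sub>R y) - t * q y" if "t \<ge> 0" for x t
    unfolding r_def using that by (intro cINF_lower[OF bdd]) simp
  have ge: "b \<le> r x" if "\<And>t. t \<ge> 0 \<Longrightarrow> b \<le> q (x + t *\<^sub>R y) - t * q y" for x b
    unfolding r_def using that by (intro cINF_greatest) auto
  show "sublinear r"
    unfolding sublinear_def
  proof (intro conjI allI impI)
    fix x1 x2
    \<comment> \<open>Parameters t and s of the two infima combine to the parameter t + s, so the
      infima can be taken one after the other.\<close>
    have "r (x1 + x2) - (q (x1 + t *\<^sub>R y) - t * q y) \<le> r x2" if t: "t \<ge> 0" for t
    proof -
      have "r (x1 + x2) - (q (x1 + t *\<^sub>R y) - t * q y) \<le> q (x2 + s *\<^sub>R y) - s * q y" if s: "s \<ge> 0" for s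
      proof -
        have "r (x1 + x2) \<le> q ((x1 + x2) + (t + s) *\<^sub>R y) - (t + s) * q y"
          using s t by (intro le) simp
        also have "(x1 + x2) + (t + s) *\<^sub>R y = (x1 + t *\<^sub>R y) + (x2 + s *\<^sub>R y)"
          by (simp add: algebra_simps)
        finally show ?thesis
          using sublinear_add[OF q, of "x1 + t *\<^sub>R y" "x2 + s *\<^sub>R y"] by (simp add: algebra_simps)
      qed
      then show ?thesis by (rule ge)
    qed
    then have "r (x1 + x2) - r x2 \<le> q (x1 + t *\<^sub>R y) - t * q y" if "t \<ge> 0" for t
      using that by (simp add: algebra_simps)
    then have "r (x1 + x2) - r x2 \<le> r x1"
      by (rule ge)
    then show "r (x1 + x2) \<le> r x1 + r x2" by simp
  next
    fix c :: real and x assume c: "c > 0"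
    have "r (c *\<^sub>R x) / c \<le> q (x + t *\<^sub>R y) - t * q y" if t: "t \<ge> 0" for t
    proof -
      have "r (c *\<^sub>R x) \<le> q (c *\<^sub>R x + (c * t) *\<^sub>R y) - (c * t) * q y"
        using c t by (intro le) simp
      also have "c *\<^sub>R x + (c * t) *\<^sub>R y = c *\<^sub>R (x + t *\<^sub>R y)"
        by (simp add: algebra_simps)
      also have "q \<dots> = c * q (x + t *\<^sub>R y)"
        using c by (intro sublinear_scale[OF q]) simp
      finally show ?thesis using c by (simp add: field_simps)
    qed
    then have "r (c *\<^sub>R x) / c \<le> r x"
      by (rule ge)
    then show "r (c *\<^sub>R x) \<le> c * r x" using c by (simp add: field_simps)
  qed
  show "r \<le> q"
    using le[of 0] by (auto simp: le_fun_def)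
  show "r x \<le> q (x + y) - q y"
    using le[of 1] by simp
qed

text \<open>Zorn's lemma for the reversed pointwise order. The infimum of a chain is finite because
  every member q satisfies -p(-x) \<le> -q(-x) \<le> q x, and subadditive because of two members one
  lies below the other.\<close>

lemma minimal_sublinear:
  fixes p :: "'a::real_vector \<Rightarrow> real"
  assumes p: "sublinear p"
  obtains f where "sublinear f" "f \<le> p" "\<And>g. sublinear g \<Longrightarrow> g \<le> f \<Longrightarrow> g = f"
proof -
  define A where "A = {q. sublinear q \<and> q \<le> p}"
  have "\<exists>m\<in>A. \<forall>q\<in>A. q \<le> m \<longrightarrow> q = m"
  proof (rule predicate_Zorn[of A "\<lambda>q r. r \<le> q"])
    show "partial_order_on A (relation_of (\<lambda>q r. r \<le> q) A)"
      by (rule partial_order_on_relation_ofI) auto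
  next
    fix C assume "C \<in> Chains (relation_of (\<lambda>q r. r \<le> q) A)"
    then have C: "C \<subseteq> A" and chain: "\<And>q r. q \<in> C \<Longrightarrow> r \<in> C \<Longrightarrow> q \<le> r \<or> r \<le> q"
      by (auto simp: Chains_def relation_of_def)
    show "\<exists>u\<in>A. \<forall>q\<in>C. u \<le> q"
    proof (cases "C = {}")
      case True
      then show ?thesis using p by (auto simp: A_def)
    next
      case False
      define u where "u = (\<lambda>x. INF q\<in>C. q x)"
      have sub: "sublinear q" "q \<le> p" if "q \<in> C" for q
        using that C by (auto simp: A_def)
      have bdd: "bdd_below ((\<lambda>q. q x) ` C)" for x
      proof (rule bdd_belowI2)
        fix q assume "q \<in> C"
        then show "- p (- x) \<le> q x"
          using sublinear_uminus_ge[OF sub(1), of q x] le_funD[OF sub(2), of q "- x"] by simp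
      qed
      have le: "u x \<le> q x" if "q \<in> C" for q x
        unfolding u_def using that by (rule cINF_lower[OF bdd])
      have ge: "b \<le> u x" if "\<And>q. q \<in> C \<Longrightarrow> b \<le> q x" for b x
        unfolding u_def using False that by (rule cINF_greatest)
      have "sublinear u"
        unfolding sublinear_def
      proof (intro conjI allI impI)
        fix x y
        have *: "u (x + y) \<le> q x + r y" if q: "q \<in> C" "r \<in> C" for q r
        proof -
          consider "q \<le> r" | "r \<le> q" using chain[OF q] by blast
          then show ?thesis
          proof cases
            case 1
            then show ?thesis
              using le[OF q(1), of "x + y"] sublinear_add[OF sub(1)[OF q(1)], of x y] le_funD[OF 1, of y] by linarith
          next
            case 2
            then show ?thesis
              using le[OF q(2), of "x + y"] sublinear_add[OF sub(1)[OF q(2)], of x y] le_funD[OF 2, of x] by linarith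
          qed
        qed
        have "u (x + y) - q x \<le> u y" if "q \<in> C" for q
          using *[OF that] by (intro ge) (simp add: diff_le_eq add.commute)
        then have "u (x + y) - u y \<le> u x"
          by (intro ge) (simp add: diff_le_eq add.commute)
        then show "u (x + y) \<le> u x + u y" by simp
      next
        fix c :: real and x assume c: "c > 0"
        have "u (c *\<^sub>R x) / c \<le> u x"
        proof (rule ge)
          fix q assume q: "q \<in> C"
          have "u (c *\<^sub>R x) \<le> c * q x"
            using le[OF q, of "c *\<^sub>R x"] sublinear_scale[OF sub(1)[OF q], of c x] c by simp
          then show "u (c *\<^sub>R x) / c \<le> q x" using c by (simp add: field_simps)
        qed
        then show "u (c *\<^sub>R x) \<le> c * u x" using c by (simp add: field_simps)
      qed
      moreover have "u \<le> p"
      proof (rule le_funI)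
        fix x
        obtain q where "q \<in> C" using False by blast
        then show "u x \<le> p x" using le[of q x] le_funD[OF sub(2), of q x] by linarith
      qed
      ultimately show ?thesis
        using le by (intro bexI[of _ u]) (auto simp: A_def le_fun_def)
    qed
  qed
  then obtain m where m: "m \<in> A" "\<And>q. q \<in> A \<Longrightarrow> q \<le> m \<Longrightarrow> q = m" by blast
  show thesis
  proof (rule that[of m])
    show "sublinear m" "m \<le> p" using m(1) by (auto simp: A_def)
    show "g = m" if "sublinear g" "g \<le> m" for g
      using that m \<open>m \<le> p\<close> by (auto simp: A_def intro: order_trans)
  qed
qed

text \<open>The direction \<open>y\<close> is built into the upper bound first: the modification
  \<open>p\<close> of the norm satisfies p(-y) \<le> -norm y, so any linear functional below
  \<open>p\<close> takes the value norm y at y. Minimality below \<open>p\<close> then supplies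
  linearity.\<close>

lemma hahn_banach_norming:
  fixes y :: "'a::real_normed_vector"
  obtains f :: "'a \<Rightarrow> real" where "bounded_linear f" "\<And>x. \<bar>f x\<bar> \<le> norm x" "f y = norm y"
proof -
  have n: "sublinear (norm :: 'a \<Rightarrow> real)"
    by (simp add: sublinear_def norm_triangle_ineq)
  define p where "p = (\<lambda>x. INF t\<in>{0..}. norm (x + t *\<^sub>R y) - t * norm y)"
  have p: "sublinear p" "p \<le> norm"
    unfolding p_def by (intro sublinear_directional[OF n])+
  have py: "p (- y) \<le> - norm y"
    using sublinear_directional(3)[OF n, of "- y" y] by (simp add: p_def)
  obtain f where f: "sublinear f" "f \<le> p" and min: "\<And>g. sublinear g \<Longrightarrow> g \<le> f \<Longrightarrow> g = f"
    using minimal_sublinear[OF p(1)] by metis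
  have add: "f (u + w) = f u + f w" for u w
  proof (rule antisym)
    show "f (u + w) \<le> f u + f w" using f(1) by (rule sublinear_add)
    \<comment> \<open>By minimality \<open>f\<close> equals its own modification in direction w,
      whose value at u is at most f(u + w) - f w.\<close>
    have "(\<lambda>x. INF t\<in>{0..}. f (x + t *\<^sub>R w) - t * f w) = f"
      by (intro min sublinear_directional[OF f(1)])
    from fun_cong[OF this, of u] have "f u \<le> f (u + w) - f w"
      using sublinear_directional(3)[OF f(1), of u w] by linarith
    then show "f u + f w \<le> f (u + w)" by simp
  qed
  have neg: "f (- u) = - f u" for u
    using add[of u "- u"] sublinear_zero[OF f(1)] by simp
  have scale: "f (c *\<^sub>R u) = c * f u" for c u
  proof (cases "c \<ge> 0")
    case True
    then show ?thesis using sublinear_scale[OF f(1)] by simp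
  next
    case False
    then have "f ((- c) *\<^sub>R u) = (- c) * f u"
      by (intro sublinear_scale[OF f(1)]) simp
    then show ?thesis using neg[of "c *\<^sub>R u"] by simp
  qed
  have le: "f x \<le> norm x" for x
    by (rule order_trans[OF le_funD[OF f(2)] le_funD[OF p(2)]])
  have abs_le: "\<bar>f x\<bar> \<le> norm x" for x
    using le[of x] le[of "- x"] neg[of x] by simp
  have "f (- y) \<le> - norm y"
    by (rule order_trans[OF le_funD[OF f(2)] py])
  then have "f y = norm y"
    using neg[of y] le[of y] by simp
  moreover have "bounded_linear f"
    by (rule bounded_linear_intro[of f 1]) (use add scale abs_le in auto)
  ultimately show thesis using that abs_le by blast
qed

definition norming_sequence :: "(nat \<Rightarrow> 'a::real_normed_vector \<Rightarrow> real) \<Rightarrow> bool" where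
  "norming_sequence \<nu> \<longleftrightarrow> (\<forall>k. bounded_linear (\<nu> k)) \<and> (\<forall>k x. \<bar>\<nu> k x\<bar> \<le> norm x) \<and>
     (\<forall>x. norm x = (SUP k. \<bar>\<nu> k x\<bar>))"

lemma dense_sequence:
  obtains e :: "nat \<Rightarrow> 'a::{metric_space, second_countable_topology}"
  where "\<And>x \<delta>. \<delta> > 0 \<Longrightarrow> \<exists>k. dist x (e k) < \<delta>"
proof -
  obtain D :: "'a set" where D: "countable D" "\<And>U. open U \<Longrightarrow> U \<noteq> {} \<Longrightarrow> \<exists>d\<in>D. d \<in> U"
    using countable_dense_setE by blast
  have "\<exists>k. dist x (from_nat_into D k) < \<delta>" if "\<delta> > 0" for x \<delta>
  proof -
    obtain d where "d \<in> D" "d \<in> ball x \<delta>"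
      using D(2)[OF open_ball, of x \<delta>] \<open>\<delta> > 0\<close> by fastforce
    then show ?thesis
      using from_nat_into_surj[OF D(1)] by (metis mem_ball)
  qed
  then show thesis by (rule that)
qed

text \<open>Functionals that norm the points of a dense sequence are enough: replacing x by a nearby
  \<open>e k\<close> moves the norm and the value of \<open>\<nu> k\<close> each by at most the
  distance, which is why \<delta>/2 is asked for.\<close>

lemma norming_sequence_exists:
  obtains \<nu> :: "nat \<Rightarrow> 'a::{real_normed_vector, second_countable_topology} \<Rightarrow> real"
  where "norming_sequence \<nu>"
proof -
  obtain e :: "nat \<Rightarrow> 'a" where e: "\<And>x \<delta>. \<delta> > 0 \<Longrightarrow> \<exists>k. dist x (e k) < \<delta>"
    using dense_sequence by blast
  have "\<forall>k. \<exists>f :: 'a \<Rightarrow> real. bounded_linear f \<and> (\<forall>x. \<bar>f x\<bar> \<le> norm x) \<and> f (e k) = norm (e k)"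
    by (metis hahn_banach_norming)
  then obtain \<nu> :: "nat \<Rightarrow> 'a \<Rightarrow> real"
    where \<nu>: "\<And>k. bounded_linear (\<nu> k)" "\<And>k x. \<bar>\<nu> k x\<bar> \<le> norm x" "\<And>k. \<nu> k (e k) = norm (e k)"
    by metis
  have "norm x = (SUP k. \<bar>\<nu> k x\<bar>)" for x
  proof (rule antisym)
    have bdd: "bdd_above (range (\<lambda>k. \<bar>\<nu> k x\<bar>))"
      by (rule bdd_aboveI2[of _ _ "norm x"]) (rule \<nu>(2))
    show "norm x \<le> (SUP k. \<bar>\<nu> k x\<bar>)"
    proof (rule field_le_epsilon)
      fix \<delta> :: real assume "\<delta> > 0"
      then obtain k where k: "dist x (e k) < \<delta> / 2"
        using e[of "\<delta> / 2" x] by auto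
      have "\<nu> k (e k - x) \<le> norm (e k - x)"
        using \<nu>(2)[of k "e k - x"] by simp
      then have "norm (e k) - \<nu> k x \<le> dist x (e k)"
        using \<nu>(3)[of k] by (simp add: bounded_linear.linear[OF \<nu>(1)] linear_diff dist_norm norm_minus_commute)
      moreover have "norm x \<le> norm (e k) + dist x (e k)"
        by (metis add.commute dist_norm norm_triangle_sub)
      moreover have "\<bar>\<nu> k x\<bar> \<le> (SUP k. \<bar>\<nu> k x\<bar>)"
        by (rule cSUP_upper[OF _ bdd]) simp
      ultimately show "norm x \<le> (SUP k. \<bar>\<nu> k x\<bar>) + \<delta>"
        using k by linarith
    qed
    show "(SUP k. \<bar>\<nu> k x\<bar>) \<le> norm x"
      by (rule cSUP_least) (use \<nu>(2) in auto)
  qed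
  then show thesis using \<nu> that unfolding norming_sequence_def by blast
qed

lemma norming_sequence_eqI:
  assumes \<nu>: "norming_sequence \<nu>" and eq: "\<And>k. \<nu> k x = \<nu> k y"
  shows "x = y"
proof -
  have "\<nu> k (x - y) = 0" for k
    using \<nu> eq[of k] unfolding norming_sequence_def
    by (simp add: bounded_linear.linear linear_diff)
  moreover have "norm (x - y) = (SUP k. \<bar>\<nu> k (x - y)\<bar>)"
    using \<nu> unfolding norming_sequence_def by blast
  ultimately show ?thesis by simp
qed

text \<open>A form of Pettis measurability: the distance to a fixed point is a countable supremum of
  measurable functions, which settles balls, and by Lindelof an open set is a countable union of
  balls.\<close>

lemma borel_measurable_norming_sequence:
  fixes g :: "'w \<Rightarrow> 'a::{real_normed_vector, second_countable_topology}"
  assumes \<nu>: "norming_sequence \<nu>" and meas: "\<And>k. (\<lambda>\<omega>. \<nu> k (g \<omega>)) \<in> borel_measurable M"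
  shows "g \<in> borel_measurable M"
proof (rule borel_measurableI)
  fix U :: "'a set" assume U: "open U"
  have ball: "g -` ball x r \<inter> space M \<in> sets M" for x r
  proof -
    have *: "norm (g \<omega> - x) = (SUP k. \<bar>\<nu> k (g \<omega>) - \<nu> k x\<bar>)" for \<omega>
      using \<nu> unfolding norming_sequence_def
      by (simp add: bounded_linear.linear flip: linear_diff)
    have bdd: "bdd_above (range (\<lambda>k. \<bar>\<nu> k (g \<omega>) - \<nu> k x\<bar>))" for \<omega>
      using \<nu> unfolding norming_sequence_def
      by (intro bdd_aboveI2[of _ _ "norm (g \<omega> - x)"])
        (metis bounded_linear.linear linear_diff)
    have "(\<lambda>\<omega>. norm (g \<omega> - x)) \<in> borel_measurable M"
      unfolding * using meas by (intro borel_measurable_cSUP) (auto intro: bdd)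
    then have "{\<omega> \<in> space M. norm (g \<omega> - x) < r} \<in> sets M"
      by measurable
    moreover have "g -` ball x r \<inter> space M = {\<omega> \<in> space M. norm (g \<omega> - x) < r}"
      by (auto simp: dist_norm norm_minus_commute)
    ultimately show ?thesis by simp
  qed
  have "\<forall>x\<in>U. \<exists>r>0. ball x r \<subseteq> U"
    using U open_contains_ball by blast
  then obtain r where r: "\<And>x. x \<in> U \<Longrightarrow> r x > 0 \<and> ball x (r x) \<subseteq> U"
    by metis
  obtain I where I: "I \<subseteq> (\<lambda>x. ball x (r x)) ` U" "countable I" "\<Union>I = \<Union>((\<lambda>x. ball x (r x)) ` U)"
    using Lindelof[of "(\<lambda>x. ball x (r x)) ` U"] by auto
  have "\<Union>((\<lambda>x. ball x (r x)) ` U) = U"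
    using r by force
  then have "g -` U \<inter> space M = (\<Union>B\<in>I. g -` B \<inter> space M)"
    using I(3) by auto
  also have "\<dots> \<in> sets M"
    using I(1,2) ball by (intro sets.countable_UN') auto
  finally show "g -` U \<inter> space M \<in> sets M" .
qed

subsection \<open>Weak limits\<close>

text \<open>Otherwise every g in K has a slab, cut out by one functional, that the sequence
  eventually avoids, and finitely many slabs cover K. The conclusion treats each functional
  separately; this is less than a weak cluster point, but enough wherever the scalar sequences are
  known to converge.\<close>

lemma weakly_compact_cluster_point:
  fixes K :: "'a::real_normed_vector set"
  assumes K: "compactin weak_topology K" and u: "\<And>n. u n \<in> K"
  obtains g where "g \<in> K"
    "\<And>(f::'a \<Rightarrow> real) \<delta>. bounded_linear f \<Longrightarrow> \<delta> > 0 \<Longrightarrow> \<exists>\<^sub>F n in sequentially. \<bar>f (u n) - f g\<bar> < \<delta>"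
proof (rule ccontr)
  assume "\<not> thesis"
  then have "\<forall>g\<in>K. \<exists>(f::'a \<Rightarrow> real) \<delta>. bounded_linear f \<and> \<delta> > 0 \<and>
      (\<forall>\<^sub>F n in sequentially. \<not> \<bar>f (u n) - f g\<bar> < \<delta>)"
    using that unfolding frequently_def not_not by metis
  then obtain f :: "'a \<Rightarrow> 'a \<Rightarrow> real" and \<delta> where f: "\<And>g. g \<in> K \<Longrightarrow> bounded_linear (f g)"
      "\<And>g. g \<in> K \<Longrightarrow> \<delta> g > 0" "\<And>g. g \<in> K \<Longrightarrow> \<forall>\<^sub>F n in sequentially. \<not> \<bar>f g (u n) - f g g\<bar> < \<delta> g"
    by metis
  define U where "U g = {x \<in> UNIV. f g x \<in> ball (f g g) (\<delta> g)}" for g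
  have "openin weak_topology (U g)" if "g \<in> K" for g
    unfolding weak_topology_def initial_topology_def U_def
    using f(1)[OF that] by (intro topology_generated_by_Basis) blast
  moreover have "K \<subseteq> \<Union>(U ` K)"
    using f(2) by (auto simp: U_def)
  ultimately obtain \<F> where \<F>: "finite \<F>" "\<F> \<subseteq> U ` K" "K \<subseteq> \<Union>\<F>"
    using K unfolding compactin_def by (metis (no_types, lifting) imageE)
  then obtain G where G: "finite G" "G \<subseteq> K" "K \<subseteq> \<Union>(U ` G)"
    by (metis finite_subset_image)
  have "\<forall>\<^sub>F n in sequentially. \<forall>g\<in>G. \<not> \<bar>f g (u n) - f g g\<bar> < \<delta> g"
    using G f(3) by (intro eventually_ball_finite) auto
  then obtain n where "\<forall>g\<in>G. \<not> \<bar>f g (u n) - f g g\<bar> < \<delta> g"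
    by (auto simp: eventually_sequentially)
  then show False
    using u[of n] G(3) by (auto simp: U_def dist_real_def abs_minus_commute)
qed

lemma tendsto_if_frequently_close:
  fixes X :: "nat \<Rightarrow> real"
  assumes X: "convergent X" and c: "\<And>\<delta>. \<delta> > 0 \<Longrightarrow> \<exists>\<^sub>F n in sequentially. \<bar>X n - c\<bar> < \<delta>"
  shows "X \<longlonglongrightarrow> c"
proof -
  obtain l where l: "X \<longlonglongrightarrow> l" using X convergent_def by blast
  have "l = c"
  proof (rule ccontr)
    assume "l \<noteq> c"
    then have d: "\<bar>l - c\<bar> / 2 > 0" by simp
    have "\<forall>\<^sub>F n in sequentially. \<bar>X n - l\<bar> < \<bar>l - c\<bar> / 2"
      using tendstoD[OF l d] by (simp add: dist_real_def)
    then have "\<exists>\<^sub>F n in sequentially. \<bar>X n - c\<bar> < \<bar>l - c\<bar> / 2 \<and> \<bar>X n - l\<bar> < \<bar>l - c\<bar> / 2"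
      using frequently_eventually_frequently[OF c[OF d]] by blast
    then obtain n where "\<bar>X n - c\<bar> < \<bar>l - c\<bar> / 2" "\<bar>X n - l\<bar> < \<bar>l - c\<bar> / 2"
      using frequently_ex by blast
    moreover have "\<bar>l - c\<bar> \<le> \<bar>X n - c\<bar> + \<bar>X n - l\<bar>" by linarith
    ultimately show False by (simp add: field_simps)
  qed
  then show ?thesis using l by simp
qed

text \<open>Links the weak compactness of the values to the norm closedness that measurable
  selection asks for: a norm limit and a cluster point agree under every
  \<open>\<nu> k\<close>.\<close>

lemma weakly_compact_imp_closed:
  fixes K :: "'a::{real_normed_vector, second_countable_topology} set"
  assumes K: "compactin weak_topology K"
  shows "closed K"
  unfolding closed_sequential_limits
proof (intro allI impI)
  fix u y assume u: "(\<forall>n. u n \<in> K) \<and> u \<longlonglongrightarrow> y"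
  obtain \<nu> :: "nat \<Rightarrow> 'a \<Rightarrow> real" where \<nu>: "norming_sequence \<nu>"
    using norming_sequence_exists by blast
  obtain g where g: "g \<in> K"
    "\<And>(f::'a \<Rightarrow> real) \<delta>. bounded_linear f \<Longrightarrow> \<delta> > 0 \<Longrightarrow> \<exists>\<^sub>F n in sequentially. \<bar>f (u n) - f g\<bar> < \<delta>"
    using weakly_compact_cluster_point[OF K] u by metis
  have "\<nu> k g = \<nu> k y" for k
  proof -
    have bl: "bounded_linear (\<nu> k)" using \<nu> by (simp add: norming_sequence_def)
    then have lim: "(\<lambda>n. \<nu> k (u n)) \<longlonglongrightarrow> \<nu> k y"
      using u by (simp add: bounded_linear.tendsto)
    have "(\<lambda>n. \<nu> k (u n)) \<longlonglongrightarrow> \<nu> k g"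
      using lim g(2)[OF bl] by (intro tendsto_if_frequently_close) (auto simp: convergent_def)
    with lim show ?thesis using LIMSEQ_unique by blast
  qed
  then show "y \<in> K"
    using norming_sequence_eqI[OF \<nu>] g(1) by metis
qed

definition weak_limit :: "(nat \<Rightarrow> 'a::real_normed_vector) \<Rightarrow> 'a \<Rightarrow> bool" where
  "weak_limit u g \<longleftrightarrow> (\<forall>f::'a \<Rightarrow> real. bounded_linear f \<longrightarrow> (\<lambda>n. f (u n)) \<longlonglongrightarrow> f g)"

lemma weak_limitD: "weak_limit u g \<Longrightarrow> bounded_linear f \<Longrightarrow> (\<lambda>n. f (u n) :: real) \<longlonglongrightarrow> f g"
  by (simp add: weak_limit_def)

text \<open>On a weakly compact set the countable norming sequence decides weak convergence. A
  subsequence staying away from \<open>f g\<close> would have a cluster point on which all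
  \<open>\<nu> k\<close> have the same values as on \<open>g\<close>, that is, \<open>g\<close>
  itself.\<close>

lemma weakly_compact_weak_limit:
  fixes K :: "'a::real_normed_vector set"
  assumes K: "compactin weak_topology K" and \<nu>: "norming_sequence \<nu>"
    and u: "\<And>n. u n \<in> K" and conv: "\<And>k. convergent (\<lambda>n. \<nu> k (u n))"
  shows "\<exists>g\<in>K. weak_limit u g"
proof -
  have bl: "bounded_linear (\<nu> k)" for k using \<nu> by (simp add: norming_sequence_def)
  obtain g where g: "g \<in> K"
    "\<And>(f::'a \<Rightarrow> real) \<delta>. bounded_linear f \<Longrightarrow> \<delta> > 0 \<Longrightarrow> \<exists>\<^sub>F n in sequentially. \<bar>f (u n) - f g\<bar> < \<delta>"
    using weakly_compact_cluster_point[of K u] K u by metis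
  have lim: "(\<lambda>n. \<nu> k (u n)) \<longlonglongrightarrow> \<nu> k g" for k
    by (rule tendsto_if_frequently_close[OF conv g(2)[OF bl]])
  have "(\<lambda>n. f (u n)) \<longlonglongrightarrow> f g" if f: "bounded_linear f" for f :: "'a \<Rightarrow> real"
  proof (rule ccontr)
    assume "\<not> (\<lambda>n. f (u n)) \<longlonglongrightarrow> f g"
    then obtain \<delta> where \<delta>: "\<delta> > 0" "\<exists>\<^sub>F n in sequentially. \<not> \<bar>f (u n) - f g\<bar> < \<delta>"
      by (auto simp: tendsto_iff dist_real_def not_eventually)
    then have "infinite {n. \<not> \<bar>f (u n) - f g\<bar> < \<delta>}"
      by (simp add: frequently_cofinite flip: cofinite_eq_sequentially)
    then obtain r :: "nat \<Rightarrow> nat" where r: "strict_mono r" "\<And>n. \<not> \<bar>f (u (r n)) - f g\<bar> < \<delta>"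
      using infinite_enumerate by blast
    obtain g' where g': "\<And>(f::'a \<Rightarrow> real) \<delta>. bounded_linear f \<Longrightarrow> \<delta> > 0
        \<Longrightarrow> \<exists>\<^sub>F n in sequentially. \<bar>f (u (r n)) - f g'\<bar> < \<delta>"
      using weakly_compact_cluster_point[of K "\<lambda>n. u (r n)"] K u by metis
    have "\<nu> k g' = \<nu> k g" for k
    proof -
      have l: "(\<lambda>n. \<nu> k (u (r n))) \<longlonglongrightarrow> \<nu> k g"
        using LIMSEQ_subseq_LIMSEQ[OF lim r(1)] by (simp add: o_def)
      moreover have "(\<lambda>n. \<nu> k (u (r n))) \<longlonglongrightarrow> \<nu> k g'"
        using l g'[OF bl] by (intro tendsto_if_frequently_close) (auto simp: convergent_def)
      ultimately show ?thesis using LIMSEQ_unique by blast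
    qed
    then have "g' = g" by (rule norming_sequence_eqI[OF \<nu>])
    then have "\<exists>\<^sub>F n in sequentially. \<bar>f (u (r n)) - f g\<bar> < \<delta>"
      using g'[OF f \<delta>(1)] by simp
    then show False
      using r(2) by simp
  qed
  then show ?thesis using g(1) unfolding weak_limit_def by blast
qed

subsection \<open>Measurable selections\<close>

lemma measurable_selection:
  fixes T :: "'w \<Rightarrow> 'a::{complete_space, second_countable_topology} set"
  assumes T: "lower_measurable M T"
    and closed: "\<And>\<omega>. \<omega> \<in> space M \<Longrightarrow> closed (T \<omega>)"
    and ne: "\<And>\<omega>. \<omega> \<in> space M \<Longrightarrow> T \<omega> \<noteq> {}"
  obtains f where "f \<in> borel_measurable M" "\<And>\<omega>. \<omega> \<in> space M \<Longrightarrow> f \<omega> \<in> T \<omega>"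
proof -
  obtain e :: "nat \<Rightarrow> 'a" where e: "\<And>x \<delta>. \<delta> > 0 \<Longrightarrow> \<exists>k. dist x (e k) < \<delta>"
    using dense_sequence by blast
  define B where "B k n = ball (e k) ((1/2) ^ n)" for k n :: nat
  have cover: "\<exists>k. x \<in> B k n" for x n
    using e[of "(1/2)^n" x] by (simp add: B_def dist_commute)
  \<comment> \<open>The next ball has to meet \<open>T \<omega>\<close> inside the current one,
    which keeps consecutive centres close; taking the least such index keeps the choice
    measurable.\<close>
  define i where "i \<omega> = rec_nat (LEAST k. T \<omega> \<inter> B k 0 \<noteq> {})
      (\<lambda>n j. LEAST k. T \<omega> \<inter> (B j n \<inter> B k (Suc n)) \<noteq> {})" for \<omega>
  have i_0: "i \<omega> 0 = (LEAST k. T \<omega> \<inter> B k 0 \<noteq> {})"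
    and i_Suc: "i \<omega> (Suc n) = (LEAST k. T \<omega> \<inter> (B (i \<omega> n) n \<inter> B k (Suc n)) \<noteq> {})" for \<omega> n
    by (simp_all add: i_def)
  have ex_next: "\<exists>k. T \<omega> \<inter> (B j n \<inter> B k (Suc n)) \<noteq> {}" if "T \<omega> \<inter> B j n \<noteq> {}" for \<omega> j n
    using that cover[of _ "Suc n"] by blast
  have i: "T \<omega> \<inter> B (i \<omega> n) n \<noteq> {}" if \<omega>: "\<omega> \<in> space M" for \<omega> n
  proof (induction n)
    case 0
    have "\<exists>k. T \<omega> \<inter> B k 0 \<noteq> {}" using ne[OF \<omega>] cover[of _ 0] by blast
    then show ?case unfolding i_0 by (rule LeastI_ex)
  next
    case (Suc n)
    from LeastI_ex[OF ex_next[OF Suc]] show ?case unfolding i_Suc by blast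
  qed
  have i2: "T \<omega> \<inter> (B (i \<omega> n) n \<inter> B (i \<omega> (Suc n)) (Suc n)) \<noteq> {}" if \<omega>: "\<omega> \<in> space M" for \<omega> n
    unfolding i_Suc by (rule LeastI_ex[OF ex_next[OF i[OF \<omega>]]])
  have meets: "Measurable.pred M (\<lambda>\<omega>. T \<omega> \<inter> V \<noteq> {})" if "open V" for V
    using T that unfolding lower_measurable_def by (simp add: pred_def)
  have meas_i: "(\<lambda>\<omega>. i \<omega> n) \<in> measurable M (count_space UNIV)" for n
  proof (induction n)
    case 0
    show ?case unfolding i_0
      by (intro measurable_Least meets) (simp add: B_def)
  next
    case (Suc n)
    \<comment> \<open>The previous index is measurable with values in a countable type, so the
      predicate may be checked for each of its values separately.\<close>
    have "Measurable.pred M (\<lambda>\<omega>. T \<omega> \<inter> (B (i \<omega> n) n \<inter> B k (Suc n)) \<noteq> {})" for k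
    proof (rule measurable_compose_countable[OF _ Suc, where f="\<lambda>j \<omega>. T \<omega> \<inter> (B j n \<inter> B k (Suc n)) \<noteq> {}"])
      show "Measurable.pred M (\<lambda>\<omega>. T \<omega> \<inter> (B j n \<inter> B k (Suc n)) \<noteq> {})" for j
        by (intro meets open_Int) (simp_all add: B_def)
    qed
    then show ?case unfolding i_Suc by (rule measurable_Least)
  qed
  define f where "f \<omega> = lim (\<lambda>n. e (i \<omega> n))" for \<omega>
  have step: "dist (e (i \<omega> n)) (e (i \<omega> (Suc n))) \<le> 2 * (1/2) ^ n" if \<omega>: "\<omega> \<in> space M" for \<omega> n
  proof -
    obtain x where "dist (e (i \<omega> n)) x < (1/2) ^ n" "dist (e (i \<omega> (Suc n))) x < (1/2) ^ Suc n"
      using i2[OF \<omega>, of n] by (auto simp: B_def)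
    moreover have "(1/2::real) ^ Suc n \<le> (1/2) ^ n" by simp
    moreover have "dist (e (i \<omega> n)) (e (i \<omega> (Suc n))) \<le> dist (e (i \<omega> n)) x + dist (e (i \<omega> (Suc n))) x"
      by (rule dist_triangle2)
    ultimately show ?thesis by linarith
  qed
  have lim: "(\<lambda>n. e (i \<omega> n)) \<longlonglongrightarrow> f \<omega>" if \<omega>: "\<omega> \<in> space M" for \<omega>
  proof -
    have "Cauchy (\<lambda>n. e (i \<omega> n))"
    proof (rule metric_CauchyI)
      fix \<delta> :: real assume "\<delta> > 0"
      \<comment> \<open>The bound is the geometric sum of the steps 2 * (1/2)^k for k from n to n +
        m - 1.\<close>
      have tele: "dist (e (i \<omega> n)) (e (i \<omega> (n + m))) \<le> 4 * (1/2) ^ n - 4 * (1/2) ^ (n + m)" for n m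
      proof (induction m)
        case (Suc m)
        have "dist (e (i \<omega> n)) (e (i \<omega> (n + Suc m)))
            \<le> dist (e (i \<omega> n)) (e (i \<omega> (n + m))) + dist (e (i \<omega> (n + m))) (e (i \<omega> (Suc (n + m))))"
          using dist_triangle by simp
        with Suc step[OF \<omega>, of "n + m"] show ?case by simp
      qed simp
      obtain N where N: "(1/2::real) ^ N < \<delta> / 8"
        using real_arch_pow_inv[of "\<delta> / 8" "1/2"] \<open>\<delta> > 0\<close> by auto
      have near: "dist (e (i \<omega> N)) (e (i \<omega> n)) < \<delta> / 2" if "n \<ge> N" for n
      proof -
        have "0 < 4 * (1/2::real) ^ n" by simp
        moreover have "dist (e (i \<omega> N)) (e (i \<omega> n)) \<le> 4 * (1/2) ^ N - 4 * (1/2) ^ n"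
          using tele[of N "n - N"] that by simp
        ultimately show ?thesis using N by linarith
      qed
      show "\<exists>N. \<forall>m\<ge>N. \<forall>n\<ge>N. dist (e (i \<omega> m)) (e (i \<omega> n)) < \<delta>"
        using dist_triangle_half_r[OF near near] by blast
    qed
    then show ?thesis
      unfolding f_def using Cauchy_convergent convergent_LIMSEQ_iff by blast
  qed
  have "f \<in> borel_measurable M"
    by (rule borel_measurable_LIMSEQ_metric[OF _ lim]) (rule measurable_compose[OF meas_i], simp_all)
  moreover have "f \<omega> \<in> T \<omega>" if \<omega>: "\<omega> \<in> space M" for \<omega>
  proof -
    have "\<forall>n. \<exists>x. x \<in> T \<omega> \<and> dist (e (i \<omega> n)) x < (1/2) ^ n"
      using i[OF \<omega>] by (force simp: B_def)
    then obtain x where x: "\<And>n. x n \<in> T \<omega>" "\<And>n. dist (e (i \<omega> n)) (x n) < (1/2) ^ n"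
      by metis
    have "(\<lambda>n. (1/2::real) ^ n) \<longlonglongrightarrow> 0" by (intro LIMSEQ_power_zero) simp
    then have "(\<lambda>n. dist (e (i \<omega> n)) (x n)) \<longlonglongrightarrow> 0"
      by (rule metric_tendsto_imp_tendsto) (use less_imp_le[OF x(2)] in simp)
    from tendsto_add[OF this tendsto_dist[OF lim[OF \<omega>] tendsto_const, of "f \<omega>"]]
    have "(\<lambda>n. dist (e (i \<omega> n)) (x n) + dist (e (i \<omega> n)) (f \<omega>)) \<longlonglongrightarrow> 0" by simp
    then have "x \<longlonglongrightarrow> f \<omega>"
      by (rule metric_tendsto_imp_tendsto) (simp add: dist_triangle3)
    then show ?thesis using closed_sequentially[OF closed[OF \<omega>]] x(1) by blast
  qed
  ultimately show thesis using that by blast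
qed

subsection \<open>Weak limits of forward convex combinations\<close>

text \<open>These forward combinations suffice for the parallelogram argument, and an inductive definition transfers every midpoint-convex property of the sequence at once.\<close>

inductive mid_tail :: "(nat \<Rightarrow> 'w \<Rightarrow> 'a::real_vector) \<Rightarrow> nat \<Rightarrow> ('w \<Rightarrow> 'a) \<Rightarrow> bool" for f n where
  base: "n \<le> j \<Longrightarrow> mid_tail f n (f j)"
| mid: "mid_tail f n F \<Longrightarrow> mid_tail f n G \<Longrightarrow> mid_tail f n (\<lambda>\<omega>. (1/2) *\<^sub>R (F \<omega> + G \<omega>))"

lemma mid_tail_antimono: "mid_tail f n F \<Longrightarrow> m \<le> n \<Longrightarrow> mid_tail f m F"
  by (induction rule: mid_tail.induct) (auto intro: mid_tail.intros)

lemma mid_tail_convex: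
  assumes "mid_tail f n F" "convex V" "\<And>j. n \<le> j \<Longrightarrow> f j \<omega> \<in> V"
  shows "F \<omega> \<in> V"
  using assms(1)
proof (induction rule: mid_tail.induct)
  case (mid F G)
  then show ?case
    using convexD[OF assms(2), of "F \<omega>" "G \<omega>" "1/2" "1/2"] by (simp add: scaleR_add_right)
qed (use assms(3) in blast)

lemma mid_tail_measurable:
  fixes f :: "nat \<Rightarrow> 'w \<Rightarrow> 'a::{real_normed_vector, second_countable_topology}"
  assumes "mid_tail f n F" "\<And>j. f j \<in> borel_measurable M"
  shows "F \<in> borel_measurable M"
  using assms(1) by (induction rule: mid_tail.induct) (use assms(2) in auto)

text \<open>The Hilbert space argument for nearest points. The infima \<alpha> over the tails
  increase to L; almost minimizing members have Q close to L, their midpoint lies in a tail and has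
  Q not much below L, and the parallelogram law makes the half difference small.\<close>

lemma mid_tail_minimizing:
  fixes f :: "nat \<Rightarrow> 'w \<Rightarrow> 'a::real_vector" and Q :: "('w \<Rightarrow> 'a) \<Rightarrow> real"
  assumes bounds: "\<And>F. mid_tail f 0 F \<Longrightarrow> Q F \<in> {0..c}"
    and parallelogram: "\<And>F G. mid_tail f 0 F \<Longrightarrow> mid_tail f 0 G \<Longrightarrow>
      Q (\<lambda>\<omega>. (1/2) *\<^sub>R (F \<omega> - G \<omega>)) = (Q F + Q G) / 2 - Q (\<lambda>\<omega>. (1/2) *\<^sub>R (F \<omega> + G \<omega>))"
    and \<delta>: "\<And>n. \<delta> n > 0" "\<And>n. \<delta> (Suc n) \<le> \<delta> n"
  obtains F where "\<And>n. mid_tail f n (F n)" "\<And>n. Q (\<lambda>\<omega>. (1/2) *\<^sub>R (F n \<omega> - F (Suc n) \<omega>)) \<le> 2 * \<delta> n"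
proof -
  define \<alpha> where "\<alpha> n = (INF F\<in>Collect (mid_tail f n). Q F)" for n
  have ne: "Collect (mid_tail f n) \<noteq> {}" for n
    using mid_tail.base[of n n f] by blast
  have Q: "Q F \<in> {0..c}" if "mid_tail f n F" for n F
    using bounds mid_tail_antimono[OF that] by blast
  have \<alpha>_le: "\<alpha> n \<le> Q F" if "mid_tail f n F" for n F
    unfolding \<alpha>_def by (rule cINF_lower[OF bdd_belowI2[of _ 0]]) (use Q that in auto)
  have \<alpha>_c: "\<alpha> n \<le> c" for n
    using \<alpha>_le[OF mid_tail.base[of n n f]] Q[OF mid_tail.base[of n n f]] by simp
  have \<alpha>_mono: "\<alpha> m \<le> \<alpha> n" if "m \<le> n" for m n
    unfolding \<alpha>_def[of n] using ne[of n] \<alpha>_le mid_tail_antimono[OF _ that] by (intro cINF_greatest) auto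
  define L where "L = (SUP n. \<alpha> n)"
  have bdd: "bdd_above (range \<alpha>)" using \<alpha>_c by (intro bdd_aboveI2)
  have \<alpha>_L: "\<alpha> n \<le> L" for n
    unfolding L_def by (rule cSUP_upper[OF _ bdd]) simp
  have "\<exists>N\<ge>n. L - \<delta> n < \<alpha> N" for n
  proof -
    have "L - \<delta> n < (SUP n. \<alpha> n)" using \<delta>(1)[of n] by (simp add: L_def)
    then obtain N where "L - \<delta> n < \<alpha> N" using less_cSUP_iff[OF _ bdd] by auto
    then have "L - \<delta> n < \<alpha> (max N n)" using \<alpha>_mono[of N "max N n"] by simp
    then show ?thesis by (intro exI[of _ "max N n"]) simp
  qed
  then obtain N where N: "\<And>n. n \<le> N n" "\<And>n. L - \<delta> n < \<alpha> (N n)" by metis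
  have "\<exists>F. mid_tail f (N n) F \<and> Q F < L + \<delta> n" for n
  proof -
    have "(INF F\<in>Collect (mid_tail f (N n)). Q F) < L + \<delta> n"
      using \<alpha>_L[of "N n"] \<delta>(1)[of n] by (simp add: \<alpha>_def)
    then show ?thesis
      using cINF_less_iff[OF ne bdd_belowI2[of _ 0]] Q by (metis (no_types, lifting) atLeastAtMost_iff mem_Collect_eq)
  qed
  then obtain F where F: "\<And>n. mid_tail f (N n) (F n)" "\<And>n. Q (F n) < L + \<delta> n" by metis
  show thesis
  proof (rule that[of F])
    show "mid_tail f n (F n)" for n using mid_tail_antimono[OF F(1) N(1)] .
    fix n
    \<comment> \<open>The starting points \<open>N n\<close> need not increase, so the midpoint is
      only known to lie in the tail from the smaller of the two; \<alpha> exceeds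
      \<open>L - \<delta> n\<close> at either one since \<delta> decreases.\<close>
    define m where "m = min (N n) (N (Suc n))"
    have "L - \<delta> n < \<alpha> m"
      using N(2)[of n] N(2)[of "Suc n"] \<delta>(2)[of n] by (auto simp: m_def min_def)
    also have "\<alpha> m \<le> Q (\<lambda>\<omega>. (1/2) *\<^sub>R (F n \<omega> + F (Suc n) \<omega>))"
      by (intro \<alpha>_le mid_tail.mid mid_tail_antimono[OF F(1)]) (simp_all add: m_def)
    finally show "Q (\<lambda>\<omega>. (1/2) *\<^sub>R (F n \<omega> - F (Suc n) \<omega>)) \<le> 2 * \<delta> n"
      using parallelogram[OF mid_tail_antimono[OF F(1)] mid_tail_antimono[OF F(1)], of n "Suc n"]
        F(2)[of n] F(2)[of "Suc n"] \<delta>(2)[of n] by (simp add: field_simps)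
  qed
qed

lemma AE_summable_nonneg:
  fixes g :: "nat \<Rightarrow> 'w \<Rightarrow> real"
  assumes g: "\<And>n. integrable M (g n)" "\<And>n. AE \<omega> in M. 0 \<le> g n \<omega>"
    and sum: "summable (\<lambda>n. \<integral>\<omega>. g n \<omega> \<partial>M)"
  shows "AE \<omega> in M. summable (\<lambda>n. g n \<omega>)"
proof -
  have nonneg: "0 \<le> (\<integral>\<omega>. g n \<omega> \<partial>M)" for n
    using g(2) by (rule integral_nonneg_AE)
  have "(\<integral>\<^sup>+\<omega>. (\<Sum>n. ennreal (g n \<omega>)) \<partial>M) = (\<Sum>n. \<integral>\<^sup>+\<omega>. ennreal (g n \<omega>) \<partial>M)"
    using g(1) by (intro nn_integral_suminf) auto
  also have "\<dots> = (\<Sum>n. ennreal (\<integral>\<omega>. g n \<omega> \<partial>M))"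
    by (intro suminf_cong nn_integral_eq_integral g)
  also have "\<dots> = ennreal (\<Sum>n. \<integral>\<omega>. g n \<omega> \<partial>M)"
    using nonneg sum by (rule suminf_ennreal2)
  finally have "(\<integral>\<^sup>+\<omega>. (\<Sum>n. ennreal (g n \<omega>)) \<partial>M) \<noteq> \<infinity>" by simp
  then have "AE \<omega> in M. (\<Sum>n. ennreal (g n \<omega>)) \<noteq> \<infinity>"
    using g(1) by (intro nn_integral_noteq_infinite) auto
  moreover have "AE \<omega> in M. \<forall>n. 0 \<le> g n \<omega>"
    using g(2) by (simp add: AE_all_countable)
  ultimately show ?thesis
    by eventually_elim (auto intro: summable_suminf_not_top)
qed

text \<open>A Hilbert seminorm weaker than the norm: minimizing its integral over the tails makes forward
  convex combinations Cauchy against all functionals of the norming sequence.\<close>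

definition norming_form :: "(nat \<Rightarrow> 'a \<Rightarrow> real) \<Rightarrow> 'a \<Rightarrow> real" where
  "norming_form \<nu> y = (\<Sum>k. (1/2) ^ k * (\<nu> k y)\<^sup>2)"

context
  fixes \<nu> :: "nat \<Rightarrow> 'a::{real_normed_vector, second_countable_topology} \<Rightarrow> real"
  assumes \<nu>: "norming_sequence \<nu>"
begin

lemma norming_sequence_linear: "linear (\<nu> k)"
  using \<nu> by (simp add: norming_sequence_def bounded_linear.linear)

lemma norming_sequence_le: "\<bar>\<nu> k x\<bar> \<le> norm x"
  using \<nu> unfolding norming_sequence_def by blast

lemma borel_measurable_norming_sequence_comp [measurable]: "\<nu> k \<in> borel_measurable borel"
  using \<nu> unfolding norming_sequence_def
  by (intro borel_measurable_continuous_onI linear_continuous_on) blast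

lemma summable_norming_form: "summable (\<lambda>k. (1/2) ^ k * (\<nu> k y)\<^sup>2)"
proof (rule summable_comparison_test')
  show "summable (\<lambda>k. (1/2) ^ k * (norm y)\<^sup>2)"
    by (intro summable_mult2 summable_geometric) simp
  show "norm ((1/2) ^ k * (\<nu> k y)\<^sup>2) \<le> (1/2) ^ k * (norm y)\<^sup>2" for k
    using norming_sequence_le[of k y] by (auto simp: abs_le_square_iff[symmetric])
qed

lemma norming_form_bounds: "norming_form \<nu> y \<in> {0..2 * (norm y)\<^sup>2}"
proof -
  have "norming_form \<nu> y \<le> (\<Sum>k. (1/2) ^ k * (norm y)\<^sup>2)"
    unfolding norming_form_def
  proof (rule suminf_le[OF _ summable_norming_form])
    show "summable (\<lambda>k. (1/2) ^ k * (norm y)\<^sup>2)"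
      by (intro summable_mult2 summable_geometric) simp
    show "(1/2) ^ k * (\<nu> k y)\<^sup>2 \<le> (1/2) ^ k * (norm y)\<^sup>2" for k
      using norming_sequence_le[of k y] by (auto simp: abs_le_square_iff[symmetric])
  qed
  also have "\<dots> = 2 * (norm y)\<^sup>2"
    by (subst suminf_mult2[symmetric]) (simp_all add: suminf_geometric)
  finally show ?thesis
    unfolding norming_form_def using suminf_nonneg[OF summable_norming_form[of y]] by auto
qed

lemma norming_form_ge: "(1/2) ^ k * (\<nu> k y)\<^sup>2 \<le> norming_form \<nu> y"
  using sum_le_suminf[OF summable_norming_form, of "{k}" y] by (simp add: norming_form_def)

lemma norming_form_parallelogram:
  "norming_form \<nu> ((1/2) *\<^sub>R (x - y)) = (norming_form \<nu> x + norming_form \<nu> y) / 2 - norming_form \<nu> ((1/2) *\<^sub>R (x + y))"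
proof -
  have "norming_form \<nu> ((1/2) *\<^sub>R (x - y)) + norming_form \<nu> ((1/2) *\<^sub>R (x + y)) =
      (\<Sum>k. (1/2) * ((1/2) ^ k * (\<nu> k x)\<^sup>2 + (1/2) ^ k * (\<nu> k y)\<^sup>2))"
    unfolding norming_form_def
    by (subst suminf_add[OF summable_norming_form summable_norming_form], intro suminf_cong)
      (simp add: linear_diff[OF norming_sequence_linear] linear_add[OF norming_sequence_linear]
        linear_scale[OF norming_sequence_linear] power2_eq_square field_simps)
  also have "\<dots> = (norming_form \<nu> x + norming_form \<nu> y) / 2"
    unfolding norming_form_def
    by (subst suminf_mult) (simp_all add: suminf_add summable_add summable_norming_form)
  finally show ?thesis by linarith
qed

lemma borel_measurable_norming_form [measurable]: "norming_form \<nu> \<in> borel_measurable borel"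
  unfolding norming_form_def by measurable

end

text \<open>The form is quadratic, so decay of order 4^-n yields increments of each
  \<open>\<nu> k\<close> of order 2^-n, which are summable.\<close>

lemma convergent_if_norming_form_small:
  fixes x :: "nat \<Rightarrow> 'a::{real_normed_vector, second_countable_topology}"
  assumes \<nu>: "norming_sequence \<nu>"
    and C: "\<And>n. norming_form \<nu> ((1/2) *\<^sub>R (x n - x (Suc n))) \<le> C * (1/4) ^ n"
  shows "convergent (\<lambda>n. \<nu> k (x n))"
proof -
  \<comment> \<open>The factor 4 undoes the squared 1/2 in the half difference, 2^k undoes the
    weight of the k-th summand, and the absolute value covers a C of unknown sign.\<close>
  define C' where "C' = sqrt (4 * 2 ^ k * \<bar>C\<bar>)"
  have "\<bar>\<nu> k (x (Suc n)) - \<nu> k (x n)\<bar> \<le> C' * (1/2) ^ n" for n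
  proof (rule power2_le_imp_le)
    have *: "\<nu> k ((1/2) *\<^sub>R (x n - x (Suc n))) = - (1/2) * (\<nu> k (x (Suc n)) - \<nu> k (x n))"
      by (simp add: field_simps linear_diff[OF norming_sequence_linear[OF \<nu>]] linear_scale[OF norming_sequence_linear[OF \<nu>]])
    have "(1/2) ^ k * (1/4 * (\<nu> k (x (Suc n)) - \<nu> k (x n))\<^sup>2) \<le> C * (1/4) ^ n"
      using order_trans[OF norming_form_ge[OF \<nu>] C[of n], of k] unfolding *
      by (simp add: power_mult_distrib power2_eq_square algebra_simps)
    also have "\<dots> \<le> \<bar>C\<bar> * (1/4) ^ n" by (intro mult_right_mono) auto
    finally have "(\<nu> k (x (Suc n)) - \<nu> k (x n))\<^sup>2 \<le> 4 * 2 ^ k * \<bar>C\<bar> * (1/4) ^ n"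
      by (simp add: field_simps)
    also have "\<dots> = (C' * (1/2) ^ n)\<^sup>2"
    proof -
      have "C'\<^sup>2 = 4 * 2 ^ k * \<bar>C\<bar>" by (simp add: C'_def)
      moreover have "((1/2) ^ n)\<^sup>2 = (1/4::real) ^ n"
        by (simp add: power2_eq_square flip: power_mult_distrib)
      ultimately show ?thesis by (simp add: power_mult_distrib)
    qed
    finally show "\<bar>\<nu> k (x (Suc n)) - \<nu> k (x n)\<bar>\<^sup>2 \<le> (C' * (1/2) ^ n)\<^sup>2" by simp
  qed (simp add: C'_def)
  then have "summable (\<lambda>n. \<nu> k (x (Suc n)) - \<nu> k (x n))"
    by (intro summable_comparison_test'[OF summable_mult[OF summable_geometric[of "1/2::real"], of C']]) auto
  then have "convergent (\<lambda>n. \<Sum>i<n. \<nu> k (x (Suc i)) - \<nu> k (x i))"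
    by (simp only: summable_iff_convergent)
  moreover have "(\<Sum>i<n. \<nu> k (x (Suc i)) - \<nu> k (x i)) = \<nu> k (x n) - \<nu> k (x 0)" for n
    by (rule sum_lessThan_telescope)
  ultimately have "convergent (\<lambda>n. (\<nu> k (x n) - \<nu> k (x 0)) + \<nu> k (x 0))"
    by (intro convergent_add convergent_const) simp
  then show ?thesis by simp
qed

text \<open>The bound by \<open>H\<close> holds almost everywhere, but \<open>H\<close> is
  nonnegative everywhere, so division by 1 + H is legitimate at every point.\<close>

locale selections = finite_measure M
  for M :: "'w measure"
    and K :: "'w \<Rightarrow> 'y::{banach, second_countable_topology} set"
    and H :: "'w \<Rightarrow> real"
    and \<nu> :: "nat \<Rightarrow> 'y \<Rightarrow> real" +
  assumes norming: "norming_sequence \<nu>"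
    and convex_K: "\<omega> \<in> space M \<Longrightarrow> convex (K \<omega>)"
    and weakly_compact_K: "\<omega> \<in> space M \<Longrightarrow> compactin weak_topology (K \<omega>)"
    and integrable_H: "integrable M H"
    and H_nonneg: "0 \<le> H \<omega>"
    and bounded_K: "AE \<omega> in M. \<forall>x\<in>K \<omega>. norm x \<le> H \<omega>"
begin

definition Sel :: "('w \<Rightarrow> 'y) set" where
  "Sel = {f \<in> borel_measurable M. \<forall>\<omega>\<in>space M. f \<omega> \<in> K \<omega>}"

lemma Sel_measurable: "f \<in> Sel \<Longrightarrow> f \<in> borel_measurable M"
  and Sel_in: "f \<in> Sel \<Longrightarrow> \<omega> \<in> space M \<Longrightarrow> f \<omega> \<in> K \<omega>"
  by (auto simp: Sel_def)

lemma Sel_bounded: "f \<in> Sel \<Longrightarrow> AE \<omega> in M. norm (f \<omega>) \<le> H \<omega>"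
  using bounded_K AE_space by eventually_elim (simp add: Sel_in)

lemma Sel_integrable: "f \<in> Sel \<Longrightarrow> integrable M f"
  by (rule Bochner_Integration.integrable_bound[OF integrable_H Sel_measurable])
    (use Sel_bounded H_nonneg in auto)

lemma mid_tail_Sel: "mid_tail f n F \<Longrightarrow> (\<And>j. f j \<in> Sel) \<Longrightarrow> F \<in> Sel"
  using mid_tail_measurable[of f n F M] mid_tail_convex[OF _ convex_K, of f n F]
  by (auto simp: Sel_def)

text \<open>This takes the place of weak sequential compactness of the set of selections. Minimizing
  makes the combinations converge under every \<open>\<nu> k\<close> almost everywhere, and weak
  compactness of \<open>K \<omega>\<close> turns this into a weak limit inside
  \<open>K \<omega>\<close>.\<close>

lemma mid_tail_weak_limit:
  assumes f: "\<And>j. f j \<in> Sel"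
  obtains F g where "\<And>n. mid_tail f n (F n)" "g \<in> Sel"
    "AE \<omega> in M. weak_limit (\<lambda>n. F n \<omega>) (g \<omega>)"
proof -
  note [measurable] = borel_measurable_norming_form[OF norming] borel_measurable_norming_sequence_comp[OF norming]
    borel_measurable_integrable[OF integrable_H]
  \<comment> \<open>\<open>H\<close> is integrable, but its square need not be; after division by (1
    + H)^2 the integrand is bounded by 2 on selections.\<close>
  define q where "q \<omega> y = norming_form \<nu> y / (1 + H \<omega>)\<^sup>2" for \<omega> y
  define Q where "Q F = (\<integral>\<omega>. q \<omega> (F \<omega>) \<partial>M)" for F
  have q_nonneg: "0 \<le> q \<omega> y" for \<omega> y
    using norming_form_bounds[OF norming, of y] by (simp add: q_def)
  have q_le: "q \<omega> y \<le> 2" if "norm y \<le> H \<omega>" for \<omega> y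
  proof -
    have "norming_form \<nu> y \<le> 2 * (norm y)\<^sup>2"
      using norming_form_bounds[OF norming, of y] by simp
    also have "\<dots> \<le> 2 * (1 + H \<omega>)\<^sup>2"
      using that by (intro mult_left_mono power_mono) auto
    finally show ?thesis
      using H_nonneg[of \<omega>] by (simp add: q_def divide_le_eq)
  qed
  have q_int: "integrable M (\<lambda>\<omega>. q \<omega> (F \<omega>))"
    if [measurable]: "F \<in> borel_measurable M" and F: "AE \<omega> in M. norm (F \<omega>) \<le> H \<omega>" for F
  proof (rule integrable_const_bound[of _ 2])
    show "AE \<omega> in M. norm (q \<omega> (F \<omega>)) \<le> 2"
      using F by eventually_elim (use q_le q_nonneg in auto)
    show "(\<lambda>\<omega>. q \<omega> (F \<omega>)) \<in> borel_measurable M"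
      unfolding q_def by measurable
  qed
  have q_S: "integrable M (\<lambda>\<omega>. q \<omega> (F \<omega>))" if "F \<in> Sel" for F
    using q_int Sel_measurable Sel_bounded that by blast
  have half: "(\<lambda>\<omega>. (1/2) *\<^sub>R (F \<omega> - G \<omega>)) \<in> borel_measurable M"
    "AE \<omega> in M. norm ((1/2) *\<^sub>R (F \<omega> - G \<omega>)) \<le> H \<omega>" if "F \<in> Sel" "G \<in> Sel" for F G
  proof -
    note [measurable] = Sel_measurable[OF that(1)] Sel_measurable[OF that(2)]
    show "(\<lambda>\<omega>. (1/2) *\<^sub>R (F \<omega> - G \<omega>)) \<in> borel_measurable M" by measurable
    show "AE \<omega> in M. norm ((1/2) *\<^sub>R (F \<omega> - G \<omega>)) \<le> H \<omega>"
      using Sel_bounded[OF that(1)] Sel_bounded[OF that(2)]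
    proof eventually_elim
      case (elim \<omega>)
      then show ?case using norm_triangle_ineq4[of "F \<omega>" "G \<omega>"] by simp
    qed
  qed
  have in_S: "F \<in> Sel" if "mid_tail f n F" for n F using mid_tail_Sel f that by blast
  \<comment> \<open>The rate 8^-n is spent twice: the weight 4^n used below leaves integrals of
    order 2^-n, which are summable, and boundedness of the summands then gives pointwise decay of
    order 4^-n.\<close>
  obtain F where F: "\<And>n. mid_tail f n (F n)"
    and QF: "\<And>n. Q (\<lambda>\<omega>. (1/2) *\<^sub>R (F n \<omega> - F (Suc n) \<omega>)) \<le> 2 * (1/8) ^ n"
  proof (rule mid_tail_minimizing[of f Q "2 * measure M (space M)" "\<lambda>n. (1/8) ^ n"])
    fix F assume "mid_tail f 0 F"
    then have FS: "F \<in> Sel" by (rule in_S)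
    have "Q F \<le> (\<integral>\<omega>. 2 \<partial>M)"
      unfolding Q_def
    proof (rule integral_mono_AE[OF q_S[OF FS]])
      show "AE \<omega> in M. q \<omega> (F \<omega>) \<le> 2"
        using Sel_bounded[OF FS] by eventually_elim (rule q_le)
    qed simp
    then show "Q F \<in> {0..2 * measure M (space M)}"
      using q_nonneg by (simp add: Q_def mult.commute)
  next
    fix F G assume "mid_tail f 0 F" "mid_tail f 0 G"
    then have FG: "F \<in> Sel" "G \<in> Sel" "(\<lambda>\<omega>. (1/2) *\<^sub>R (F \<omega> + G \<omega>)) \<in> Sel"
      by (auto intro: in_S mid_tail.mid)
    have "Q (\<lambda>\<omega>. (1/2) *\<^sub>R (F \<omega> - G \<omega>)) =
      (\<integral>\<omega>. (q \<omega> (F \<omega>) + q \<omega> (G \<omega>)) / 2 - q \<omega> ((1/2) *\<^sub>R (F \<omega> + G \<omega>)) \<partial>M)"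
      unfolding Q_def q_def norming_form_parallelogram[OF norming]
      by (intro Bochner_Integration.integral_cong refl) (simp add: add_divide_distrib diff_divide_distrib)
    also have "\<dots> = (Q F + Q G) / 2 - Q (\<lambda>\<omega>. (1/2) *\<^sub>R (F \<omega> + G \<omega>))"
      unfolding Q_def using q_S[OF FG(1)] q_S[OF FG(2)] q_S[OF FG(3)] by simp
    finally show "Q (\<lambda>\<omega>. (1/2) *\<^sub>R (F \<omega> - G \<omega>)) = (Q F + Q G) / 2 - Q (\<lambda>\<omega>. (1/2) *\<^sub>R (F \<omega> + G \<omega>))" .
  qed (use that in auto)
  have FS: "F n \<in> Sel" for n using F in_S by blast
  define g where "g n \<omega> = 4 ^ n * q \<omega> ((1/2) *\<^sub>R (F n \<omega> - F (Suc n) \<omega>))" for n \<omega>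
  have "AE \<omega> in M. summable (\<lambda>n. g n \<omega>)"
  proof (rule AE_summable_nonneg)
    show "integrable M (g n)" for n
      unfolding g_def by (intro integrable_mult_right q_int half FS)
    show "AE \<omega> in M. 0 \<le> g n \<omega>" for n
      using q_nonneg by (simp add: g_def)
    show "summable (\<lambda>n. \<integral>\<omega>. g n \<omega> \<partial>M)"
    proof (rule summable_comparison_test')
      show "summable (\<lambda>n. 2 * (1/2::real) ^ n)" by (intro summable_mult summable_geometric) simp
      fix n
      have "(\<integral>\<omega>. g n \<omega> \<partial>M) = 4 ^ n * Q (\<lambda>\<omega>. (1/2) *\<^sub>R (F n \<omega> - F (Suc n) \<omega>))"
        unfolding g_def Q_def by simp
      also have "\<dots> \<le> 4 ^ n * (2 * (1/8) ^ n)"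
        using QF by (intro mult_left_mono) auto
      also have "\<dots> = 2 * (1/2) ^ n"
        by (simp flip: power_mult_distrib)
      finally show "norm (\<integral>\<omega>. g n \<omega> \<partial>M) \<le> 2 * (1/2) ^ n"
        using integral_nonneg_AE[of "g n" M] q_nonneg by (simp add: g_def)
    qed
  qed
  then have "AE \<omega> in M. \<forall>k. convergent (\<lambda>n. \<nu> k (F n \<omega>))"
  proof eventually_elim
    case (elim \<omega>)
    then have "Bseq (\<lambda>n. g n \<omega>)"
      using summable_LIMSEQ_zero convergent_def convergent_imp_Bseq by blast
    then obtain C where C: "\<And>n. \<bar>g n \<omega>\<bar> \<le> C" by (auto simp: Bseq_def)
    have "norming_form \<nu> ((1/2) *\<^sub>R (F n \<omega> - F (Suc n) \<omega>)) \<le> (C * (1 + H \<omega>)\<^sup>2) * (1/4) ^ n" for n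
    proof -
      have "4 ^ n * (norming_form \<nu> ((1/2) *\<^sub>R (F n \<omega> - F (Suc n) \<omega>)) / (1 + H \<omega>)\<^sup>2) \<le> C"
        using abs_le_D1[OF C[of n]] by (simp add: g_def q_def)
      moreover have "(1 + H \<omega>)\<^sup>2 > 0" using H_nonneg[of \<omega>] by simp
      ultimately show ?thesis by (simp add: field_simps power_one_over)
    qed
    then show ?case using convergent_if_norming_form_small[OF norming, of "\<lambda>n. F n \<omega>"] by blast
  qed
  then obtain N where N: "\<And>\<omega>. \<omega> \<in> space M - N \<Longrightarrow> \<forall>k. convergent (\<lambda>n. \<nu> k (F n \<omega>))" "N \<in> null_sets M"
    by (rule AE_E3) (rule that; simp)
  have "\<exists>y\<in>K \<omega>. weak_limit (\<lambda>n. F n \<omega>) y" if \<omega>: "\<omega> \<in> space M - N" for \<omega>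
  proof (rule weakly_compact_weak_limit[OF weakly_compact_K norming])
    show "convergent (\<lambda>n. \<nu> k (F n \<omega>))" for k using N(1)[OF \<omega>] by simp
    show "F n \<omega> \<in> K \<omega>" for n using Sel_in[OF FS] \<omega> by blast
  qed (use \<omega> in blast)
  then obtain l where l: "\<And>\<omega>. \<omega> \<in> space M - N \<Longrightarrow> l \<omega> \<in> K \<omega>"
    "\<And>\<omega>. \<omega> \<in> space M - N \<Longrightarrow> weak_limit (\<lambda>n. F n \<omega>) (l \<omega>)"
    by metis
  \<comment> \<open>The value \<open>F 0 \<omega>\<close> on the null set keeps \<open>g\<close> in
    \<open>K \<omega>\<close> at every point of the space, as \<open>Sel\<close> demands, and keeps
    it measurable.\<close>
  define g where "g \<omega> = (if \<omega> \<in> N then F 0 \<omega> else l \<omega>)" for \<omega>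
  have [measurable]: "N \<in> sets M" using N(2) by auto
  note mS [measurable] = Sel_measurable[OF FS]
  have "g \<in> borel_measurable M"
  proof (rule borel_measurable_norming_sequence[OF norming])
    fix k
    have bl: "bounded_linear (\<nu> k)" using norming by (simp add: norming_sequence_def)
    show "(\<lambda>\<omega>. \<nu> k (g \<omega>)) \<in> borel_measurable M"
    proof (rule borel_measurable_LIMSEQ_real)
      show "(\<lambda>n. if \<omega> \<in> N then \<nu> k (F 0 \<omega>) else \<nu> k (F n \<omega>)) \<longlonglongrightarrow> \<nu> k (g \<omega>)" if "\<omega> \<in> space M" for \<omega>
        using weak_limitD[OF l(2) bl, of \<omega>] that by (auto simp: g_def)
    qed measurable
  qed
  moreover have "g \<omega> \<in> K \<omega>" if "\<omega> \<in> space M" for \<omega>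
    using l(1)[of \<omega>] Sel_in[OF FS that] that by (cases "\<omega> \<in> N") (simp_all add: g_def)
  ultimately have "g \<in> Sel" by (simp add: Sel_def)
  moreover have "AE \<omega> in M. weak_limit (\<lambda>n. F n \<omega>) (g \<omega>)"
    using AE_not_in[OF N(2)] AE_space
  proof eventually_elim
    case (elim \<omega>)
    then have "g \<omega> = l \<omega>" "\<omega> \<in> space M - N" by (simp_all add: g_def)
    then show ?case using l(2) by simp
  qed
  ultimately show thesis using that F by blast
qed

end

subsection \<open>Bounded functionals on integrable functions\<close>

text \<open>The bound by C times the measure does all the work: it makes the value on the remainder
  of a countable union tend to 0, hence gives countable additivity, it gives absolute continuity,
  and it makes m + C \<mu> nonnegative. Radon-Nikodym applies to that sum, and C is subtracted from
  its density.\<close>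

lemma (in finite_measure) finitely_additive_density:
  fixes m :: "'a set \<Rightarrow> real"
  assumes add: "\<And>A B. A \<in> sets M \<Longrightarrow> B \<in> sets M \<Longrightarrow> A \<inter> B = {} \<Longrightarrow> m (A \<union> B) = m A + m B"
    and le: "\<And>A. A \<in> sets M \<Longrightarrow> \<bar>m A\<bar> \<le> C * measure M A"
  obtains \<rho> where "integrable M \<rho>" "\<And>A. A \<in> sets M \<Longrightarrow> m A = (\<integral>\<omega>. indicator A \<omega> * \<rho> \<omega> \<partial>M)"
proof -
  define p where "p A = m A + C * measure M A" for A
  have p_nonneg: "0 \<le> p A" if "A \<in> sets M" for A
    using le[OF that] by (simp add: p_def)
  have m_empty: "m {} = 0" using le[of "{}"] by simp
  have sums: "(\<lambda>i. p (A i)) sums p (\<Union>i. A i)"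
    if A: "range A \<subseteq> sets M" "disjoint_family A" for A :: "nat \<Rightarrow> 'a set"
  proof -
    have [measurable]: "A i \<in> sets M" for i using A(1) by blast
    define D where "D n = (\<Union>i. A i) - (\<Union>i<n. A i)" for n
    have D [measurable]: "D n \<in> sets M" for n unfolding D_def by measurable
    have U: "(\<Union>i<n. A i) \<in> sets M" for n by measurable
    have disj: "A n \<inter> (\<Union>i<n. A i) = {}" for n
    proof -
      have "A n \<inter> A i = {}" if "i < n" for i
        using A(2) that by (simp add: disjoint_family_on_def)
      then show ?thesis by blast
    qed
    have m_fin: "m (\<Union>i<n. A i) = (\<Sum>i<n. m (A i))" for n
    proof (induction n)
      case (Suc n)
      have "(\<Union>i<Suc n. A i) = A n \<union> (\<Union>i<n. A i)" by (auto simp: less_Suc_eq)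
      then show ?case using add[OF _ U disj] Suc by simp
    qed (simp add: m_empty)
    have mu: "(\<lambda>i. measure M (A i)) sums measure M (\<Union>i. A i)"
      using A by (rule finite_measure_UNION)
    have mu_fin: "measure M (\<Union>i<n. A i) = (\<Sum>i<n. measure M (A i))" for n
      by (rule finite_measure_finite_Union) (use A in \<open>auto intro: disjoint_family_on_mono\<close>)
    have Un: "(\<Union>i. A i) = (\<Union>i<n. A i) \<union> D n" "(\<Union>i<n. A i) \<inter> D n = {}" for n
      by (auto simp: D_def)
    have eq: "m (\<Union>i. A i) - m (D n) = (\<Sum>i<n. m (A i))" for n
      using add[OF U D Un(2)] Un(1)[of n] m_fin[of n] by simp
    have muD: "measure M (D n) = measure M (\<Union>i. A i) - (\<Sum>i<n. measure M (A i))" for n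
      using finite_measure_Union[OF U D Un(2)] Un(1)[of n] mu_fin[of n] by simp
    have "(\<lambda>n. C * measure M (D n)) \<longlonglongrightarrow> C * (measure M (\<Union>i. A i) - measure M (\<Union>i. A i))"
      unfolding muD using mu unfolding sums_def by (intro tendsto_intros)
    then have "(\<lambda>n. C * measure M (D n)) \<longlonglongrightarrow> 0" by simp
    then have "(\<lambda>n. m (D n)) \<longlonglongrightarrow> 0"
      by (rule Lim_null_comparison[rotated]) (use le[OF D] in simp)
    then have "(\<lambda>n. m (\<Union>i. A i) - m (D n)) \<longlonglongrightarrow> m (\<Union>i. A i) - 0"
      by (intro tendsto_intros)
    then have "(\<lambda>i. m (A i)) sums m (\<Union>i. A i)"
      unfolding sums_def eq by simp
    then show ?thesis
      unfolding p_def using mu by (intro sums_add sums_mult)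
  qed
  define N where "N = measure_of (space M) (sets M) (\<lambda>A. ennreal (p A))"
  have sets_N: "sets N = sets M" by (simp add: N_def)
  have emeasure_N: "emeasure N A = ennreal (p A)" if "A \<in> sets M" for A
    unfolding N_def
  proof (rule emeasure_measure_of_sigma[OF _ _ _ that])
    show "sigma_algebra (space M) (sets M)" by (rule sets.sigma_algebra_axioms)
    show "positive (sets M) (\<lambda>A. ennreal (p A))"
      by (simp add: positive_def p_def m_empty)
    show "countably_additive (sets M) (\<lambda>A. ennreal (p A))"
    proof (rule countably_additiveI)
      fix A :: "nat \<Rightarrow> 'a set"
      assume A: "range A \<subseteq> sets M" "disjoint_family A"
      have "(\<Sum>i. ennreal (p (A i))) = ennreal (\<Sum>i. p (A i))"
        using sums[OF A] A(1) by (intro suminf_ennreal2 p_nonneg) (auto simp: sums_iff)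
      then show "(\<Sum>i. ennreal (p (A i))) = ennreal (p (\<Union>i. A i))"
        using sums[OF A] by (simp add: sums_iff)
    qed
  qed
  interpret N: finite_measure N
    by (rule finite_measureI) (use emeasure_N[of "space M"] sets_eq_imp_space_eq[OF sets_N] in simp)
  have ac: "absolutely_continuous M N"
    unfolding absolutely_continuous_def
  proof
    fix A assume A: "A \<in> null_sets M"
    then have "p A = 0" using le[of A] null_setsD2[OF A] by (simp add: p_def measure_eq_0_null_sets)
    then show "A \<in> null_sets N" using emeasure_N[of A] A by (intro null_setsI) (auto simp: sets_N)
  qed
  obtain f where f: "f \<in> borel_measurable M" "\<And>x. 0 \<le> f x" "AE x in M. RN_deriv M N x = ennreal (f x)"
    using real_RN_deriv[OF N.finite_measure_axioms ac sets_N] by metis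
  have bi: "has_bochner_integral M (\<lambda>x. indicator A x * f x) (p A)" if A: "A \<in> sets M" for A
  proof (rule has_bochner_integral_nn_integral)
    have "(\<integral>\<^sup>+ x. ennreal (indicator A x * f x) \<partial>M) = (\<integral>\<^sup>+ x. RN_deriv M N x * indicator A x \<partial>M)"
      by (intro nn_integral_cong_AE, use f(3) in eventually_elim) (auto split: split_indicator)
    also have "\<dots> = emeasure (density M (RN_deriv M N)) A"
      using A by (simp add: emeasure_density)
    also have "\<dots> = ennreal (p A)"
      using density_RN_deriv[OF ac sets_N] emeasure_N[OF A] by simp
    finally show "(\<integral>\<^sup>+ x. ennreal (indicator A x * f x) \<partial>M) = ennreal (p A)" .
    show "(\<lambda>x. indicator A x * f x) \<in> borel_measurable M" using A f(1) by measurable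
  qed (use f(2) p_nonneg[OF A] in auto)
  have f_int: "integrable M f"
    using bi[OF sets.top] by (auto simp: has_bochner_integral_iff cong: Bochner_Integration.integrable_cong)
  show thesis
  proof (rule that)
    show "integrable M (\<lambda>x. f x - C)" using f_int by simp
    fix A assume A: "A \<in> sets M"
    have "(\<integral>x. indicator A x * (f x - C) \<partial>M) = (\<integral>x. indicator A x * f x - C * indicator A x \<partial>M)"
      by (intro Bochner_Integration.integral_cong) (auto simp: algebra_simps)
    also have "\<dots> = (\<integral>x. indicator A x * f x \<partial>M) - (\<integral>x. C * indicator A x \<partial>M)"
    proof (rule Bochner_Integration.integral_diff)
      show "integrable M (\<lambda>x. indicator A x * f x)" using bi[OF A] by (simp add: has_bochner_integral_iff)
      show "integrable M (\<lambda>x. C * indicator A x)"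
        by (intro integrable_mult_right integrable_real_indicator[OF A]) (simp add: less_top[symmetric])
    qed
    also have "\<dots> = p A - C * measure M A"
      using bi[OF A] A by (simp add: has_bochner_integral_iff)
    finally show "m A = (\<integral>x. indicator A x * (f x - C) \<partial>M)" by (simp add: p_def)
  qed
qed

text \<open>One inequality encodes everything: a = 0 gives a Lipschitz bound, a = 1 with j = k the
  norm bound, and the general case linearity in the limit. The coefficients are rational because the
  inequality will be available only off a null set, hence for countably many choices; real
  coefficients follow by approximation.\<close>

lemma extend_from_dense_sequence:
  fixes e :: "nat \<Rightarrow> 'a::real_normed_vector" and idx :: "nat \<Rightarrow> 'a \<Rightarrow> nat" and r :: "nat \<Rightarrow> real"
  assumes idx: "\<And>y::'a. (\<lambda>n. e (idx n y)) \<longlonglongrightarrow> y"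
    and r: "\<And>a i j k. a \<in> \<rat> \<Longrightarrow> \<bar>a * r i + r j - r k\<bar> \<le> C * norm (a *\<^sub>R e i + e j - e k)"
  defines "L \<equiv> \<lambda>y. lim (\<lambda>n. r (idx n y))"
  shows "(\<lambda>n. r (idx n y)) \<longlonglongrightarrow> L y" and "bounded_linear L" and "\<bar>L y\<bar> \<le> C * norm y" and "L (e i) = r i"
proof -
  have diff: "\<bar>r j - r k\<bar> \<le> C * norm (e j - e k)" for j k using r[of 0 0 j k] by simp
  have bound: "\<bar>r i\<bar> \<le> C * norm (e i)" for i using r[of 1 i 0 0] by simp
  have lim: "(\<lambda>n. r (idx n y)) \<longlonglongrightarrow> L y" for y
  proof -
    have "Cauchy (\<lambda>n. r (idx n y))"
    proof (rule metric_CauchyI)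
      fix \<delta> :: real assume "\<delta> > 0"
      then have "\<delta> / (\<bar>C\<bar> + 1) > 0" by simp
      then obtain N where N: "\<And>m n. m \<ge> N \<Longrightarrow> n \<ge> N \<Longrightarrow> norm (e (idx m y) - e (idx n y)) < \<delta> / (\<bar>C\<bar> + 1)"
        using LIMSEQ_imp_Cauchy[OF idx[of y]] unfolding Cauchy_def dist_norm by metis
      have "\<bar>r (idx m y) - r (idx n y)\<bar> < \<delta>" if mn: "m \<ge> N" "n \<ge> N" for m n
      proof -
        let ?d = "norm (e (idx m y) - e (idx n y))"
        have "\<bar>r (idx m y) - r (idx n y)\<bar> \<le> C * ?d" by (rule diff)
        also have "\<dots> \<le> (\<bar>C\<bar> + 1) * ?d" by (intro mult_right_mono) auto
        also have "\<dots> < \<delta>" using N[OF mn] by (simp add: pos_less_divide_eq mult.commute)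
        finally show ?thesis .
      qed
      then show "\<exists>N. \<forall>m\<ge>N. \<forall>n\<ge>N. dist (r (idx m y)) (r (idx n y)) < \<delta>"
        unfolding dist_real_def by blast
    qed
    then show ?thesis unfolding L_def using Cauchy_convergent convergent_LIMSEQ_iff by blast
  qed
  then show "(\<lambda>n. r (idx n y)) \<longlonglongrightarrow> L y" .
  have bnd: "\<bar>L y\<bar> \<le> C * norm y" for y
    by (rule LIMSEQ_le[OF tendsto_rabs[OF lim] tendsto_mult_left[OF tendsto_norm[OF idx]]]) (use bound in auto)
  then show "\<bar>L y\<bar> \<le> C * norm y" .
  have comb: "a * L y + L z = L (a *\<^sub>R y + z)" for a y z
  proof -
    obtain q :: "nat \<Rightarrow> rat" where q: "(\<lambda>n. real_of_rat (q n)) \<longlonglongrightarrow> a"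
    proof -
      have "\<exists>q. a < real_of_rat q \<and> real_of_rat q < a + 1 / real (Suc n)" for n
        by (intro of_rat_dense) simp
      then obtain q where q: "\<And>n. a < real_of_rat (q n)" "\<And>n. real_of_rat (q n) < a + 1 / real (Suc n)" by metis
      have "(\<lambda>n. a + 1 / real (Suc n)) \<longlonglongrightarrow> a"
        using LIMSEQ_inverse_real_of_nat_add[of a] by (simp add: inverse_eq_divide)
      then have "(\<lambda>n. real_of_rat (q n)) \<longlonglongrightarrow> a"
        by (rule tendsto_sandwich[OF _ _ tendsto_const, rotated 2]) (intro always_eventually allI less_imp_le q)+
      then show thesis by (rule that)
    qed
    let ?w = "a *\<^sub>R y + z"
    have "(\<lambda>n. \<bar>real_of_rat (q n) * r (idx n y) + r (idx n z) - r (idx n ?w)\<bar>) \<longlonglongrightarrow> \<bar>a * L y + L z - L ?w\<bar>"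
      by (intro tendsto_intros q lim)
    moreover have "(\<lambda>n. C * norm (real_of_rat (q n) *\<^sub>R e (idx n y) + e (idx n z) - e (idx n ?w))) \<longlonglongrightarrow>
        C * norm (a *\<^sub>R y + z - ?w)"
      by (intro tendsto_intros q idx)
    ultimately have "\<bar>a * L y + L z - L ?w\<bar> \<le> C * norm (a *\<^sub>R y + z - ?w)"
      by (rule LIMSEQ_le) (intro exI allI impI r Rats_of_rat)
    then show ?thesis by simp
  qed
  have L0: "L 0 = 0" using bnd[of 0] by simp
  show "bounded_linear L"
  proof (rule bounded_linear_intro)
    show "L (x + y) = L x + L y" for x y using comb[of 1 x y] by simp
    show "L (c *\<^sub>R x) = c *\<^sub>R L x" for c x using comb[of c x 0] L0 by simp
    show "norm (L x) \<le> norm x * C" for x using bnd[of x] by (simp add: mult.commute)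
  qed
  have "(\<lambda>n. C * norm (e i - e (idx n (e i)))) \<longlonglongrightarrow> C * norm (e i - e i)"
    by (intro tendsto_intros idx)
  then have "(\<lambda>n. C * norm (e i - e (idx n (e i)))) \<longlonglongrightarrow> 0" by simp
  then have "(\<lambda>n. r i - r (idx n (e i))) \<longlonglongrightarrow> 0"
    by (rule Lim_null_comparison[rotated]) (use diff in simp)
  moreover have "(\<lambda>n. r i - r (idx n (e i))) \<longlonglongrightarrow> r i - L (e i)"
    by (intro tendsto_intros lim)
  ultimately show "L (e i) = r i" using LIMSEQ_unique by fastforce
qed

text \<open>The conditions of \<open>L1_dual\<close> on functions instead of classes, with the
  constant made explicit. The bound forces equal values on functions that agree almost everywhere
  (\<open>L1_functional_cong\<close>).\<close>

definition L1_functional :: "'w measure \<Rightarrow> real \<Rightarrow> (('w \<Rightarrow> 'a::{banach, second_countable_topology}) \<Rightarrow> real) \<Rightarrow> bool" where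
  "L1_functional M C \<Phi> \<longleftrightarrow>
     (\<forall>f g. integrable M f \<longrightarrow> integrable M g \<longrightarrow> \<Phi> (\<lambda>\<omega>. f \<omega> + g \<omega>) = \<Phi> f + \<Phi> g) \<and>
     (\<forall>c f. integrable M f \<longrightarrow> \<Phi> (\<lambda>\<omega>. c *\<^sub>R f \<omega>) = c * \<Phi> f) \<and>
     (\<forall>f. integrable M f \<longrightarrow> \<bar>\<Phi> f\<bar> \<le> C * (\<integral>\<omega>. norm (f \<omega>) \<partial>M))"

lemma L1_functional_add: "L1_functional M C \<Phi> \<Longrightarrow> integrable M f \<Longrightarrow> integrable M g \<Longrightarrow>
    \<Phi> (\<lambda>\<omega>. f \<omega> + g \<omega>) = \<Phi> f + \<Phi> g"
  and L1_functional_scale: "L1_functional M C \<Phi> \<Longrightarrow> integrable M f \<Longrightarrow> \<Phi> (\<lambda>\<omega>. c *\<^sub>R f \<omega>) = c * \<Phi> f"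
  and L1_functional_bound: "L1_functional M C \<Phi> \<Longrightarrow> integrable M f \<Longrightarrow> \<bar>\<Phi> f\<bar> \<le> C * (\<integral>\<omega>. norm (f \<omega>) \<partial>M)"
  by (auto simp: L1_functional_def)

lemma L1_functional_diff:
  assumes "L1_functional M C \<Phi>" "integrable M f" "integrable M g"
  shows "\<Phi> (\<lambda>\<omega>. f \<omega> - g \<omega>) = \<Phi> f - \<Phi> g"
  using L1_functional_add[OF assms(1,2), of "\<lambda>\<omega>. - 1 *\<^sub>R g \<omega>"] L1_functional_scale[OF assms(1,3), of "-1"] assms(3)
  by simp

lemma L1_functional_cong:
  assumes \<Phi>: "L1_functional M C \<Phi>" and f: "integrable M f" and g: "integrable M g" and eq: "AE \<omega> in M. f \<omega> = g \<omega>"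
  shows "\<Phi> f = \<Phi> g"
proof -
  have "(\<integral>\<omega>. norm (f \<omega> - g \<omega>) \<partial>M) = (\<integral>\<omega>. 0 \<partial>M)"
    using f g eq by (intro integral_cong_AE) auto
  then show ?thesis
    using L1_functional_bound[OF \<Phi>, of "\<lambda>\<omega>. f \<omega> - g \<omega>"] L1_functional_diff[OF \<Phi> f g] f g by simp
qed

text \<open>Indicators times vectors of a dense sequence are total in L1: the bound carries the
  vanishing to all vectors and through dominated limits.\<close>

lemma (in finite_measure) L1_functional_eq_0:
  assumes \<Phi>: "L1_functional M C \<Phi>" and dense: "\<And>y \<delta>. \<delta> > 0 \<Longrightarrow> \<exists>k. dist y (e k) < \<delta>"
    and 0: "\<And>A i. A \<in> sets M \<Longrightarrow> \<Phi> (\<lambda>\<omega>. indicator A \<omega> *\<^sub>R e i) = 0"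
    and f: "integrable M f"
  shows "\<Phi> f = 0"
  using f
proof (induction rule: integrable_induct)
  case (base A c)
  have int: "integrable M (\<lambda>\<omega>. indicator A \<omega> *\<^sub>R y)" for y :: 'b
    using base(1) by (intro integrable_scaleR_left integrable_real_indicator) (auto simp: less_top[symmetric])
  have le: "\<bar>\<Phi> (\<lambda>\<omega>. indicator A \<omega> *\<^sub>R c)\<bar> \<le> \<bar>C\<bar> * measure M A * norm (c - e k)" for k
  proof -
    have "\<Phi> (\<lambda>\<omega>. indicator A \<omega> *\<^sub>R c) = \<Phi> (\<lambda>\<omega>. indicator A \<omega> *\<^sub>R (c - e k))"
      using L1_functional_diff[OF \<Phi> int int, of c "e k"] 0[OF base(1)]
      by (simp add: scaleR_diff_right)
    also have "\<bar>\<dots>\<bar> \<le> C * (\<integral>\<omega>. norm (indicator A \<omega> *\<^sub>R (c - e k)) \<partial>M)"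
      by (rule L1_functional_bound[OF \<Phi> int])
    also have "(\<integral>\<omega>. norm (indicator A \<omega> *\<^sub>R (c - e k)) \<partial>M) = measure M A * norm (c - e k)"
      using base(1) by simp
    also have "C * (measure M A * norm (c - e k)) \<le> \<bar>C\<bar> * (measure M A * norm (c - e k))"
      by (intro mult_right_mono) auto
    finally show ?thesis by (simp add: mult.assoc)
  qed
  have "\<bar>\<Phi> (\<lambda>\<omega>. indicator A \<omega> *\<^sub>R c)\<bar> \<le> 0"
  proof (rule field_le_epsilon)
    fix \<delta> :: real assume \<delta>: "\<delta> > 0"
    have pos: "\<bar>C\<bar> * measure M A + 1 > 0" by (simp add: add_nonneg_pos)
    then obtain k where k: "dist c (e k) < \<delta> / (\<bar>C\<bar> * measure M A + 1)"
      using dense[of "\<delta> / (\<bar>C\<bar> * measure M A + 1)" c] \<delta> by auto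
    have "\<bar>\<Phi> (\<lambda>\<omega>. indicator A \<omega> *\<^sub>R c)\<bar> \<le> (\<bar>C\<bar> * measure M A + 1) * norm (c - e k)"
      using le[of k] by (simp add: distrib_right add_increasing2)
    also have "\<dots> \<le> \<delta>"
      using k pos by (simp add: dist_norm pos_less_divide_eq mult.commute)
    finally show "\<bar>\<Phi> (\<lambda>\<omega>. indicator A \<omega> *\<^sub>R c)\<bar> \<le> 0 + \<delta>" by simp
  qed
  then show ?case by simp
next
  case (add f g)
  then show ?case using L1_functional_add[OF \<Phi>] by simp
next
  case (lim f s)
  have "(\<lambda>i. \<integral>\<omega>. norm (f \<omega> - s i \<omega>) \<partial>M) \<longlonglongrightarrow> (\<integral>\<omega>. 0 \<partial>M)"
  proof (rule integral_dominated_convergence[where w="\<lambda>\<omega>. 3 * norm (f \<omega>)"])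
    show "AE \<omega> in M. (\<lambda>i. norm (f \<omega> - s i \<omega>)) \<longlonglongrightarrow> 0"
    proof (rule AE_I2)
      fix \<omega> assume "\<omega> \<in> space M"
      then have "(\<lambda>i. norm (f \<omega> - s i \<omega>)) \<longlonglongrightarrow> norm (f \<omega> - f \<omega>)"
        by (intro tendsto_intros lim.hyps(2))
      then show "(\<lambda>i. norm (f \<omega> - s i \<omega>)) \<longlonglongrightarrow> 0" by simp
    qed
    show "AE \<omega> in M. norm (norm (f \<omega> - s i \<omega>)) \<le> 3 * norm (f \<omega>)" for i
    proof (rule AE_I2)
      fix \<omega> assume "\<omega> \<in> space M"
      from lim.hyps(3)[OF this, of i] show "norm (norm (f \<omega> - s i \<omega>)) \<le> 3 * norm (f \<omega>)"
        using norm_triangle_ineq4[of "f \<omega>" "s i \<omega>"] by simp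
    qed
  qed (use lim.hyps(1,4) in auto)
  then have "(\<lambda>i. C * (\<integral>\<omega>. norm (f \<omega> - s i \<omega>) \<partial>M)) \<longlonglongrightarrow> C * 0"
    by (intro tendsto_mult_left) simp
  moreover have "\<bar>\<Phi> f\<bar> \<le> C * (\<integral>\<omega>. norm (f \<omega> - s i \<omega>) \<partial>M)" for i
    using L1_functional_diff[OF \<Phi> lim.hyps(4) lim.hyps(1)[of i]] lim.IH[of i]
      L1_functional_bound[OF \<Phi>, of "\<lambda>\<omega>. f \<omega> - s i \<omega>"] lim.hyps(1)[of i] lim.hyps(4) by simp
  ultimately have "\<bar>\<Phi> f\<bar> \<le> C * 0"
    by (intro LIMSEQ_le_const) auto
  then show ?case by simp
qed

text \<open>No measurability of \<Psi> as a map into the dual of Y is claimed, only that of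
  \<open>\<Psi> \<omega> (f \<omega>)\<close>. Each vector \<open>e i\<close> of a dense sequence
  has a scalar density \<open>\<rho> i\<close>, and at almost every point these densities extend to
  a bounded linear functional on Y.\<close>

lemma (in finite_measure) L1_functional_representation:
  fixes \<Phi> :: "('a \<Rightarrow> 'b::{banach, second_countable_topology}) \<Rightarrow> real"
  assumes \<Phi>: "L1_functional M C \<Phi>"
  obtains \<Psi> where "\<And>\<omega>. bounded_linear (\<Psi> \<omega>)" "\<And>\<omega> y. \<bar>\<Psi> \<omega> y\<bar> \<le> \<bar>C\<bar> * norm y"
    "\<And>f. integrable M f \<Longrightarrow> integrable M (\<lambda>\<omega>. \<Psi> \<omega> (f \<omega>))"
    "\<And>f. integrable M f \<Longrightarrow> \<Phi> f = (\<integral>\<omega>. \<Psi> \<omega> (f \<omega>) \<partial>M)"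
proof -
  obtain e :: "nat \<Rightarrow> 'b" where e: "\<And>y \<delta>. \<delta> > 0 \<Longrightarrow> \<exists>k. dist y (e k) < \<delta>"
    using dense_sequence by blast
  have int: "integrable M (\<lambda>\<omega>. indicator A \<omega> *\<^sub>R y)" if "A \<in> sets M" for A and y :: 'b
    using that by (intro integrable_scaleR_left integrable_real_indicator) (auto simp: less_top[symmetric])
  have bound: "\<bar>\<Phi> (\<lambda>\<omega>. indicator A \<omega> *\<^sub>R y)\<bar> \<le> (C * norm y) * measure M A" if "A \<in> sets M" for A y
    using L1_functional_bound[OF \<Phi> int[OF that], of y] that by (simp add: mult_ac)
  have "\<exists>\<rho>. integrable M \<rho> \<and> (\<forall>A\<in>sets M. \<Phi> (\<lambda>\<omega>. indicator A \<omega> *\<^sub>R e i) = (\<integral>\<omega>. indicator A \<omega> * \<rho> \<omega> \<partial>M))" for i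
  proof (rule finitely_additive_density[of "\<lambda>A. \<Phi> (\<lambda>\<omega>. indicator A \<omega> *\<^sub>R e i)"])
    fix A B assume AB: "A \<in> sets M" "B \<in> sets M" "A \<inter> B = {}"
    have "(\<lambda>\<omega>. indicator (A \<union> B) \<omega> *\<^sub>R e i) = (\<lambda>\<omega>. indicator A \<omega> *\<^sub>R e i + indicator B \<omega> *\<^sub>R e i)"
      using AB(3) by (auto simp: fun_eq_iff split: split_indicator)
    then show "\<Phi> (\<lambda>\<omega>. indicator (A \<union> B) \<omega> *\<^sub>R e i) = \<Phi> (\<lambda>\<omega>. indicator A \<omega> *\<^sub>R e i) + \<Phi> (\<lambda>\<omega>. indicator B \<omega> *\<^sub>R e i)"
      using L1_functional_add[OF \<Phi> int[OF AB(1)] int[OF AB(2)]] by simp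
  qed (use bound in auto)
  then obtain \<rho> where \<rho>: "\<And>i. integrable M (\<rho> i)"
    "\<And>i A. A \<in> sets M \<Longrightarrow> \<Phi> (\<lambda>\<omega>. indicator A \<omega> *\<^sub>R e i) = (\<integral>\<omega>. indicator A \<omega> * \<rho> i \<omega> \<partial>M)"
    by metis
  \<comment> \<open>The bound on \<Phi> controls the average of the left-hand expression over every
    set of positive measure; the averaging theorem turns this into a bound at almost every
    point.\<close>
  have "AE \<omega> in M. \<bar>a * \<rho> i \<omega> + \<rho> j \<omega> - \<rho> k \<omega>\<bar> \<le> \<bar>C\<bar> * norm (a *\<^sub>R e i + e j - e k)" for a i j k
  proof -
    let ?v = "a *\<^sub>R e i + e j - e k" and ?u = "\<lambda>\<omega>. a * \<rho> i \<omega> + \<rho> j \<omega> - \<rho> k \<omega>"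
    have "AE \<omega> in M. ?u \<omega> \<in> cball 0 (\<bar>C\<bar> * norm ?v)"
    proof (rule averaging_theorem)
      show "integrable M ?u" using \<rho>(1) by simp
      fix A assume A: "A \<in> sets M" "measure M A > 0"
      have intA: "integrable M (\<lambda>\<omega>. indicator A \<omega> * \<rho> l \<omega>)" for l
        using integrable_mult_indicator[OF A(1) \<rho>(1)[of l]] by simp
      note I = int[OF A(1)]
      have Ia: "integrable M (\<lambda>\<omega>. a *\<^sub>R indicator A \<omega> *\<^sub>R e i)"
        by (intro integrable_scaleR_right I)
      have "set_lebesgue_integral M A ?u =
          (\<integral>\<omega>. a * (indicator A \<omega> * \<rho> i \<omega>) + indicator A \<omega> * \<rho> j \<omega> - indicator A \<omega> * \<rho> k \<omega> \<partial>M)"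
        unfolding set_lebesgue_integral_def
        by (intro Bochner_Integration.integral_cong) (auto simp: algebra_simps)
      also have "\<dots> = a * \<Phi> (\<lambda>\<omega>. indicator A \<omega> *\<^sub>R e i) + \<Phi> (\<lambda>\<omega>. indicator A \<omega> *\<^sub>R e j) - \<Phi> (\<lambda>\<omega>. indicator A \<omega> *\<^sub>R e k)"
        using intA A(1) by (simp add: \<rho>(2))
      also have "\<dots> = \<Phi> (\<lambda>\<omega>. a *\<^sub>R indicator A \<omega> *\<^sub>R e i + indicator A \<omega> *\<^sub>R e j - indicator A \<omega> *\<^sub>R e k)"
        by (simp only: L1_functional_diff[OF \<Phi> Bochner_Integration.integrable_add[OF Ia I] I]
          L1_functional_add[OF \<Phi> Ia I] L1_functional_scale[OF \<Phi> I])
      also have "(\<lambda>\<omega>. a *\<^sub>R indicator A \<omega> *\<^sub>R e i + indicator A \<omega> *\<^sub>R e j - indicator A \<omega> *\<^sub>R e k) = (\<lambda>\<omega>. indicator A \<omega> *\<^sub>R ?v)"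
        by (auto simp: fun_eq_iff split: split_indicator)
      finally have "\<bar>set_lebesgue_integral M A ?u\<bar> \<le> (C * norm ?v) * measure M A"
        using bound[OF A(1), of ?v] by simp
      also have "\<dots> \<le> (\<bar>C\<bar> * norm ?v) * measure M A"
        by (intro mult_right_mono) auto
      finally show "(1 / measure M A) *\<^sub>R set_lebesgue_integral M A ?u \<in> cball 0 (\<bar>C\<bar> * norm ?v)"
        using A(2) by (simp add: field_simps abs_mult)
    qed simp
    then show ?thesis by simp
  qed
  \<comment> \<open>Rational coefficients and natural indices are countably many, so a single null
    set serves all of them.\<close>
  then have "AE \<omega> in M. \<forall>a\<in>\<rat>. \<forall>i j k. \<bar>a * \<rho> i \<omega> + \<rho> j \<omega> - \<rho> k \<omega>\<bar> \<le> \<bar>C\<bar> * norm (a *\<^sub>R e i + e j - e k)"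
    by (simp add: AE_ball_countable countable_rat AE_all_countable)
  then obtain N where N: "\<And>\<omega>. \<omega> \<in> space M - N \<Longrightarrow>
      \<forall>a\<in>\<rat>. \<forall>i j k. \<bar>a * \<rho> i \<omega> + \<rho> j \<omega> - \<rho> k \<omega>\<bar> \<le> \<bar>C\<bar> * norm (a *\<^sub>R e i + e j - e k)" "N \<in> null_sets M"
    by (rule AE_E3) (rule that; simp)
  \<comment> \<open>An explicit approximation by least indices, so that
    \<open>idx n (f \<omega>)\<close> is measurable with countably many values; \<Psi> along
    \<open>f\<close> is then a limit of measurable functions.\<close>
  define idx where "idx n y = (LEAST i. dist y (e i) < inverse (real (Suc n)))" for n y
  have idx: "(\<lambda>n. e (idx n y)) \<longlonglongrightarrow> y" for y
  proof -
    have "dist y (e (idx n y)) < inverse (real (Suc n))" for n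
      unfolding idx_def by (rule LeastI_ex) (rule e, simp)
    then show ?thesis
      by (intro metric_tendsto_imp_tendsto[OF LIMSEQ_inverse_real_of_nat] always_eventually)
        (simp add: dist_commute less_imp_le)
  qed
  define bad where "bad \<omega> \<longleftrightarrow> \<omega> \<in> N \<or> \<omega> \<notin> space M" for \<omega>
  \<comment> \<open>The default 0 at exceptional points makes \<open>\<Psi> \<omega>\<close> bounded
    and linear for every \<omega>.\<close>
  define \<Psi> where "\<Psi> \<omega> y = (if bad \<omega> then 0 else lim (\<lambda>n. \<rho> (idx n y) \<omega>))" for \<omega> y
  have good: "(\<lambda>n. \<rho> (idx n y) \<omega>) \<longlonglongrightarrow> \<Psi> \<omega> y" "bounded_linear (\<Psi> \<omega>)" "\<bar>\<Psi> \<omega> y\<bar> \<le> \<bar>C\<bar> * norm y" "\<Psi> \<omega> (e i) = \<rho> i \<omega>"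
    if "\<not> bad \<omega>" for \<omega> y i
  proof -
    have "\<bar>a * \<rho> i \<omega> + \<rho> j \<omega> - \<rho> k \<omega>\<bar> \<le> \<bar>C\<bar> * norm (a *\<^sub>R e i + e j - e k)" if "a \<in> \<rat>" for a i j k
      using N(1)[of \<omega>] \<open>\<not> bad \<omega>\<close> that by (simp add: bad_def)
    from extend_from_dense_sequence[of e idx "\<lambda>i. \<rho> i \<omega>", OF idx this]
    show "(\<lambda>n. \<rho> (idx n y) \<omega>) \<longlonglongrightarrow> \<Psi> \<omega> y" "bounded_linear (\<Psi> \<omega>)" "\<bar>\<Psi> \<omega> y\<bar> \<le> \<bar>C\<bar> * norm y" "\<Psi> \<omega> (e i) = \<rho> i \<omega>"
      using that unfolding \<Psi>_def by simp_all
  qed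
  have lin: "bounded_linear (\<Psi> \<omega>)" for \<omega>
  proof (cases "bad \<omega>")
    case True
    then have "\<Psi> \<omega> = (\<lambda>y. 0)" by (auto simp: \<Psi>_def)
    then show ?thesis by simp
  qed (rule good)
  have bnd: "\<bar>\<Psi> \<omega> y\<bar> \<le> \<bar>C\<bar> * norm y" for \<omega> y
    by (cases "bad \<omega>") (simp add: \<Psi>_def, rule good)
  have meas: "(\<lambda>\<omega>. \<Psi> \<omega> (f \<omega>)) \<in> borel_measurable M" if [measurable]: "f \<in> borel_measurable M" for f
  proof (rule borel_measurable_LIMSEQ_real)
    have [measurable]: "N \<in> sets M" using N(2) by auto
    have [measurable]: "(\<lambda>\<omega>. idx n (f \<omega>)) \<in> measurable M (count_space UNIV)" for n
      unfolding idx_def by (rule measurable_Least) measurable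
    have [measurable]: "(\<lambda>\<omega>. \<rho> (idx n (f \<omega>)) \<omega>) \<in> borel_measurable M" for n
      by (rule measurable_compose_countable[where f="\<lambda>i \<omega>. \<rho> i \<omega>"]) (use \<rho>(1) in measurable)
    show "(\<lambda>\<omega>. if \<omega> \<in> N then 0 else \<rho> (idx n (f \<omega>)) \<omega>) \<in> borel_measurable M" for n by measurable
    show "(\<lambda>n. if \<omega> \<in> N then 0 else \<rho> (idx n (f \<omega>)) \<omega>) \<longlonglongrightarrow> \<Psi> \<omega> (f \<omega>)" if "\<omega> \<in> space M" for \<omega>
      using good(1)[of \<omega> "f \<omega>"] that by (cases "\<omega> \<in> N") (auto simp: bad_def \<Psi>_def)
  qed
  have \<Psi>_int: "integrable M (\<lambda>\<omega>. \<Psi> \<omega> (f \<omega>))" if "integrable M f" for f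
  proof (rule Bochner_Integration.integrable_bound)
    show "integrable M (\<lambda>\<omega>. \<bar>C\<bar> * norm (f \<omega>))" using that by simp
    show "(\<lambda>\<omega>. \<Psi> \<omega> (f \<omega>)) \<in> borel_measurable M" using that by (intro meas) simp
  qed (use bnd in simp)
  \<comment> \<open>The difference between \<Phi> and its candidate is itself an
    \<open>L1_functional\<close>, so it suffices that it vanishes on indicators times the
    \<open>e i\<close>.\<close>
  define \<Delta> where "\<Delta> f = \<Phi> f - (\<integral>\<omega>. \<Psi> \<omega> (f \<omega>) \<partial>M)" for f
  have \<Delta>: "L1_functional M (C + \<bar>C\<bar>) \<Delta>"
    unfolding L1_functional_def
  proof (intro conjI allI impI)
    fix f g :: "'a \<Rightarrow> 'b" and c assume f: "integrable M f"
    show "\<Delta> (\<lambda>\<omega>. c *\<^sub>R f \<omega>) = c * \<Delta> f"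
      using L1_functional_scale[OF \<Phi> f]
      by (simp add: \<Delta>_def linear_scale[OF bounded_linear.linear[OF lin]] right_diff_distrib)
    have "\<bar>\<integral>\<omega>. \<Psi> \<omega> (f \<omega>) \<partial>M\<bar> \<le> (\<integral>\<omega>. \<bar>\<Psi> \<omega> (f \<omega>)\<bar> \<partial>M)"
      by (rule integral_abs_bound)
    also have "\<dots> \<le> (\<integral>\<omega>. \<bar>C\<bar> * norm (f \<omega>) \<partial>M)"
      using \<Psi>_int[OF f] f bnd by (intro integral_mono) auto
    finally show "\<bar>\<Delta> f\<bar> \<le> (C + \<bar>C\<bar>) * (\<integral>\<omega>. norm (f \<omega>) \<partial>M)"
      using L1_functional_bound[OF \<Phi> f] unfolding \<Delta>_def by (simp add: distrib_right)
    assume g: "integrable M g"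
    show "\<Delta> (\<lambda>\<omega>. f \<omega> + g \<omega>) = \<Delta> f + \<Delta> g"
      using L1_functional_add[OF \<Phi> f g] \<Psi>_int[OF f] \<Psi>_int[OF g]
      by (simp add: \<Delta>_def linear_add[OF bounded_linear.linear[OF lin]])
  qed
  have "\<Delta> f = 0" if f: "integrable M f" for f
  proof (rule L1_functional_eq_0[OF \<Delta> e _ f])
    fix A i assume A: "A \<in> sets M"
    have "(\<integral>\<omega>. \<Psi> \<omega> (indicator A \<omega> *\<^sub>R e i) \<partial>M) = (\<integral>\<omega>. indicator A \<omega> * \<rho> i \<omega> \<partial>M)"
    proof (rule integral_cong_AE)
      show "AE \<omega> in M. \<Psi> \<omega> (indicator A \<omega> *\<^sub>R e i) = indicator A \<omega> * \<rho> i \<omega>"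
        using AE_not_in[OF N(2)] AE_space
        by eventually_elim (simp add: linear_scale[OF bounded_linear.linear[OF lin]] good(4) bad_def)
    qed (use A \<rho>(1) in \<open>auto intro!: meas\<close>)
    then show "\<Delta> (\<lambda>\<omega>. indicator A \<omega> *\<^sub>R e i) = 0"
      using \<rho>(2)[OF A] by (simp add: \<Delta>_def)
  qed
  then have rep: "\<Phi> f = (\<integral>\<omega>. \<Psi> \<omega> (f \<omega>) \<partial>M)" if "integrable M f" for f
    using that by (simp add: \<Delta>_def)
  show thesis by (rule that[OF lin bnd \<Psi>_int rep])
qed

text \<open>At each point the representation applies a single bounded linear functional to the
  values, so weak convergence there is enough for scalar dominated convergence.\<close>

lemma (in finite_measure) L1_functional_weak_dominated_convergence:
  fixes F :: "nat \<Rightarrow> 'a \<Rightarrow> 'b::{banach, second_countable_topology}"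
  assumes \<Phi>: "L1_functional M C \<Phi>" and F: "\<And>n. integrable M (F n)" and g: "integrable M g"
    and H: "integrable M H" "\<And>n. AE \<omega> in M. norm (F n \<omega>) \<le> H \<omega>"
    and lim: "AE \<omega> in M. weak_limit (\<lambda>n. F n \<omega>) (g \<omega>)"
  shows "(\<lambda>n. \<Phi> (F n)) \<longlonglongrightarrow> \<Phi> g"
proof -
  obtain \<Psi> where \<Psi>: "\<And>\<omega>. bounded_linear (\<Psi> \<omega>)" "\<And>\<omega> y. \<bar>\<Psi> \<omega> y\<bar> \<le> \<bar>C\<bar> * norm y"
    "\<And>f. integrable M f \<Longrightarrow> integrable M (\<lambda>\<omega>. \<Psi> \<omega> (f \<omega>))"
    "\<And>f. integrable M f \<Longrightarrow> \<Phi> f = (\<integral>\<omega>. \<Psi> \<omega> (f \<omega>) \<partial>M)"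
    using L1_functional_representation[OF \<Phi>] by blast
  have "(\<lambda>n. \<integral>\<omega>. \<Psi> \<omega> (F n \<omega>) \<partial>M) \<longlonglongrightarrow> (\<integral>\<omega>. \<Psi> \<omega> (g \<omega>) \<partial>M)"
  proof (rule integral_dominated_convergence[where w="\<lambda>\<omega>. \<bar>C\<bar> * H \<omega>"])
    show "AE \<omega> in M. (\<lambda>n. \<Psi> \<omega> (F n \<omega>)) \<longlonglongrightarrow> \<Psi> \<omega> (g \<omega>)"
      using lim by eventually_elim (rule weak_limitD[OF _ \<Psi>(1)])
    show "AE \<omega> in M. norm (\<Psi> \<omega> (F n \<omega>)) \<le> \<bar>C\<bar> * H \<omega>" for n
      using H(2)[of n]
    proof eventually_elim
      case (elim \<omega>)
      have "\<bar>\<Psi> \<omega> (F n \<omega>)\<bar> \<le> \<bar>C\<bar> * norm (F n \<omega>)" by (rule \<Psi>(2))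
      also have "\<dots> \<le> \<bar>C\<bar> * H \<omega>" using elim by (intro mult_left_mono) auto
      finally show ?case by simp
    qed
  qed (use H(1) \<Psi>(3)[OF F] \<Psi>(3)[OF g] in auto)
  then show ?thesis by (simp add: \<Psi>(4) F g)
qed

subsection \<open>Approximate fixed points on a simplex\<close>

text \<open>Tychonoff for sequences of intervals. It serves both the finite cube, whose sides beyond
  m collapse to {0}, and the range of the coordinates of selections.\<close>

lemma compact_box_fun: "compact {t. \<forall>i. (t::nat \<Rightarrow> real) i \<in> {a i..b i}}"
proof -
  have "compactin (product_topology (\<lambda>i. euclidean) UNIV) (PiE UNIV (\<lambda>i. {a i..b i}))"
    by (simp add: compactin_PiE)
  moreover have "PiE UNIV (\<lambda>i. {a i..b i}) = {t. \<forall>i. (t::nat \<Rightarrow> real) i \<in> {a i..b i}}"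
    by (auto simp: PiE_UNIV_domain)
  ultimately show ?thesis
    by (simp add: euclidean_product_topology)
qed

lemma tendsto_fun_iff:
  fixes f :: "'b \<Rightarrow> 'i \<Rightarrow> 'a::topological_space"
  shows "(f \<longlongrightarrow> l) F \<longleftrightarrow> (\<forall>i. ((\<lambda>x. f x i) \<longlongrightarrow> l i) F)"
  using limitin_componentwise[of "\<lambda>_. euclidean" UNIV f l F]
  by (simp add: euclidean_product_topology)

text \<open>The dimension m is the size of a finite net found inside a later proof, so the cube is
  encoded by functions vanishing from m on instead of by a type. The proof takes the limit of grids
  with Kuhn's combinatorial lemma.\<close>

lemma brouwer_cube_fun:
  fixes f :: "(nat \<Rightarrow> real) \<Rightarrow> nat \<Rightarrow> real" and m :: nat
  defines "C \<equiv> {t. \<forall>i. t i \<in> {0..if i < m then 1 else 0}}"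
  assumes cont: "continuous_on C f" and f: "f \<in> C \<rightarrow> C"
  obtains t where "t \<in> C" "f t = t"
proof -
  have C: "compact C" unfolding C_def by (rule compact_box_fun)
  define pt where "pt p x = (\<lambda>i. if i < m then real (x i) / real p else 0)" for p :: nat and x :: "nat \<Rightarrow> nat"
  \<comment> \<open>Label 0 marks coordinates that \<open>f\<close> does not decrease. The upper
    face is labelled 1 regardless of \<open>f\<close>, as Kuhn's lemma demands.\<close>
  define label where "label p x i = (if x i < p \<and> f (pt p x) i \<ge> pt p x i then 0 else 1 :: nat)" for p x i
  define good where "good p q r s \<longleftrightarrow> (\<forall>i<m. q i < Suc p) \<and> (\<forall>i<m. (\<forall>j<m. q j \<le> r i j \<and> r i j \<le> q j + 1) \<and>
      (\<forall>j<m. q j \<le> s i j \<and> s i j \<le> q j + 1) \<and> label (Suc p) (r i) i = 0 \<and> label (Suc p) (s i) i = 1)"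
    for p q and r s :: "nat \<Rightarrow> nat \<Rightarrow> nat"
  have "\<exists>q r s. good p q r s" for p
  proof -
    obtain q where q: "\<forall>i<m. q i < Suc p"
      "\<forall>i<m. \<exists>r s. (\<forall>j<m. q j \<le> r j \<and> r j \<le> q j + 1) \<and> (\<forall>j<m. q j \<le> s j \<and> s j \<le> q j + 1)
        \<and> label (Suc p) r i \<noteq> label (Suc p) s i"
    proof (rule kuhn_lemma[of "Suc p" m "label (Suc p)"])
      show "\<forall>x. (\<forall>i<m. x i \<le> Suc p) \<longrightarrow> (\<forall>i<m. x i = 0 \<longrightarrow> label (Suc p) x i = 0)"
      proof (intro allI impI)
        fix x i assume x: "\<forall>i<m. x i \<le> Suc p" and i: "i < m" "x i = 0"
        have "pt (Suc p) x \<in> C"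
          using x by (auto simp: C_def pt_def divide_le_eq)
        then have "f (pt (Suc p) x) \<in> C" using f by blast
        then show "label (Suc p) x i = 0"
          using i by (auto simp: C_def label_def pt_def)
      qed
    qed (auto simp: label_def)
    \<comment> \<open>Kuhn's lemma only says that the two labels differ; the points are ordered so
      that r carries 0 and s carries 1.\<close>
    define P where "P i r s \<longleftrightarrow> (\<forall>j<m. q j \<le> r j \<and> r j \<le> q j + 1) \<and> (\<forall>j<m. q j \<le> s j \<and> s j \<le> q j + 1)
        \<and> label (Suc p) r i = 0 \<and> label (Suc p) s i = 1" for i r s
    have "\<exists>r s. i < m \<longrightarrow> P i r s" for i
    proof (cases "i < m")
      case i: True
      obtain r s where rs: "\<forall>j<m. q j \<le> r j \<and> r j \<le> q j + 1" "\<forall>j<m. q j \<le> s j \<and> s j \<le> q j + 1"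
          "label (Suc p) r i \<noteq> label (Suc p) s i"
        using q(2) i by blast
      have "label (Suc p) r i = 0 \<and> label (Suc p) s i = 1 \<or> label (Suc p) r i = 1 \<and> label (Suc p) s i = 0"
        using rs(3) by (auto simp: label_def split: if_splits)
      then show ?thesis using rs(1,2) unfolding P_def by blast
    qed simp
    then obtain r s where "\<And>i. i < m \<Longrightarrow> P i (r i) (s i)" by metis
    then show ?thesis using q(1) unfolding P_def good_def by blast
  qed
  then obtain q r s where qrs: "\<And>p. good p (q p) (r p) (s p)" by metis
  then have q: "\<And>p i. i < m \<Longrightarrow> q p i < Suc p"
    and r: "\<And>p i j. i < m \<Longrightarrow> j < m \<Longrightarrow> q p j \<le> r p i j \<and> r p i j \<le> q p j + 1"
    and s: "\<And>p i j. i < m \<Longrightarrow> j < m \<Longrightarrow> q p j \<le> s p i j \<and> s p i j \<le> q p j + 1"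
    and lr: "\<And>p i. i < m \<Longrightarrow> label (Suc p) (r p i) i = 0"
    and ls: "\<And>p i. i < m \<Longrightarrow> label (Suc p) (s p i) i = 1"
    unfolding good_def by blast+
  have inC: "pt (Suc p) x \<in> C" if "\<And>j. j < m \<Longrightarrow> x j \<le> q p j + 1" for p x
  proof -
    have "x j \<le> Suc p" if "j < m" for j
      using \<open>\<And>j. j < m \<Longrightarrow> x j \<le> q p j + 1\<close>[OF that] q[OF that, of p] by simp
    then have "real (x j) \<le> 1 + real p" if "j < m" for j
      using that by (metis of_nat_Suc of_nat_le_iff)
    then show ?thesis by (auto simp: C_def pt_def divide_le_eq)
  qed
  have "\<forall>p. pt (Suc p) (q p) \<in> C" by (simp add: inC)
  then obtain t \<rho> where t: "t \<in> C" "strict_mono \<rho>" "((\<lambda>p. pt (Suc p) (q p)) \<circ> \<rho>) \<longlonglongrightarrow> t"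
    using C unfolding compact_def by metis
  \<comment> \<open>All grid points within one step above \<open>q\<close> share its limit, the mesh
    being 1/(p+1).\<close>
  have lim: "(\<lambda>n. pt (Suc (\<rho> n)) (x n)) \<longlonglongrightarrow> t"
    if x: "\<And>n j. j < m \<Longrightarrow> q (\<rho> n) j \<le> x n j \<and> x n j \<le> q (\<rho> n) j + 1" for x
    unfolding tendsto_fun_iff
  proof
    fix j
    have t': "(\<lambda>n. pt (Suc (\<rho> n)) (q (\<rho> n)) j) \<longlonglongrightarrow> t j"
      using t(3) by (simp add: tendsto_fun_iff o_def)
    have u: "(\<lambda>n. pt (Suc (\<rho> n)) (q (\<rho> n)) j + 1 / real (Suc (\<rho> n))) \<longlonglongrightarrow> t j + 0"
      by (intro tendsto_add t' LIMSEQ_subseq_LIMSEQ[OF LIMSEQ_inverse_real_of_nat t(2), unfolded o_def inverse_eq_divide])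
    show "(\<lambda>n. pt (Suc (\<rho> n)) (x n) j) \<longlonglongrightarrow> t j"
    proof (cases "j < m")
      case True
      have "pt (Suc (\<rho> n)) (q (\<rho> n)) j \<le> pt (Suc (\<rho> n)) (x n) j" for n
        using x[OF True, of n] True by (simp add: pt_def divide_right_mono)
      moreover have "pt (Suc (\<rho> n)) (x n) j \<le> pt (Suc (\<rho> n)) (q (\<rho> n)) j + 1 / real (Suc (\<rho> n))" for n
        using x[OF True, of n] True
        by (simp add: pt_def divide_right_mono flip: add_divide_distrib)
      ultimately show ?thesis
        by (intro tendsto_sandwich[OF _ _ t' u[simplified]]) auto
    next
      case False
      then show ?thesis using t' by (simp add: pt_def)
    qed
  qed
  have flim: "(\<lambda>n. f (pt (Suc (\<rho> n)) (x n)) j) \<longlonglongrightarrow> f t j"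
    if x: "\<And>n j. j < m \<Longrightarrow> q (\<rho> n) j \<le> x n j \<and> x n j \<le> q (\<rho> n) j + 1" for x j
  proof -
    have "(\<lambda>n. f (pt (Suc (\<rho> n)) (x n))) \<longlonglongrightarrow> f t"
      by (rule continuous_on_tendsto_compose[OF cont lim t(1)]) (use x in \<open>auto intro!: always_eventually inC\<close>)
    then show ?thesis by (simp add: tendsto_fun_iff)
  qed
  have "f t i = t i" for i
  proof (cases "i < m")
    case i: True
    let ?R = "\<lambda>n. pt (Suc (\<rho> n)) (r (\<rho> n) i)" and ?S = "\<lambda>n. pt (Suc (\<rho> n)) (s (\<rho> n) i)"
    have R: "(\<lambda>n. ?R n i) \<longlonglongrightarrow> t i" "(\<lambda>n. f (?R n) i) \<longlonglongrightarrow> f t i"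
      using lim[of "\<lambda>n. r (\<rho> n) i"] flim[of "\<lambda>n. r (\<rho> n) i" i] r[OF i] by (auto simp: tendsto_fun_iff)
    have S: "(\<lambda>n. ?S n i) \<longlonglongrightarrow> t i" "(\<lambda>n. f (?S n) i) \<longlonglongrightarrow> f t i"
      using lim[of "\<lambda>n. s (\<rho> n) i"] flim[of "\<lambda>n. s (\<rho> n) i" i] s[OF i] by (auto simp: tendsto_fun_iff)
    have "?R n i \<le> f (?R n) i" for n
      using lr[OF i, of "\<rho> n"] by (auto simp: label_def split: if_splits)
    then have "t i \<le> f t i" by (intro LIMSEQ_le[OF R]) auto
    \<comment> \<open>Label 1 yields this inequality only below the upper face; on the face the
      coordinate is 1, and \<open>f\<close> cannot exceed it.\<close>
    have "f (?S n) i \<le> ?S n i" for n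
    proof (cases "s (\<rho> n) i i < Suc (\<rho> n)")
      case True
      then show ?thesis using ls[OF i, of "\<rho> n"] by (auto simp: label_def split: if_splits)
    next
      case False
      then have "1 \<le> ?S n i" using i by (simp add: pt_def le_divide_eq)
      moreover have "?S n \<in> C" using s[OF i] by (intro inC) blast
      then have "f (?S n) \<in> C" using f by blast
      then have "f (?S n) i \<le> 1" using i by (auto simp: C_def dest: spec[of _ i])
      ultimately show ?thesis by simp
    qed
    then have "f t i \<le> t i" by (intro LIMSEQ_le[OF S(2,1)]) auto
    with \<open>t i \<le> f t i\<close> show ?thesis by simp
  next
    case False
    have "f t \<in> C" using f t(1) by blast
    then have "f t i \<in> {0..if i < m then 1 else 0}" "t i \<in> {0..if i < m then 1 else 0}"
      using t(1) unfolding C_def by blast+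
    then show ?thesis using False by simp
  qed
  then show thesis using that t(1) by blast
qed

text \<open>The weights max 0 (\<epsilon> - d i t), normalized, define a self-map of the simplex,
  the cover making their sum positive. At a fixed point a positive coordinate is a positive weight,
  so its index is \<epsilon>-close.\<close>

lemma simplex_approximate_fixed_point:
  fixes d :: "nat \<Rightarrow> (nat \<Rightarrow> real) \<Rightarrow> real" and m :: nat
  defines "\<Delta> \<equiv> {t. (\<forall>i. 0 \<le> t i) \<and> (\<forall>i\<ge>m. t i = 0) \<and> (\<Sum>i<m. t i) = 1}"
  assumes m: "m > 0" and cont: "\<And>i. i < m \<Longrightarrow> continuous_on \<Delta> (d i)"
    and cover: "\<And>t. t \<in> \<Delta> \<Longrightarrow> \<exists>i<m. d i t < \<epsilon>"
  obtains t where "t \<in> \<Delta>" "\<And>i. i < m \<Longrightarrow> t i > 0 \<Longrightarrow> d i t < \<epsilon>"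
proof -
  define C where "C = {t. \<forall>i. (t :: nat \<Rightarrow> real) i \<in> {0..if i < m then 1 else 0}}"
  define \<sigma> where "\<sigma> t = (\<Sum>i<m. t i)" for t :: "nat \<Rightarrow> real"
  \<comment> \<open>a retraction of the cube onto the simplex\<close>
  define r where "r t = (\<lambda>i. if i < m then (t i + max 0 (1 - \<sigma> t) / m) / max 1 (\<sigma> t) else 0)" for t
  define w where "w t i = max 0 (\<epsilon> - d i t)" for t i
  define p where "p t = (\<lambda>i. if i < m then w t i / (\<Sum>j<m. w t j) else 0)" for t
  have r: "r t \<in> \<Delta>" if "t \<in> C" for t
  proof -
    have t: "t i \<ge> 0" for i using that by (auto simp: C_def)
    have "(\<Sum>i<m. r t i) = (\<sigma> t + max 0 (1 - \<sigma> t)) / max 1 (\<sigma> t)"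
      using m by (simp add: r_def sum.distrib \<sigma>_def flip: sum_divide_distrib)
    also have "\<dots> = 1" by (simp add: max_def)
    finally show ?thesis using t by (auto simp: \<Delta>_def r_def)
  qed
  have r_id: "r t = t" if "t \<in> \<Delta>" for t
    using that by (auto simp: \<Delta>_def r_def \<sigma>_def)
  have w_pos: "(\<Sum>j<m. w t j) > 0" if t: "t \<in> \<Delta>" for t
  proof -
    obtain i where "i < m" "d i t < \<epsilon>" using cover[OF t] by blast
    then show ?thesis by (intro sum_pos2[of _ i]) (auto simp: w_def)
  qed
  have p: "p t \<in> \<Delta>" if t: "t \<in> \<Delta>" for t
    using w_pos[OF t]
    by (auto simp: \<Delta>_def p_def w_def simp flip: sum_divide_distrib intro!: divide_nonneg_nonneg sum_nonneg)
  have \<Delta>C: "\<Delta> \<subseteq> C"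
  proof
    fix t assume t: "t \<in> \<Delta>"
    have "t i \<le> 1" if "i < m" for i
      using member_le_sum[of i "{..<m}" t] t that by (auto simp: \<Delta>_def)
    then show "t \<in> C" using t by (auto simp: \<Delta>_def C_def)
  qed
  have cont_coord: "continuous_on S (\<lambda>t::nat \<Rightarrow> real. t i)" for S i
    by (rule continuous_on_product_then_coordinatewise) (rule continuous_on_id)
  have cont_r: "continuous_on C r"
  proof (rule continuous_on_coordinatewise_then_product)
    show "continuous_on C (\<lambda>t. r t i)" for i
      unfolding r_def \<sigma>_def
      by (cases "i < m") (auto intro!: continuous_intros cont_coord)
  qed
  have cont_p: "continuous_on \<Delta> p"
  proof (rule continuous_on_coordinatewise_then_product)
    show "continuous_on \<Delta> (\<lambda>t. p t i)" for i
    proof (cases "i < m")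
      case True
      have "(\<Sum>j<m. w t j) \<noteq> 0" if "t \<in> \<Delta>" for t
        using w_pos[OF that] by simp
      then show ?thesis
        using True unfolding p_def w_def
        by (auto intro!: continuous_intros cont)
    qed (simp add: p_def)
  qed
  obtain t where t: "t \<in> C" "(p \<circ> r) t = t"
  proof (rule brouwer_cube_fun[of m "p \<circ> r"])
    show "continuous_on {t. \<forall>i. t i \<in> {0..if i < m then 1 else 0}} (p \<circ> r)"
      unfolding C_def[symmetric]
      by (rule continuous_on_compose[OF cont_r continuous_on_subset[OF cont_p]]) (use r in auto)
    show "p \<circ> r \<in> {t. \<forall>i. t i \<in> {0..if i < m then 1 else 0}} \<rightarrow> {t. \<forall>i. t i \<in> {0..if i < m then 1 else 0}}"
      unfolding C_def[symmetric] using p r \<Delta>C by auto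
  qed (use that C_def in auto)
  \<comment> \<open>A fixed point of \<open>p \<circ> r\<close> lies in the image of
    \<open>p\<close>, hence in the simplex, where \<open>r\<close> is the identity; so
    \<open>p\<close> itself fixes it.\<close>
  have t\<Delta>: "t \<in> \<Delta>" using t p r by (metis comp_apply)
  then have pt: "p t = t" using t r_id by simp
  show thesis
  proof (rule that[OF t\<Delta>])
    fix i assume "i < m" "t i > 0"
    then have "w t i / (\<Sum>j<m. w t j) > 0" using fun_cong[OF pt, of i] by (simp add: p_def)
    then have "w t i > 0" using w_pos[OF t\<Delta>] by (simp add: zero_less_divide_iff)
    then show "d i t < \<epsilon>" by (simp add: w_def)
  qed
qed

subsection \<open>Fixed points of correspondences on selections\<close>

text \<open>Norm compactness enters here: nearby points of C have a norm convergent subsequence, and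
  its limit agrees with \<open>g\<close> under every \<open>\<nu> k\<close>.\<close>

lemma weak_limit_compact:
  fixes C :: "'a::{real_normed_vector, second_countable_topology} set"
  assumes u: "weak_limit u g" and C: "compact C"
    and close: "\<And>\<delta>. \<delta> > 0 \<Longrightarrow> \<forall>\<^sub>F n in sequentially. \<exists>c\<in>C. dist (u n) c < \<delta>"
  shows "g \<in> C"
proof -
  obtain \<nu> :: "nat \<Rightarrow> 'a \<Rightarrow> real" where \<nu>: "norming_sequence \<nu>"
    using norming_sequence_exists by blast
  have "\<exists>n c. n \<ge> k \<and> c \<in> C \<and> dist (u n) c < inverse (real (Suc k))" for k
  proof -
    obtain N where "\<And>n. n \<ge> N \<Longrightarrow> \<exists>c\<in>C. dist (u n) c < inverse (real (Suc k))"
      using close[of "inverse (real (Suc k))"] by (auto simp: eventually_sequentially)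
    from this[of "max N k"] show ?thesis by (intro exI[of _ "max N k"]) auto
  qed
  then obtain n c where nc: "\<And>k. n k \<ge> k" "\<And>k. c k \<in> C" "\<And>k. dist (u (n k)) (c k) < inverse (real (Suc k))"
    by metis
  obtain l r where l: "l \<in> C" "strict_mono r" "(c \<circ> r) \<longlonglongrightarrow> l"
    using C nc(2) unfolding compact_def by metis
  have "\<nu> k l = \<nu> k g" for k
  proof -
    have bl: "bounded_linear (\<nu> k)" using \<nu> by (simp add: norming_sequence_def)
    have "(\<lambda>i. \<nu> k (c (r i))) \<longlonglongrightarrow> \<nu> k l"
      using bounded_linear.tendsto[OF bl l(3)] by (simp add: o_def)
    moreover have "(\<lambda>i. \<nu> k (u (n (r i)))) \<longlonglongrightarrow> \<nu> k g"
    proof (rule filterlim_compose[OF weak_limitD[OF u bl]])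
      show "filterlim (\<lambda>i. n (r i)) sequentially sequentially"
        by (rule filterlim_at_top_mono[OF filterlim_ident])
          (use order_trans[OF seq_suble[OF l(2)] nc(1)] in simp)
    qed
    ultimately have "(\<lambda>i. \<nu> k (u (n (r i))) - \<nu> k (c (r i))) \<longlonglongrightarrow> \<nu> k g - \<nu> k l"
      by (intro tendsto_diff)
    moreover have "(\<lambda>i. \<nu> k (u (n (r i))) - \<nu> k (c (r i))) \<longlonglongrightarrow> 0"
    proof (rule Lim_null_comparison)
      have "(\<lambda>i. inverse (real (Suc (r i)))) \<longlonglongrightarrow> 0"
        using LIMSEQ_subseq_LIMSEQ[OF LIMSEQ_inverse_real_of_nat l(2)] by (simp add: o_def)
      then show "(\<lambda>i. inverse (real (Suc (r i)))) \<longlonglongrightarrow> 0" .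
      have "\<bar>\<nu> k (u (n (r i))) - \<nu> k (c (r i))\<bar> \<le> inverse (real (Suc (r i)))" for i
        using norming_sequence_le[OF \<nu>, of k "u (n (r i)) - c (r i)"] nc(3)[of "r i"]
        unfolding linear_diff[OF norming_sequence_linear[OF \<nu>]] dist_norm by linarith
      then show "\<forall>\<^sub>F i in sequentially. norm (\<nu> k (u (n (r i))) - \<nu> k (c (r i))) \<le> inverse (real (Suc (r i)))"
        by simp
    qed
    ultimately have "\<nu> k g - \<nu> k l = 0" using LIMSEQ_unique by blast
    then show ?thesis by simp
  qed
  then show ?thesis using norming_sequence_eqI[OF \<nu>] l(1) by metis
qed

section \<open>Coordinates on the set of selections\<close>

locale coordinatized_selections = selections M K H \<nu>
  for M :: "'w measure"
    and K :: "'w \<Rightarrow> 'y::{banach, second_countable_topology} set"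
    and H :: "'w \<Rightarrow> real"
    and \<nu> :: "nat \<Rightarrow> 'y \<Rightarrow> real" +
  fixes B :: "nat \<Rightarrow> 'w set"
  assumes B_sets [measurable]: "B j \<in> sets M"
    and B_dense: "A \<in> sets M \<Longrightarrow> \<epsilon> > 0 \<Longrightarrow> \<exists>j. measure M ((A - B j) \<union> (B j - A)) < \<epsilon>"
begin

text \<open>Dividing by \<open>1 + H\<close> bounds the integrand by 1, so that no uniform integrability is needed. On
  selections, the coordinates already induce the weak topology (see \<open>functional_tendsto\<close>).\<close>

definition wcoord :: "nat \<Rightarrow> ('w \<Rightarrow> 'y) \<Rightarrow> 'w \<Rightarrow> real" where
  "wcoord k f \<omega> = \<nu> k (f \<omega>) / (1 + H \<omega>)"

text \<open>Decoding runs through all pairs of a set and a functional, so a selection becomes a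
  point of the metrizable space of real sequences with the product topology.\<close>

definition coords :: "('w \<Rightarrow> 'y) \<Rightarrow> nat \<Rightarrow> real" where
  "coords f i = (\<integral>\<omega>. indicator (B (fst (prod_decode i))) \<omega> * wcoord (snd (prod_decode i)) f \<omega> \<partial>M)"

lemma wcoord_bounded: "f \<in> Sel \<Longrightarrow> AE \<omega> in M. \<bar>wcoord k f \<omega>\<bar> \<le> 1"
proof -
  assume f: "f \<in> Sel"
  show ?thesis
    using Sel_bounded[OF f]
  proof eventually_elim
    case (elim \<omega>)
    then have "\<bar>\<nu> k (f \<omega>)\<bar> \<le> 1 + H \<omega>"
      using norming_sequence_le[OF norming, of k "f \<omega>"] by linarith
    then show ?case using H_nonneg[of \<omega>] by (simp add: wcoord_def divide_le_eq)
  qed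
qed

lemma wcoord_measurable: "f \<in> Sel \<Longrightarrow> wcoord k f \<in> borel_measurable M"
proof -
  assume "f \<in> Sel"
  note [measurable] = Sel_measurable[OF this] borel_measurable_norming_sequence_comp[OF norming]
    borel_measurable_integrable[OF integrable_H]
  show ?thesis unfolding wcoord_def by measurable
qed

lemma wcoord_integrable: "f \<in> Sel \<Longrightarrow> A \<in> sets M \<Longrightarrow> integrable M (\<lambda>\<omega>. indicator A \<omega> * wcoord k f \<omega>)"
proof -
  assume f: "f \<in> Sel" and A: "A \<in> sets M"
  have "integrable M (wcoord k f)"
    by (rule integrable_const_bound[of _ 1]) (use wcoord_bounded[OF f] wcoord_measurable[OF f] in auto)
  from integrable_mult_indicator[OF A this] show ?thesis by simp
qed

lemma coords_bounded:
  assumes f: "f \<in> Sel"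
  shows "\<bar>coords f i\<bar> \<le> measure M (space M)"
proof -
  obtain j k where jk: "prod_decode i = (j, k)" by fastforce
  have "\<bar>coords f i\<bar> \<le> (\<integral>\<omega>. \<bar>indicator (B j) \<omega> * wcoord k f \<omega>\<bar> \<partial>M)"
    unfolding coords_def jk by simp
  also have "\<dots> \<le> (\<integral>\<omega>. 1 \<partial>M)"
  proof (rule integral_mono_AE)
    show "AE \<omega> in M. \<bar>indicator (B j) \<omega> * wcoord k f \<omega>\<bar> \<le> 1"
      using wcoord_bounded[OF f, of k] by eventually_elim (auto split: split_indicator)
  qed (use wcoord_integrable[OF f B_sets] in auto)
  finally show ?thesis by simp
qed

text \<open>Equal coordinates mean equal integrals over the sets \<open>B j\<close>. Since weighted
  selections differ by at most 2, replacing an arbitrary A by \<open>B j\<close> costs at most twice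
  the measure of the symmetric difference.\<close>

lemma coords_injective:
  assumes f: "f \<in> Sel" and g: "g \<in> Sel" and eq: "coords f = coords g"
  shows "AE \<omega> in M. f \<omega> = g \<omega>"
proof -
  have "AE \<omega> in M. wcoord k f \<omega> - wcoord k g \<omega> = 0" for k
  proof (rule density_zero)
    have int: "integrable M (\<lambda>\<omega>. indicator A \<omega> * (wcoord k f \<omega> - wcoord k g \<omega>))" if "A \<in> sets M" for A
      using wcoord_integrable[OF f that] wcoord_integrable[OF g that] by (simp add: right_diff_distrib)
    show "integrable M (\<lambda>\<omega>. wcoord k f \<omega> - wcoord k g \<omega>)"
      using int[OF sets.top] by (rule Bochner_Integration.integrable_cong[THEN iffD1, rotated 2]) auto
    fix A assume A: "A \<in> sets M"
    have "\<bar>\<integral>\<omega>. indicator A \<omega> * (wcoord k f \<omega> - wcoord k g \<omega>) \<partial>M\<bar> \<le> 0"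
    proof (rule field_le_epsilon)
      fix \<epsilon> :: real assume \<epsilon>: "\<epsilon> > 0"
      then obtain j where j: "measure M ((A - B j) \<union> (B j - A)) < \<epsilon> / 2"
        using B_dense[OF A, of "\<epsilon> / 2"] by auto
      have E: "(A - B j) \<union> (B j - A) \<in> sets M" using A by simp
      have "(\<integral>\<omega>. indicator (B j) \<omega> * (wcoord k f \<omega> - wcoord k g \<omega>) \<partial>M) = coords f (prod_encode (j, k)) - coords g (prod_encode (j, k))"
        using wcoord_integrable[OF f B_sets] wcoord_integrable[OF g B_sets] by (simp add: coords_def right_diff_distrib)
      then have "\<bar>\<integral>\<omega>. indicator A \<omega> * (wcoord k f \<omega> - wcoord k g \<omega>) \<partial>M\<bar>
          = \<bar>\<integral>\<omega>. indicator A \<omega> * (wcoord k f \<omega> - wcoord k g \<omega>) - indicator (B j) \<omega> * (wcoord k f \<omega> - wcoord k g \<omega>) \<partial>M\<bar>"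
        using eq int[OF A] int[OF B_sets] by simp
      also have "\<dots> \<le> (\<integral>\<omega>. \<bar>indicator A \<omega> * (wcoord k f \<omega> - wcoord k g \<omega>) - indicator (B j) \<omega> * (wcoord k f \<omega> - wcoord k g \<omega>)\<bar> \<partial>M)"
        by (rule integral_abs_bound)
      also have "\<dots> \<le> (\<integral>\<omega>. 2 * indicator ((A - B j) \<union> (B j - A)) \<omega> \<partial>M)"
      proof (rule integral_mono_AE)
        show "integrable M (\<lambda>\<omega>. \<bar>indicator A \<omega> * (wcoord k f \<omega> - wcoord k g \<omega>) - indicator (B j) \<omega> * (wcoord k f \<omega> - wcoord k g \<omega>)\<bar>)"
          using int[OF A] int[OF B_sets] by (intro integrable_abs Bochner_Integration.integrable_diff)
        show "integrable M (\<lambda>\<omega>. 2 * indicator ((A - B j) \<union> (B j - A)) \<omega> :: real)"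
          by (intro integrable_mult_right integrable_real_indicator[OF E]) (simp add: less_top[symmetric])
        show "AE \<omega> in M. \<bar>indicator A \<omega> * (wcoord k f \<omega> - wcoord k g \<omega>) - indicator (B j) \<omega> * (wcoord k f \<omega> - wcoord k g \<omega>)\<bar>
            \<le> 2 * indicator ((A - B j) \<union> (B j - A)) \<omega>"
          using wcoord_bounded[OF f, of k] wcoord_bounded[OF g, of k]
        proof eventually_elim
          case (elim \<omega>)
          then have "\<bar>wcoord k f \<omega> - wcoord k g \<omega>\<bar> \<le> 2" by linarith
          then show ?case by (cases "\<omega> \<in> A"; cases "\<omega> \<in> B j") simp_all
        qed
      qed
      also have "\<dots> = 2 * measure M ((A - B j) \<union> (B j - A))" using E by simp
      also have "\<dots> \<le> 0 + \<epsilon>" using j by simp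
      finally show "\<bar>\<integral>\<omega>. indicator A \<omega> * (wcoord k f \<omega> - wcoord k g \<omega>) \<partial>M\<bar> \<le> 0 + \<epsilon>" .
    qed
    then show "set_lebesgue_integral M A (\<lambda>\<omega>. wcoord k f \<omega> - wcoord k g \<omega>) = 0"
      by (simp add: set_lebesgue_integral_def)
  qed
  then have "AE \<omega> in M. \<forall>k. wcoord k f \<omega> - wcoord k g \<omega> = 0" by (simp add: AE_all_countable)
  then show ?thesis
  proof eventually_elim
    case (elim \<omega>)
    have "1 + H \<omega> \<noteq> 0" using H_nonneg[of \<omega>] by simp
    moreover have "wcoord k f \<omega> = wcoord k g \<omega>" for k using elim by simp
    ultimately have "\<nu> k (f \<omega>) = \<nu> k (g \<omega>)" for k by (simp add: wcoord_def)
    then show ?case by (rule norming_sequence_eqI[OF norming])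
  qed
qed

lemma coords_sum:
  assumes "\<And>j. j < m \<Longrightarrow> s j \<in> Sel"
  shows "coords (\<lambda>\<omega>. \<Sum>j<m. t j *\<^sub>R s j \<omega>) i = (\<Sum>j<m. t j * coords (s j) i)"
proof -
  obtain b k where bk: "prod_decode i = (b, k)" by fastforce
  have "coords (\<lambda>\<omega>. \<Sum>j<m. t j *\<^sub>R s j \<omega>) i = (\<integral>\<omega>. (\<Sum>j<m. t j * (indicator (B b) \<omega> * wcoord k (s j) \<omega>)) \<partial>M)"
    unfolding coords_def bk wcoord_def
    by (intro Bochner_Integration.integral_cong refl)
      (simp add: linear_sum[OF norming_sequence_linear[OF norming]] linear_scale[OF norming_sequence_linear[OF norming]]
        sum_divide_distrib sum_distrib_left mult_ac)
  also have "\<dots> = (\<Sum>j<m. t j * coords (s j) i)"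
    using wcoord_integrable[OF assms B_sets] by (simp add: coords_def bk)
  finally show ?thesis .
qed

lemma coords_mid:
  assumes F: "F \<in> Sel" and G: "G \<in> Sel"
  shows "coords (\<lambda>\<omega>. (1/2) *\<^sub>R (F \<omega> + G \<omega>)) i = (1/2) * (coords F i + coords G i)"
proof -
  have "coords (\<lambda>\<omega>. \<Sum>j<2::nat. (1/2) *\<^sub>R (if j = 0 then F else G) \<omega>) i = (\<Sum>j<2::nat. (1/2) * coords (if j = 0 then F else G) i)"
    by (rule coords_sum) (use F G in auto)
  then show ?thesis by (simp add: numeral_2_eq_2 scaleR_add_right distrib_left)
qed

text \<open>Stated for any T that commutes with midpoints on \<open>Sel\<close>, because it is
  applied both to coordinates and to functionals on L1.\<close>

lemma mid_tail_affine:
  assumes T: "\<And>F G. F \<in> Sel \<Longrightarrow> G \<in> Sel \<Longrightarrow> T (\<lambda>\<omega>. (1/2) *\<^sub>R (F \<omega> + G \<omega>)) = (1/2) * (T F + T G)"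
    and f: "\<And>j. f j \<in> Sel" and V: "convex (V :: real set)" "\<And>j. n \<le> j \<Longrightarrow> T (f j) \<in> V"
    and F: "mid_tail f n F"
  shows "T F \<in> V"
  using F
proof (induction rule: mid_tail.induct)
  case (mid F G)
  then show ?case
    using T[OF mid_tail_Sel[OF mid.hyps(1) f] mid_tail_Sel[OF mid.hyps(2) f]]
      convexD[OF V(1), of "T F" "T G" "1/2" "1/2"] by (simp add: distrib_left)
qed (use V in blast)

lemma mid_tail_affine_tendsto:
  assumes T: "\<And>F G. F \<in> Sel \<Longrightarrow> G \<in> Sel \<Longrightarrow> T (\<lambda>\<omega>. (1/2) *\<^sub>R (F \<omega> + G \<omega>)) = (1/2) * (T F + T G)"
    and f: "\<And>j. f j \<in> Sel" and lim: "(\<lambda>j. T (f j)) \<longlonglongrightarrow> (l::real)"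
    and F: "\<And>n. mid_tail f n (F n)"
  shows "(\<lambda>n. T (F n)) \<longlonglongrightarrow> l"
proof (rule tendstoI)
  fix \<epsilon> :: real assume "\<epsilon> > 0"
  then obtain N where N: "\<And>j. j \<ge> N \<Longrightarrow> T (f j) \<in> ball l \<epsilon>"
    using lim by (force simp: tendsto_iff eventually_sequentially dist_commute)
  have "T (F n) \<in> ball l \<epsilon>" if "n \<ge> N" for n
    by (rule mid_tail_affine[OF T f convex_ball _ F]) (use N that in simp_all)
  then show "\<forall>\<^sub>F n in sequentially. dist (T (F n)) l < \<epsilon>"
    by (auto simp: eventually_sequentially dist_commute)
qed

lemma coords_mid_tail_tendsto:
  assumes f: "\<And>j. f j \<in> Sel" and lim: "(\<lambda>j. coords (f j) i) \<longlonglongrightarrow> l"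
    and F: "\<And>n. mid_tail f n (F n)"
  shows "(\<lambda>n. coords (F n) i) \<longlonglongrightarrow> l"
proof (rule mid_tail_affine_tendsto[where T="\<lambda>F. coords F i"])
  show "coords (\<lambda>\<omega>. (1/2) *\<^sub>R (F \<omega> + G \<omega>)) i = (1/2) * (coords F i + coords G i)" if "F \<in> Sel" "G \<in> Sel" for F G
    using that by (rule coords_mid)
qed (rule f lim F)+

lemma coords_weak_limit:
  assumes F: "\<And>n. F n \<in> Sel" and g: "g \<in> Sel" and lim: "AE \<omega> in M. weak_limit (\<lambda>n. F n \<omega>) (g \<omega>)"
  shows "(\<lambda>n. coords (F n) i) \<longlonglongrightarrow> coords g i"
proof -
  obtain b k where bk: "prod_decode i = (b, k)" by fastforce
  show ?thesis
    unfolding coords_def bk fst_conv snd_conv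
  proof (rule integral_dominated_convergence[where w="\<lambda>\<omega>. 1"])
    show "AE \<omega> in M. (\<lambda>n. indicator (B b) \<omega> * wcoord k (F n) \<omega>) \<longlonglongrightarrow> indicator (B b) \<omega> * wcoord k g \<omega>"
      using lim
    proof eventually_elim
      case (elim \<omega>)
      have "1 + H \<omega> \<noteq> 0" using H_nonneg[of \<omega>] by simp
      moreover have "bounded_linear (\<nu> k)" using norming by (simp add: norming_sequence_def)
      ultimately show ?case
        unfolding wcoord_def by (intro tendsto_intros weak_limitD[OF elim])
    qed
    show "AE \<omega> in M. norm (indicator (B b) \<omega> * wcoord k (F n) \<omega>) \<le> 1" for n
      using wcoord_bounded[OF F, of k n] by eventually_elim (auto split: split_indicator)
  qed (use wcoord_integrable[OF F B_sets] wcoord_integrable[OF g B_sets] in auto)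
qed

lemma functional_mid:
  assumes "L1_functional M C \<Phi>" "F \<in> Sel" "G \<in> Sel"
  shows "\<Phi> (\<lambda>\<omega>. (1/2) *\<^sub>R (F \<omega> + G \<omega>)) = (1/2) * (\<Phi> F + \<Phi> G)"
  using L1_functional_scale[OF assms(1), of "\<lambda>\<omega>. F \<omega> + G \<omega>" "1/2"]
    L1_functional_add[OF assms(1)] Sel_integrable assms(2,3) by simp

text \<open>One-sided on purpose: a violation
  \<open>\<Phi> y + \<epsilon> \<le> \<Phi> (x n)\<close> along a subsequence survives convex
  combinations, whereas mere distance from \<open>\<Phi> y\<close> would not. The combinations have
  a pointwise weak limit with the coordinates of \<open>y\<close>, which contradicts the
  violation.\<close>

lemma functional_eventually_less:
  assumes \<Phi>: "L1_functional M C \<Phi>" and x: "\<And>n. x n \<in> Sel" "y \<in> Sel"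
    and lim: "\<And>i. (\<lambda>n. coords (x n) i) \<longlonglongrightarrow> coords y i" and \<epsilon>: "\<epsilon> > 0"
  shows "\<forall>\<^sub>F n in sequentially. \<Phi> (x n) < \<Phi> y + \<epsilon>"
proof (rule ccontr)
  assume "\<not> ?thesis"
  then have "infinite {n. \<not> \<Phi> (x n) < \<Phi> y + \<epsilon>}"
    by (simp add: frequently_cofinite not_eventually flip: cofinite_eq_sequentially)
  then obtain r :: "nat \<Rightarrow> nat" where r: "strict_mono r" "\<And>n. \<not> \<Phi> (x (r n)) < \<Phi> y + \<epsilon>"
    using infinite_enumerate by blast
  define f where "f n = x (r n)" for n
  have f: "f n \<in> Sel" for n using x(1) by (simp add: f_def)
  obtain F g where F: "\<And>n. mid_tail f n (F n)" and g: "g \<in> Sel"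
    and wl: "AE \<omega> in M. weak_limit (\<lambda>n. F n \<omega>) (g \<omega>)"
    by (rule mid_tail_weak_limit[OF f]) (rule that)
  have F_Sel: "F n \<in> Sel" for n using mid_tail_Sel[OF F f] .
  have "coords g i = coords y i" for i
  proof -
    have "(\<lambda>n. coords (f n) i) \<longlonglongrightarrow> coords y i"
      using LIMSEQ_subseq_LIMSEQ[OF lim r(1)] by (simp add: o_def f_def)
    then have "(\<lambda>n. coords (F n) i) \<longlonglongrightarrow> coords y i"
      by (rule coords_mid_tail_tendsto[OF f _ F])
    then show ?thesis using coords_weak_limit[OF F_Sel g wl] LIMSEQ_unique by blast
  qed
  then have "AE \<omega> in M. g \<omega> = y \<omega>" by (intro coords_injective g x(2) ext)
  then have "\<Phi> g = \<Phi> y" by (intro L1_functional_cong[OF \<Phi>] Sel_integrable g x(2))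
  moreover have lim\<Phi>: "(\<lambda>n. \<Phi> (F n)) \<longlonglongrightarrow> \<Phi> g"
    by (rule L1_functional_weak_dominated_convergence[OF \<Phi> Sel_integrable[OF F_Sel] Sel_integrable[OF g] integrable_H Sel_bounded[OF F_Sel] wl])
  moreover have "\<Phi> (F n) \<in> {\<Phi> y + \<epsilon>..}" for n
    by (rule mid_tail_affine[OF functional_mid[OF \<Phi>] f convex_real_interval(1) _ F]) (use r(2) in \<open>auto simp: f_def not_less\<close>)
  then have "\<Phi> y + \<epsilon> \<le> \<Phi> g" by (intro LIMSEQ_le_const[OF lim\<Phi>]) simp
  ultimately show False using \<epsilon> by simp
qed

lemma functional_tendsto:
  assumes \<Phi>: "L1_functional M C \<Phi>" and x: "\<And>n. x n \<in> Sel" "y \<in> Sel"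
    and lim: "\<And>i. (\<lambda>n. coords (x n) i) \<longlonglongrightarrow> coords y i"
  shows "(\<lambda>n. \<Phi> (x n)) \<longlonglongrightarrow> \<Phi> y"
proof (rule order_tendstoI)
  fix a assume "\<Phi> y < a"
  then show "\<forall>\<^sub>F n in sequentially. \<Phi> (x n) < a"
    using functional_eventually_less[OF \<Phi> x lim, of "a - \<Phi> y"] by simp
next
  fix a assume a: "a < \<Phi> y"
  have "L1_functional M C (\<lambda>f. - \<Phi> f)"
    using \<Phi> by (auto simp: L1_functional_def)
  from functional_eventually_less[OF this x lim, of "\<Phi> y - a"] a
  show "\<forall>\<^sub>F n in sequentially. a < \<Phi> (x n)" by simp
qed

text \<open>The closure suffices for extracting subsequences and finite nets; in
  \<open>fixed_point\<close>, the limit is recognized as the coordinates of a selection by means of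
  \<open>mid_tail_weak_limit\<close>.\<close>

lemma compact_closure_coords: "compact (closure (coords ` Sel))"
proof -
  let ?B = "{t :: nat \<Rightarrow> real. \<forall>i. t i \<in> {- measure M (space M)..measure M (space M)}}"
  have B: "compact ?B" by (rule compact_box_fun)
  have "coords ` Sel \<subseteq> ?B"
    using coords_bounded by (force simp: abs_le_iff minus_le_iff)
  then have "closure (coords ` Sel) \<subseteq> ?B"
    by (rule closure_minimal) (rule compact_imp_closed[OF B])
  then have "closure (coords ` Sel) = ?B \<inter> closure (coords ` Sel)" by blast
  then show ?thesis using compact_Int_closed[OF B closed_closure, of "coords ` Sel"] by simp
qed

lemma sum_Sel:
  fixes m :: nat
  assumes s: "\<And>j. j < m \<Longrightarrow> s j \<in> Sel" and t: "\<And>j. j < m \<Longrightarrow> 0 \<le> t j" "(\<Sum>j<m. t j) = 1"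
  shows "(\<lambda>\<omega>. \<Sum>j<m. t j *\<^sub>R s j \<omega>) \<in> Sel"
  unfolding Sel_def
proof (intro CollectI conjI ballI)
  have [measurable]: "s j \<in> borel_measurable M" if "j < m" for j using Sel_measurable s that by blast
  show "(\<lambda>\<omega>. \<Sum>j<m. t j *\<^sub>R s j \<omega>) \<in> borel_measurable M"
    by (intro borel_measurable_sum borel_measurable_scaleR) simp_all
  show "(\<Sum>j<m. t j *\<^sub>R s j \<omega>) \<in> K \<omega>" if "\<omega> \<in> space M" for \<omega>
    by (rule convex_sum) (use convex_K[OF that] Sel_in[OF s that] t in auto)
qed

text \<open>\<open>s\<close> is arbitrary. Continuity comes from the weights instead: the
  coordinates of a convex combination are affine in t. The conclusion says that
  \<open>y \<omega>\<close> belongs to the convex hull of the values of \<open>s\<close> at nearby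
  points, with the same \<open>y\<close> for all \<omega>.\<close>

lemma approximate_fixed_point:
  assumes ne: "Sel \<noteq> {}" and s: "\<And>x. x \<in> Sel \<Longrightarrow> s x \<in> Sel" and \<epsilon>: "\<epsilon> > 0"
  shows "\<exists>y\<in>Sel. \<forall>\<omega> V. convex V \<longrightarrow> (\<forall>x\<in>Sel. dist (coords x) (coords y) < \<epsilon> \<longrightarrow> s x \<omega> \<in> V) \<longrightarrow> y \<omega> \<in> V"
proof -
  have "closure (coords ` Sel) \<subseteq> (\<Union>x\<in>Sel. ball (coords x) \<epsilon>)"
  proof
    fix p assume "p \<in> closure (coords ` Sel)"
    then have "\<exists>q\<in>coords ` Sel. dist q p < \<epsilon>" using \<epsilon> unfolding closure_approachable by blast
    then show "p \<in> (\<Union>x\<in>Sel. ball (coords x) \<epsilon>)" by (simp add: mem_ball)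
  qed
  then obtain X where X: "X \<subseteq> Sel" "finite X" "closure (coords ` Sel) \<subseteq> (\<Union>x\<in>X. ball (coords x) \<epsilon>)"
    by (rule compactE_image[OF compact_closure_coords open_ball])
  obtain m h where h: "h ` {i. i < (m::nat)} = X"
    using finite_imp_nat_seg_image_inj_on[OF X(2)] by metis
  have h_Sel: "h i \<in> Sel" if "i < m" for i using h X(1) that by blast
  have cover: "\<exists>i<m. dist (coords y) (coords (h i)) < \<epsilon>" if "y \<in> Sel" for y
  proof -
    have "coords y \<in> closure (coords ` Sel)" using that closure_subset[of "coords ` Sel"] by (rule subsetD[OF _ imageI, rotated])
    then have "coords y \<in> (\<Union>x\<in>X. ball (coords x) \<epsilon>)" by (rule subsetD[OF X(3)])
    then obtain x where x: "x \<in> X" "coords y \<in> ball (coords x) \<epsilon>" by (rule UN_E)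
    have "x \<in> h ` {i. i < m}" using x(1) unfolding h .
    then obtain i where i: "i < m" "x = h i" by (rule imageE) simp
    have "dist (coords y) (coords (h i)) < \<epsilon>" using x(2) unfolding i(2) mem_ball by (subst dist_commute)
    then show ?thesis using i(1) by blast
  qed
  obtain x0 where "x0 \<in> Sel" using ne by blast
  from cover[OF this] have m: "m > 0" by auto
  define y where "y t \<omega> = (\<Sum>j<m. t j *\<^sub>R s (h j) \<omega>)" for t :: "nat \<Rightarrow> real" and \<omega>
  have coords_y: "coords (y t) i = (\<Sum>j<m. t j * coords (s (h j)) i)" for t i
    unfolding y_def by (rule coords_sum) (rule s[OF h_Sel])
  have y_Sel: "y t \<in> Sel" if "\<And>i. 0 \<le> t i" "(\<Sum>i<m. t i) = 1" for t
    unfolding y_def by (rule sum_Sel[OF s[OF h_Sel] that])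
  let ?\<Delta> = "{t. (\<forall>i. 0 \<le> t i) \<and> (\<forall>i\<ge>m. t i = 0) \<and> (\<Sum>i<m. t i) = 1}"
  obtain t where t: "t \<in> ?\<Delta>" "\<And>i. i < m \<Longrightarrow> t i > 0 \<Longrightarrow> dist (coords (y t)) (coords (h i)) < \<epsilon>"
  proof (rule simplex_approximate_fixed_point[of m "\<lambda>i t. dist (coords (y t)) (coords (h i))" \<epsilon>])
    have "continuous_on ?\<Delta> (\<lambda>t. coords (y t))"
    proof (rule continuous_on_coordinatewise_then_product)
      show "continuous_on ?\<Delta> (\<lambda>t. coords (y t) i)" for i
        unfolding coords_y
        by (intro continuous_intros continuous_on_product_then_coordinatewise continuous_on_id)
    qed
    then show "continuous_on ?\<Delta> (\<lambda>t. dist (coords (y t)) (coords (h i)))" for i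
      by (intro continuous_on_dist continuous_on_const)
    show "\<exists>i<m. dist (coords (y t)) (coords (h i)) < \<epsilon>" if "t \<in> ?\<Delta>" for t
      using that by (intro cover y_Sel) auto
  qed (use m that in auto)
  show ?thesis
  proof (intro bexI[of _ "y t"] allI impI)
    show "y t \<in> Sel" using t(1) by (intro y_Sel) auto
    fix \<omega> V assume V: "convex V" "\<forall>x\<in>Sel. dist (coords x) (coords (y t)) < \<epsilon> \<longrightarrow> s x \<omega> \<in> V"
    \<comment> \<open>Indices of weight zero carry no information about the distance to
      \<open>h j\<close>, so they are removed before convexity of V is applied.\<close>
    let ?I = "{j. j < m \<and> t j > 0}"
    have I: "(\<Sum>j\<in>?I. t j) = 1"
      using t(1) by (subst sum.mono_neutral_left[of "{..<m}"]) (auto simp: le_less)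
    have "y t \<omega> = (\<Sum>j\<in>?I. t j *\<^sub>R s (h j) \<omega>)"
      unfolding y_def using t(1) by (intro sum.mono_neutral_right) (auto simp: le_less)
    also have "\<dots> \<in> V"
    proof (rule convex_sum)
      show "s (h j) \<omega> \<in> V" if "j \<in> ?I" for j
        using that h_Sel[of j] t(2)[of j] V(2) by (auto simp: dist_commute)
    qed (use V I in auto)
    finally show "y t \<omega> \<in> V" .
  qed
qed

text \<open>Upper semicontinuity is assumed in the sequential form that the weak topology on classes
  provides and that \<open>functional_tendsto\<close> reduces to coordinates. The limit is taken in
  two stages: a subsequence with convergent coordinates, then forward combinations with a pointwise
  weak limit \<open>g\<close>. Both have the same limit coordinates, so T is examined near
  \<open>g\<close>.\<close>

theorem fixed_point:
  fixes T :: "('w \<Rightarrow> 'y) \<Rightarrow> 'w \<Rightarrow> 'y set"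
  assumes ne: "Sel \<noteq> {}" and s: "\<And>x. x \<in> Sel \<Longrightarrow> s x \<in> Sel"
    and s_T: "\<And>x \<omega>. x \<in> Sel \<Longrightarrow> \<omega> \<in> space M \<Longrightarrow> s x \<omega> \<in> T x \<omega>"
    and T: "\<And>x \<omega>. x \<in> Sel \<Longrightarrow> \<omega> \<in> space M \<Longrightarrow> convex (T x \<omega>) \<and> compact (T x \<omega>)"
    and usc: "\<And>x y \<omega> V. \<lbrakk>\<And>n. x n \<in> Sel; y \<in> Sel; \<omega> \<in> space M; open V; T y \<omega> \<subseteq> V;
        \<And>C \<Phi>. L1_functional M C \<Phi> \<Longrightarrow> (\<lambda>n. \<Phi> (x n)) \<longlonglongrightarrow> \<Phi> y\<rbrakk>
      \<Longrightarrow> \<forall>\<^sub>F n in sequentially. T (x n) \<omega> \<subseteq> V"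
  obtains x where "x \<in> Sel" "AE \<omega> in M. x \<omega> \<in> T x \<omega>"
proof -
  define P where "P n y \<longleftrightarrow> y \<in> Sel \<and> (\<forall>\<omega> V. convex V \<longrightarrow>
      (\<forall>x\<in>Sel. dist (coords x) (coords y) < inverse (real (Suc n)) \<longrightarrow> s x \<omega> \<in> V) \<longrightarrow> y \<omega> \<in> V)" for n y
  have "\<exists>y. P n y" for n
  proof -
    have "inverse (real (Suc n)) > 0" by simp
    from approximate_fixed_point[where s=s, OF ne s this] show ?thesis unfolding P_def by blast
  qed
  then obtain y where "\<And>n. P n (y n)" by metis
  then have y: "\<And>n. y n \<in> Sel"
    "\<And>n \<omega> V. convex V \<Longrightarrow> (\<forall>x\<in>Sel. dist (coords x) (coords (y n)) < inverse (real (Suc n)) \<longrightarrow> s x \<omega> \<in> V) \<Longrightarrow> y n \<omega> \<in> V"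
    unfolding P_def by blast+
  have "\<forall>n. coords (y n) \<in> closure (coords ` Sel)" using y(1) closure_subset by blast
  then obtain l r where r: "strict_mono r" "((\<lambda>n. coords (y n)) \<circ> r) \<longlonglongrightarrow> l"
    using compact_closure_coords unfolding compact_def by metis
  define f where "f n = y (r n)" for n
  have f: "f n \<in> Sel" for n using y(1) by (simp add: f_def)
  have fl: "(\<lambda>n. coords (f n)) \<longlonglongrightarrow> l" using r(2) by (simp add: o_def f_def)
  obtain F g where F: "\<And>n. mid_tail f n (F n)" and g: "g \<in> Sel"
    and wl: "AE \<omega> in M. weak_limit (\<lambda>n. F n \<omega>) (g \<omega>)"
    by (rule mid_tail_weak_limit[OF f]) (rule that)
  have F_Sel: "F n \<in> Sel" for n using mid_tail_Sel[OF F f] .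
  have "coords g i = l i" for i
  proof -
    have "(\<lambda>n. coords (f n) i) \<longlonglongrightarrow> l i" using fl by (simp add: tendsto_fun_iff)
    then have "(\<lambda>n. coords (F n) i) \<longlonglongrightarrow> l i"
      by (rule coords_mid_tail_tendsto[OF f _ F])
    then show ?thesis using coords_weak_limit[OF F_Sel g wl] LIMSEQ_unique by blast
  qed
  then have "coords g = l" by (rule ext)
  then have fg: "(\<lambda>n. coords (f n)) \<longlonglongrightarrow> coords g" using fl by simp
  \<comment> \<open>Coordinates live in a metric space, so failure at all radii 1/(n+1) would give a
    sequence against the hypothesis on T. The radius may depend on \<omega>.\<close>
  have nbhd: "\<exists>\<eta>>0. \<forall>x\<in>Sel. dist (coords x) (coords g) < \<eta> \<longrightarrow> T x \<omega> \<subseteq> V"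
    if \<omega>: "\<omega> \<in> space M" and V: "open V" "T g \<omega> \<subseteq> V" for \<omega> V
  proof (rule ccontr)
    assume no: "\<not> ?thesis"
    have "\<exists>x\<in>Sel. dist (coords x) (coords g) < inverse (real (Suc n)) \<and> \<not> T x \<omega> \<subseteq> V" for n
    proof -
      have "inverse (real (Suc n)) > 0" by simp
      then show ?thesis using no by blast
    qed
    then obtain x where x: "\<And>n. x n \<in> Sel" "\<And>n. dist (coords (x n)) (coords g) < inverse (real (Suc n))"
      "\<And>n. \<not> T (x n) \<omega> \<subseteq> V" by metis
    have "(\<lambda>n. coords (x n)) \<longlonglongrightarrow> coords g"
      by (rule metric_tendsto_imp_tendsto[OF LIMSEQ_inverse_real_of_nat]) (use less_imp_le[OF x(2)] in simp)
    then have lim: "(\<lambda>n. coords (x n) i) \<longlonglongrightarrow> coords g i" for i by (simp add: tendsto_fun_iff)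
    have "\<forall>\<^sub>F n in sequentially. T (x n) \<omega> \<subseteq> V"
      by (rule usc[OF x(1) g \<omega> V]) (rule functional_tendsto[OF _ x(1) g lim])
    then show False using x(3) by simp
  qed
  have "AE \<omega> in M. g \<omega> \<in> T g \<omega>"
    using wl AE_space
  proof eventually_elim
    case (elim \<omega>)
    note C = T[OF g elim(2)]
    show ?case
    proof (rule weak_limit_compact[OF elim(1)])
      show "compact (T g \<omega>)" using C by blast
      fix \<delta> :: real assume \<delta>: "\<delta> > 0"
      \<comment> \<open>The \<delta>-neighbourhood is written as a sum of sets to obtain convexity
        and openness at once.\<close>
      define V where "V = (\<Union>c\<in>T g \<omega>. \<Union>b\<in>ball 0 \<delta>. {c + b})"
      have V_iff: "p \<in> V \<longleftrightarrow> (\<exists>c\<in>T g \<omega>. dist p c < \<delta>)" for p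
      proof
        assume "p \<in> V"
        then obtain c b where c: "c \<in> T g \<omega>" "b \<in> ball 0 \<delta>" "p = c + b" unfolding V_def by blast
        then have "dist p c < \<delta>" by (simp add: dist_norm)
        then show "\<exists>c\<in>T g \<omega>. dist p c < \<delta>" using c(1) by blast
      next
        assume "\<exists>c\<in>T g \<omega>. dist p c < \<delta>"
        then obtain c where "c \<in> T g \<omega>" "p - c \<in> ball 0 \<delta>" by (auto simp: dist_norm norm_minus_commute)
        then show "p \<in> V" unfolding V_def by (intro UN_I[of c] UN_I[of "p - c"]) auto
      qed
      have V: "convex V" "open V" "T g \<omega> \<subseteq> V"
      proof -
        show "convex V" unfolding V_def using C by (intro convex_sums) auto
        show "open V" unfolding V_def by (intro open_sums) auto
        show "T g \<omega> \<subseteq> V" using \<delta> V_iff by force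
      qed
      obtain \<eta> where \<eta>: "\<eta> > 0" "\<And>x. x \<in> Sel \<Longrightarrow> dist (coords x) (coords g) < \<eta> \<Longrightarrow> T x \<omega> \<subseteq> V"
        using nbhd[OF elim(2) V(2,3)] by blast
      \<comment> \<open>Half of \<eta> is for the distance from \<open>f n\<close> to
        \<open>g\<close>, half for the radius within which \<open>f n\<close> was averaged; that
        radius is at most 1/(n+1) because \<open>r n\<close> is at least n.\<close>
      have "\<forall>\<^sub>F n in sequentially. dist (coords (f n)) (coords g) < \<eta> / 2"
        using fg \<eta>(1) by (intro tendstoD) auto
      moreover have "\<forall>\<^sub>F n in sequentially. dist (inverse (real (Suc n))) 0 < \<eta> / 2"
        using LIMSEQ_inverse_real_of_nat \<eta>(1) by (intro tendstoD) auto
      ultimately have "\<forall>\<^sub>F n in sequentially. f n \<omega> \<in> V"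
      proof eventually_elim
        case (elim n)
        show ?case unfolding f_def
        proof (rule y(2)[OF V(1)], intro ballI impI)
          fix x assume x: "x \<in> Sel" "dist (coords x) (coords (y (r n))) < inverse (real (Suc (r n)))"
          have "inverse (real (Suc (r n))) \<le> inverse (real (Suc n))"
            using seq_suble[OF r(1), of n] by (intro le_imp_inverse_le) auto
          moreover have "inverse (real (Suc n)) < \<eta> / 2"
            using elim(2) by (simp add: dist_real_def)
          ultimately have "dist (coords x) (coords (y (r n))) < \<eta> / 2" using x(2) by linarith
          then have "dist (coords x) (coords g) < \<eta>"
            using dist_triangle_half_l[of "coords x" "coords (y (r n))" \<eta> "coords g"] elim(1) by (simp add: f_def dist_commute)
          then show "s x \<omega> \<in> V" using \<eta>(2)[OF x(1)] s_T[OF x(1) \<open>\<omega> \<in> space M\<close>] by blast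
        qed
      qed
      then obtain N where N: "\<And>n. n \<ge> N \<Longrightarrow> f n \<omega> \<in> V" by (auto simp: eventually_sequentially)
      have "F n \<omega> \<in> V" if "n \<ge> N" for n
        by (rule mid_tail_convex[OF F V(1)]) (use N that in simp)
      then show "\<forall>\<^sub>F n in sequentially. \<exists>c\<in>T g \<omega>. dist (F n \<omega>) c < \<delta>"
        unfolding eventually_sequentially V_iff by blast
    qed
  qed
  then show thesis using that g by blast
qed

end

section \<open>From selections to classes of integrable functions\<close>

lemma initial_topology_eventually:
  assumes U: "openin (initial_topology S \<Phi>) U" and y: "y \<in> U"
    and x: "\<And>n. x n \<in> S" and lim: "\<And>\<phi>. \<phi> \<in> \<Phi> \<Longrightarrow> (\<lambda>n. \<phi> (x n)) \<longlonglongrightarrow> \<phi> y"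
  shows "\<forall>\<^sub>F n in sequentially. x n \<in> U"
proof -
  have "generate_topology_on {{x \<in> S. \<phi> x \<in> U} |\<phi> U. \<phi> \<in> \<Phi> \<and> open U} U"
    using U unfolding initial_topology_def openin_topology_generated_by_iff .
  then show ?thesis
    using y
  \<comment> \<open>Only the basic sets use the convergence of functionals; finite intersections and
    unions preserve "eventually in U".\<close>
  proof (induction rule: generate_topology_on.induct)
    case (Int V W)
    then have "\<forall>\<^sub>F n in sequentially. x n \<in> V" "\<forall>\<^sub>F n in sequentially. x n \<in> W" by blast+
    then show ?case by eventually_elim simp
  next
    case (UN \<K>)
    then obtain V where V: "V \<in> \<K>" "y \<in> V" by blast
    then have "\<forall>\<^sub>F n in sequentially. x n \<in> V" using UN by blast
    then show ?case by eventually_elim (use V(1) in blast)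
  next
    case (Basis V)
    then obtain \<phi> W where \<phi>: "\<phi> \<in> \<Phi>" "open W" "V = {x \<in> S. \<phi> x \<in> W}" by blast
    then have "\<forall>\<^sub>F n in sequentially. \<phi> (x n) \<in> W"
      using Basis.prems by (intro topological_tendstoD[OF lim]) auto
    then show ?case by eventually_elim (use \<phi>(3) x in blast)
  qed simp
qed

lemma L1_dual_functional:
  assumes "\<phi> \<in> L1_dual M"
  obtains C where "L1_functional M C (\<lambda>f. \<phi> (L1_class M f))"
  using assms unfolding L1_dual_def L1_functional_def by blast

theorem theorem10:
  fixes M :: "'w measure"
    and X :: "'w \<Rightarrow> 'y::{banach, second_countable_topology} \<Rightarrow> real"
    and A :: "'w \<Rightarrow> ('w \<Rightarrow> 'y) set \<Rightarrow> 'y \<Rightarrow> real"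
    and a :: "('w \<Rightarrow> 'y) set \<Rightarrow> real"
    and z :: real
  assumes "finite_measure M" and "complete_measure M" and "separable_measure M"
    and "z \<in> {0<..1}"
    and "fuzzy_mapping (space M) X"
    and "random_fuzzy_mapping M (L_X M X z) A"
    and "\<And>x. x \<in> L_X M X z \<Longrightarrow> a x \<in> {0<..1}"
    and "\<And>\<omega> x. \<omega> \<in> space M \<Longrightarrow> x \<in> L_X M X z \<Longrightarrow> fuzzy_cut (A \<omega> x) (a x) \<subseteq> fuzzy_cut (X \<omega>) z"
    and A1a: "\<And>\<omega>. \<omega> \<in> space M \<Longrightarrow>
          fuzzy_cut (X \<omega>) z \<noteq> {} \<and> convex (fuzzy_cut (X \<omega>) z) \<and> compactin weak_topology (fuzzy_cut (X \<omega>) z)"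
        "integrably_bounded M (\<lambda>\<omega>. fuzzy_cut (X \<omega>) z)"
    and A1b: "lower_measurable M (\<lambda>\<omega>. fuzzy_cut (X \<omega>) z)"
    and A2a: "\<And>\<omega> x. \<omega> \<in> space M \<Longrightarrow> x \<in> L_X M X z \<Longrightarrow>
          fuzzy_cut (A \<omega> x) (a x) \<noteq> {} \<and> convex (fuzzy_cut (A \<omega> x) (a x)) \<and> compact (fuzzy_cut (A \<omega> x) (a x))"
    and A2b: "\<And>x. x \<in> L_X M X z \<Longrightarrow> measurable_graph M (\<lambda>\<omega>. fuzzy_cut (A \<omega> x) (a x))"
    and A2c: "\<And>\<omega>. \<omega> \<in> space M \<Longrightarrow>
          upper_semicontinuous (subtopology (weak_L1_topology M) (L_X M X z))
            (\<lambda>x. fuzzy_cut (A \<omega> x) (a x))"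
  shows "\<exists>x \<in> L_X M X z. L1_selection M (\<lambda>\<omega>. fuzzy_cut (A \<omega> x) (a x)) x"
proof -
  interpret finite_measure M by fact
  define K where "K \<omega> = fuzzy_cut (X \<omega>) z" for \<omega>
  obtain h where h: "integrable M h" "AE \<omega> in M. \<forall>x\<in>K \<omega>. norm x \<le> h \<omega>"
    using A1a(2) unfolding integrably_bounded_def K_def by blast
  obtain \<nu> :: "nat \<Rightarrow> 'y \<Rightarrow> real" where \<nu>: "norming_sequence \<nu>"
    using norming_sequence_exists by blast
  obtain D where D: "D \<subseteq> sets M" "countable D"
    "\<And>A e. A \<in> sets M \<Longrightarrow> e > 0 \<Longrightarrow> \<exists>B\<in>D. emeasure M ((A - B) \<union> (B - A)) < ennreal e"
    using assms(3) unfolding separable_measure_def by blast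
  \<comment> \<open>Density applied to the empty set yields a member, which the enumeration by
    \<open>from_nat_into\<close> requires.\<close>
  have D_ne: "D \<noteq> {}" using D(3)[of "{}" 1] by auto
  interpret C: coordinatized_selections M K "\<lambda>\<omega>. \<bar>h \<omega>\<bar>" \<nu> "from_nat_into D"
  proof
    show "norming_sequence \<nu>" by (rule \<nu>)
    show "convex (K \<omega>)" "compactin weak_topology (K \<omega>)" if "\<omega> \<in> space M" for \<omega>
      using A1a(1)[OF that] by (simp_all add: K_def)
    show "integrable M (\<lambda>\<omega>. \<bar>h \<omega>\<bar>)" using h(1) by simp
    show "0 \<le> \<bar>h \<omega>\<bar>" for \<omega> by simp
    show "AE \<omega> in M. \<forall>x\<in>K \<omega>. norm x \<le> \<bar>h \<omega>\<bar>"
      using h(2) by eventually_elim (auto intro: order_trans[OF _ abs_ge_self])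
    show "from_nat_into D j \<in> sets M" for j
      using from_nat_into[OF D_ne] D(1) by blast
    fix A and \<epsilon> :: real assume A: "A \<in> sets M" and \<epsilon>: "\<epsilon> > 0"
    obtain B where B: "B \<in> D" "emeasure M ((A - B) \<union> (B - A)) < ennreal \<epsilon>"
      using D(3)[OF A \<epsilon>] by blast
    then have "measure M ((A - B) \<union> (B - A)) < \<epsilon>"
      by (simp add: emeasure_eq_measure ennreal_less_iff)
    moreover obtain j where "from_nat_into D j = B"
      using from_nat_into_surj[OF D(2) B(1)] by blast
    ultimately show "\<exists>j. measure M ((A - from_nat_into D j) \<union> (from_nat_into D j - A)) < \<epsilon>"
      by blast
  qed
  have cls: "L1_class M f \<in> L_X M X z" "f \<in> L1_class M f" "L1_class M f \<in> L1_space M" if f: "f \<in> C.Sel" for f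
  proof -
    have int: "integrable M f" by (rule C.Sel_integrable[OF f])
    show mem: "f \<in> L1_class M f" using int by (simp add: L1_class_def L1_rel_def)
    show sp: "L1_class M f \<in> L1_space M"
      unfolding L1_class_def L1_space_def by (rule quotientI) (simp add: int)
    have "AE \<omega> in M. f \<omega> \<in> fuzzy_cut (X \<omega>) z"
      using AE_space by eventually_elim (use C.Sel_in[OF f] K_def in auto)
    then show "L1_class M f \<in> L_X M X z"
      using mem sp L1_selection_iff[OF sp] unfolding L_X_def by blast
  qed
  \<comment> \<open>The correspondence is read on functions through their classes, so a fixed point
    among functions is one for its class.\<close>
  define T where "T x \<omega> = fuzzy_cut (A \<omega> (L1_class M x)) (a (L1_class M x))" for x \<omega>
  have T: "T x \<omega> \<noteq> {} \<and> convex (T x \<omega>) \<and> compact (T x \<omega>)" "T x \<omega> \<subseteq> K \<omega>"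
    if "x \<in> C.Sel" "\<omega> \<in> space M" for x \<omega>
    using A2a[OF that(2) cls(1)[OF that(1)]] assms(8)[OF that(2) cls(1)[OF that(1)]]
    unfolding T_def K_def by simp_all
  have "\<exists>f\<in>C.Sel. \<forall>\<omega>\<in>space M. f \<omega> \<in> T x \<omega>" if x: "x \<in> C.Sel" for x
  proof -
    have "a (L1_class M x) \<in> {0..1}" using assms(7)[OF cls(1)[OF x]] by simp
    \<comment> \<open>For a fixed class the level is a constant in [0,1], so measurability of the
      cuts at fixed levels applies.\<close>
    then have "lower_measurable M (T x)"
      using assms(6) cls(1)[OF x] unfolding random_fuzzy_mapping_def T_def by blast
    then obtain f where "f \<in> borel_measurable M" "\<And>\<omega>. \<omega> \<in> space M \<Longrightarrow> f \<omega> \<in> T x \<omega>"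
      by (rule measurable_selection) (use T(1)[OF x] compact_imp_closed in blast)+
    then show ?thesis using T(2)[OF x] unfolding C.Sel_def by blast
  qed
  then obtain s where s: "\<And>x. x \<in> C.Sel \<Longrightarrow> s x \<in> C.Sel" "\<And>x \<omega>. x \<in> C.Sel \<Longrightarrow> \<omega> \<in> space M \<Longrightarrow> s x \<omega> \<in> T x \<omega>"
    by metis
  have ne: "C.Sel \<noteq> {}"
  proof -
    have "lower_measurable M K" using A1b unfolding K_def .
    then obtain f where "f \<in> borel_measurable M" "\<And>\<omega>. \<omega> \<in> space M \<Longrightarrow> f \<omega> \<in> K \<omega>"
      by (rule measurable_selection) (use A1a(1) weakly_compact_imp_closed in \<open>auto simp: K_def\<close>)
    then show ?thesis unfolding C.Sel_def by blast
  qed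
  obtain x where x: "x \<in> C.Sel" "AE \<omega> in M. x \<omega> \<in> T x \<omega>"
  proof (rule C.fixed_point[of s T])
    fix x y \<omega> V
    assume x: "\<And>n. x n \<in> C.Sel" and y: "y \<in> C.Sel" and \<omega>: "\<omega> \<in> space M" and V: "open V" "T y \<omega> \<subseteq> V"
      and lim: "\<And>C \<Phi>. L1_functional M C \<Phi> \<Longrightarrow> (\<lambda>n. \<Phi> (x n)) \<longlonglongrightarrow> \<Phi> y"
    let ?U = "{c \<in> topspace (subtopology (weak_L1_topology M) (L_X M X z)). fuzzy_cut (A \<omega> c) (a c) \<subseteq> V}"
    have "openin (subtopology (weak_L1_topology M) (L_X M X z)) ?U"
      using A2c[OF \<omega>] V(1) unfolding upper_semicontinuous_def by blast
    then obtain W where W: "openin (weak_L1_topology M) W" "?U = W \<inter> L_X M X z"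
      unfolding openin_subtopology by blast
    have "L1_class M y \<in> ?U"
      using cls[OF y] V(2) by (simp add: topspace_weak_L1_topology T_def)
    then have "L1_class M y \<in> W" using W(2) by blast
    moreover have "(\<lambda>n. \<phi> (L1_class M (x n))) \<longlonglongrightarrow> \<phi> (L1_class M y)" if "\<phi> \<in> L1_dual M" for \<phi>
      using L1_dual_functional[OF that] lim by blast
    ultimately have "\<forall>\<^sub>F n in sequentially. L1_class M (x n) \<in> W"
      using W(1) cls(3)[OF x] unfolding weak_L1_topology_def by (intro initial_topology_eventually)
    then show "\<forall>\<^sub>F n in sequentially. T (x n) \<omega> \<subseteq> V"
    proof eventually_elim
      case (elim n)
      then have "L1_class M (x n) \<in> ?U" using W(2) cls(1)[OF x] by blast
      then show ?case by (simp add: T_def)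
    qed
  qed (use ne s T(1) in auto)
  have "L1_selection M (\<lambda>\<omega>. fuzzy_cut (A \<omega> (L1_class M x)) (a (L1_class M x))) (L1_class M x)"
    using L1_selection_iff[OF cls(3)[OF x(1)]] cls(2)[OF x(1)] x(2) unfolding T_def by blast
  then show ?thesis using cls(1)[OF x(1)] by blast
qed

end
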